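(* For $m = 2$ and every integer $k > 1$, $\mathrm{ATIME}^{op}[\log^k n, m] \subsetneq \mathrm{ATIME}^{op}[\log^{k+1} n, m]$. Moreover, for every integer $m > 2$ and every integer $k > 1$, $\mathrm{ATIME}^{op}[\log^k n, m] \subsetneq \mathrm{ATIME}^{op}[\log^{k+2} n, m]$.
   Context: Throughout, $\log n$ denotes $\log_2 n$ and $\log^k n$ denotes $(\log n)^k$. A random-access Turing machine is a multi-tape Turing machine with a read-only random-access input of length $n+1$ (the input binary string followed by an endmark $\triangleleft$), a fixed number of read-write working tapes, and a read-write input address-tape of length $\lceil\log n\rceil$; at each step the binary number on the address-tape determines which input cell is read (the endmark cell if the number exceeds $n$). A random-access alternating Turing machine is such a machine whose states are partitioned into existential and universal states, with the usual alternating acceptance condition. $\mathrm{ATIME}^{op}[f(n), m]$ is the class of languages of binary strings accepted by a random-access alternating Turing machine that starts in a universal state, makes at most $O(f(n))$ steps on inputs of length $n$, and whose computations have at most $m$ alternating blocks of universal/existential states (i.e. at most $m-1$ alternations). *)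

theory Defs
  imports Complex_Main "HOL-Library.Landau_Symbols"
begin

datatype head_move = Move_Left | Stay | Move_Right

text \<open>
  States and work-tape symbols are coded as natural numbers, the blank being symbol 0.
  An input or address symbol that is read has type \<^typ>\<open>bool option\<close>: on the input,
  \<^term>\<open>None\<close> is the endmark; on the address tape, it signals that the head has moved past
  the last cell.
\<close>

record transition =
  from_state :: nat
  read_input :: "bool option"
  read_addr :: "bool option"
  read_work :: "nat list"
  to_state :: nat
  write_addr :: bool
  move_addr :: head_move
  act_work :: "(nat \<times> head_move) list"

record ratm =
  num_tapes :: nat
  universal :: "nat set"
  existential :: "nat set"
  initial :: nat
  final :: "nat set"
  work_alphabet :: "nat set"
  transitions :: "transition set"

definition states :: "ratm \<Rightarrow> nat set" where
  "states M = universal M \<union> existential M"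

definition wf_transition :: "ratm \<Rightarrow> transition \<Rightarrow> bool" where
  "wf_transition M t \<longleftrightarrow>
     from_state t \<in> states M - final M \<and>
     to_state t \<in> states M \<and>
     length (read_work t) = num_tapes M \<and>
     set (read_work t) \<subseteq> work_alphabet M \<and>
     length (act_work t) = num_tapes M \<and>
     fst ` set (act_work t) \<subseteq> work_alphabet M"

definition wf_ratm :: "ratm \<Rightarrow> bool" where
  "wf_ratm M \<longleftrightarrow>
     finite (states M) \<and>
     universal M \<inter> existential M = {} \<and>
     initial M \<in> states M \<and>
     final M \<subseteq> states M \<and>
     finite (work_alphabet M) \<and> 0 \<in> work_alphabet M \<and>
     finite (transitions M) \<and>
     (\<forall>t \<in> transitions M. wf_transition M t)"

text \<open>A work tape is one-way infinite and given by its contents and its head position.\<close>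

type_synonym work_tape = "(nat \<Rightarrow> nat) \<times> nat"

record config =
  cur_state :: nat
  addr_tape :: "bool list"
  addr_head :: nat
  work_tapes :: "work_tape list"

text \<open>A left move on the leftmost cell leaves the head where it is.\<close>

fun move_head :: "head_move \<Rightarrow> nat \<Rightarrow> nat" where
  "move_head Move_Left p = p - 1"
| "move_head Stay p = p"
| "move_head Move_Right p = Suc p"

fun read_tape :: "work_tape \<Rightarrow> nat" where
  "read_tape (f, p) = f p"

fun act_tape :: "nat \<times> head_move \<Rightarrow> work_tape \<Rightarrow> work_tape" where
  "act_tape (s, d) (f, p) = (f(p := s), move_head d p)"

text \<open>
  The base of the logarithm is 2, and \<open>log 2 0 = 0\<close>, so that the address tape is empty for
  inputs of length at most 1.
\<close>

definition addr_length :: "nat \<Rightarrow> nat" where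
  "addr_length n = nat \<lceil>log 2 (real n)\<rceil>"

text \<open>The leftmost cell of the address tape holds the most significant bit.\<close>

definition addr_value :: "bool list \<Rightarrow> nat" where
  "addr_value bs = horner_sum of_bool 2 (rev bs)"

text \<open>
  Input cells are numbered from 0, so that cell \<open>n\<close> (the last one) is the endmark cell; it is
  also the cell that is read for every larger address.
\<close>

definition input_symbol :: "bool list \<Rightarrow> config \<Rightarrow> bool option" where
  "input_symbol x c =
     (let i = addr_value (addr_tape c) in if i < length x then Some (x ! i) else None)"

definition addr_symbol :: "config \<Rightarrow> bool option" where
  "addr_symbol c =
     (if addr_head c < length (addr_tape c) then Some (addr_tape c ! addr_head c) else None)"

definition init_config :: "ratm \<Rightarrow> bool list \<Rightarrow> config" where
  "init_config M x =
     \<lparr>cur_state = initial M,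
      addr_tape = replicate (addr_length (length x)) False,
      addr_head = 0,
      work_tapes = replicate (num_tapes M) (\<lambda>_. 0, 0)\<rparr>"

text \<open>
  The address tape never changes its length: its head can go at most one position past the
  last cell, and there the list update below has no effect.
\<close>

definition enabled :: "bool list \<Rightarrow> transition \<Rightarrow> config \<Rightarrow> bool" where
  "enabled x t c \<longleftrightarrow>
     from_state t = cur_state c \<and>
     read_input t = input_symbol x c \<and>
     read_addr t = addr_symbol c \<and>
     read_work t = map read_tape (work_tapes c)"

definition apply_transition :: "transition \<Rightarrow> config \<Rightarrow> config" where
  "apply_transition t c =
     \<lparr>cur_state = to_state t,
      addr_tape = (addr_tape c)[addr_head c := write_addr t],
      addr_head = min (move_head (move_addr t) (addr_head c)) (length (addr_tape c)),
      work_tapes = map2 act_tape (act_work t) (work_tapes c)\<rparr>"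

definition step :: "ratm \<Rightarrow> bool list \<Rightarrow> config \<Rightarrow> config \<Rightarrow> bool" where
  "step M x c c' \<longleftrightarrow> (\<exists>t \<in> transitions M. enabled x t c \<and> c' = apply_transition t c)"

inductive accepting :: "ratm \<Rightarrow> bool list \<Rightarrow> config \<Rightarrow> bool" for M x where
  final: "cur_state c \<in> final M \<Longrightarrow> accepting M x c"
| existential: "cur_state c \<in> existential M \<Longrightarrow> step M x c c' \<Longrightarrow> accepting M x c' \<Longrightarrow>
    accepting M x c"
| universal: "cur_state c \<in> universal M \<Longrightarrow> \<exists>c'. step M x c c' \<Longrightarrow>
    \<forall>c'. step M x c c' \<longrightarrow> accepting M x c' \<Longrightarrow> accepting M x c"

definition language :: "ratm \<Rightarrow> bool list set" where
  "language M = {x. accepting M x (init_config M x)}"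

text \<open>
  Computations are finite, possibly partial, paths of configurations; one with \<open>l\<close>
  configurations makes \<open>l - 1\<close> steps.
\<close>

definition computation :: "ratm \<Rightarrow> bool list \<Rightarrow> config list \<Rightarrow> bool" where
  "computation M x cs \<longleftrightarrow>
     cs \<noteq> [] \<and> hd cs = init_config M x \<and> successively (step M x) cs"

definition num_blocks :: "ratm \<Rightarrow> config list \<Rightarrow> nat" where
  "num_blocks M cs = length (remdups_adj (map (\<lambda>c. cur_state c \<in> universal M) cs))"

definition ATIME_op :: "(nat \<Rightarrow> real) \<Rightarrow> nat \<Rightarrow> bool list set set" where
  "ATIME_op f m =
     {language M | M.
        wf_ratm M \<and> initial M \<in> universal M \<and>
        (\<exists>T :: nat \<Rightarrow> nat. (\<lambda>n. real (T n)) \<in> O(f) \<and>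
           (\<forall>x cs. computation M x cs \<longrightarrow> length cs - 1 \<le> T (length x))) \<and>
        (\<forall>x cs. computation M x cs \<longrightarrow> num_blocks M cs \<le> m)}"

end

theory Submission
  imports Defs "HOL-Library.FuncSet" "HOL-Library.Countable"
begin

text \<open>
  The separating language is, up to negation, the parity of polynomially many (in \<open>log n\<close>) input
  bits. Let \<open>s\<close> be of the order of \<open>log n ^ (k + 1)\<close>. The parity of \<open>s ^ m\<close> bits is decided in time
  \<open>O(s)\<close> by a game with \<open>m\<close> blocks: a player claims the parities of the \<open>s\<close> blocks of \<open>s ^ (m - 1)\<close> bits, the opponent
  picks a block with a wrong claim and goes on with the opposite claim for that block, and the
  last player reads \<open>s\<close> bits. Conversely, a machine with \<open>m\<close> blocks and time \<open>t = O(log n ^ k)\<close> is a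
  formula with \<open>m\<close> levels of gates of fan-in \<open>2 ^ O(t)\<close> and bottom terms of width \<open>O(t)\<close>. The
  switching lemma removes one level at the price of a factor \<open>O(t)\<close> in the number of variables,
  and in the end parity would have a conjunctive normal form narrower than its number of
  variables; this bounds that number by \<open>O(t) ^ m\<close>, which is less than \<open>s ^ m\<close>.
\<close>

section \<open>Bounded-depth formulas\<close>

text \<open>For the upper bound the obstacle is to read \<open>s\<close> bits in time
  \<open>O(s)\<close>: an address has about \<open>log n\<close> cells, too many to be written anew
  for each bit. So the address tape itself becomes a counter with unary digits, one counter per
  player, and a sweep over the tape visits a number of addresses proportional to its length. As the
  digits are bounded by the number of their cells, \<open>s\<close> never has to be computed. The
  language is the negation of parity because the first player is universal and claims that the
  parity is odd. For the lower bound, branching over the transitions fixes the configuration, hence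
  the address, so that each step depends on a single input bit and a branch of length
  \<open>t\<close> on \<open>O(t)\<close> bits. Fan-in \<open>2 ^ O(t)\<close> is harmless: the
  proportion of bad restrictions is exponentially small in \<open>w + 1\<close>, where the width
  \<open>w\<close> is of the order of \<open>t\<close>, so a constant \<open>Q\<close> makes up for
  the union bound.\<close>

definition override :: "('v \<rightharpoonup> bool) \<Rightarrow> ('v \<Rightarrow> bool) \<Rightarrow> 'v \<Rightarrow> bool" where
  "override r y v = (case r v of Some b \<Rightarrow> b | None \<Rightarrow> y v)"

text \<open>
  Semantic form of "\<open>f\<close> is a conjunction of clauses with at most \<open>w\<close> literals over \<open>V\<close>": every zero
  of \<open>f\<close> is certified by the values of at most \<open>w\<close> variables.
\<close>

definition cnf :: "'v set \<Rightarrow> nat \<Rightarrow> (('v \<Rightarrow> bool) \<Rightarrow> bool) \<Rightarrow> bool" where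
  "cnf V w f \<longleftrightarrow> (\<forall>y. \<not> f y \<longrightarrow>
     (\<exists>\<beta>\<subseteq>V. finite \<beta> \<and> card \<beta> \<le> w \<and> (\<forall>y'. (\<forall>v\<in>\<beta>. y' v = y v) \<longrightarrow> \<not> f y')))"

text \<open>
  Formulas with \<open>j + 1\<close> levels whose top gate is a conjunction; the disjunctive ones are the
  negations of these, so that one predicate is enough.
\<close>

fun Pi_lev :: "'v set \<Rightarrow> nat \<Rightarrow> nat \<Rightarrow> nat \<Rightarrow> (('v \<Rightarrow> bool) \<Rightarrow> bool) \<Rightarrow> bool" where
  "Pi_lev V w S 0 f = cnf V w f"
| "Pi_lev V w S (Suc j) f =
     (\<exists>G. finite G \<and> G \<noteq> {} \<and> card G \<le> S \<and> (\<forall>g\<in>G. Pi_lev V w S j (\<lambda>y. \<not> g y)) \<and>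
          f = (\<lambda>y. \<forall>g\<in>G. g y))"

lemma cnfE:
  assumes "cnf V w f" "\<not> f y"
  obtains \<beta> where "\<beta> \<subseteq> V" "finite \<beta>" "card \<beta> \<le> w" "\<And>y'. (\<And>v. v \<in> \<beta> \<Longrightarrow> y' v = y v) \<Longrightarrow> \<not> f y'"
proof -
  from assms(1)[unfolded cnf_def, rule_format, OF assms(2)] obtain \<beta> where
    "\<beta> \<subseteq> V" "finite \<beta>" "card \<beta> \<le> w" "\<forall>y'. (\<forall>v\<in>\<beta>. y' v = y v) \<longrightarrow> \<not> f y'"
    by (elim exE conjE)
  then show ?thesis using that by simp
qed

lemma cnfI:
  assumes "\<And>y. \<not> f y \<Longrightarrow> \<exists>\<beta>\<subseteq>V. finite \<beta> \<and> card \<beta> \<le> w \<and> (\<forall>y'. (\<forall>v\<in>\<beta>. y' v = y v) \<longrightarrow> \<not> f y')"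
  shows "cnf V w f"
  unfolding cnf_def by (intro allI impI) (rule assms)

lemma cnf_mono:
  assumes "cnf V w f" "w \<le> w'"
  shows "cnf V w' f"
proof (rule cnfI)
  fix y assume "\<not> f y"
  then obtain \<beta> where "\<beta> \<subseteq> V" "finite \<beta>" "card \<beta> \<le> w" "\<And>y'. (\<And>v. v \<in> \<beta> \<Longrightarrow> y' v = y v) \<Longrightarrow> \<not> f y'"
    using cnfE[OF assms(1)] by metis
  then show "\<exists>\<beta>\<subseteq>V. finite \<beta> \<and> card \<beta> \<le> w' \<and> (\<forall>y'. (\<forall>v\<in>\<beta>. y' v = y v) \<longrightarrow> \<not> f y')"
    using assms(2) by (intro exI[of _ \<beta>]) simp
qed

lemma Pi_lev_mono: "Pi_lev V w S j f \<Longrightarrow> w \<le> w' \<Longrightarrow> S \<le> S' \<Longrightarrow> Pi_lev V w' S' j f"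
proof (induction j arbitrary: f)
  case 0
  then show ?case by (auto intro: cnf_mono)
next
  case (Suc j)
  then obtain G where G: "finite G" "G \<noteq> {}" "card G \<le> S" "\<forall>g\<in>G. Pi_lev V w S j (\<lambda>y. \<not> g y)"
    "f = (\<lambda>y. \<forall>g\<in>G. g y)" by auto
  have "\<forall>g\<in>G. Pi_lev V w' S' j (\<lambda>y. \<not> g y)" using G(4) Suc by blast
  then show ?case using G Suc.prems(3) by (auto intro!: exI[of _ G])
qed

text \<open>A gate with a single input; this is how a change of player adds a level.\<close>

lemma Pi_lev_lift: "Pi_lev V w S j (\<lambda>y. \<not> f y) \<Longrightarrow> S \<ge> 1 \<Longrightarrow> Pi_lev V w S (Suc j) f"
  by (auto intro!: exI[of _ "{f}"])

lemma cnf_const: "cnf V w (\<lambda>_. b)"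
  by (rule cnfI, intro exI[of _ "{}"]) simp

lemma Pi_lev_const: "S \<ge> 1 \<Longrightarrow> Pi_lev V w S j (\<lambda>_. b)"
proof (induction j arbitrary: b)
  case 0
  then show ?case by (simp add: cnf_const)
next
  case (Suc j)
  then show ?case using Pi_lev_lift[OF Suc.IH[of "\<not> b"]] by simp
qed

text \<open>These are the tests that a machine can make in one step from a fixed configuration: the
  address is known, so at most one input bit matters.\<close>

definition junta1 :: "'v set \<Rightarrow> (('v \<Rightarrow> bool) \<Rightarrow> bool) \<Rightarrow> bool" where
  "junta1 V e \<longleftrightarrow> (\<exists>\<beta>\<subseteq>V. finite \<beta> \<and> card \<beta> \<le> 1 \<and> (\<forall>y y'. (\<forall>v\<in>\<beta>. y' v = y v) \<longrightarrow> e y' = e y))"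

lemma junta1_not: "junta1 V e \<Longrightarrow> junta1 V (\<lambda>y. \<not> e y)"
  unfolding junta1_def by auto

lemma cnf_or_junta1:
  assumes "cnf V w f" "junta1 V e"
  shows "cnf V (w + 1) (\<lambda>y. e y \<or> f y)"
  unfolding cnf_def
proof (intro allI impI)
  fix y assume y: "\<not> (e y \<or> f y)"
  obtain \<beta> where \<beta>: "\<beta> \<subseteq> V" "finite \<beta>" "card \<beta> \<le> 1" "\<forall>y y'. (\<forall>v\<in>\<beta>. y' v = y v) \<longrightarrow> e y' = e y"
    using assms(2) unfolding junta1_def by blast
  obtain \<gamma> where \<gamma>: "\<gamma> \<subseteq> V" "finite \<gamma>" "card \<gamma> \<le> w" "\<And>y'. (\<And>v. v \<in> \<gamma> \<Longrightarrow> y' v = y v) \<Longrightarrow> \<not> f y'"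
    using cnfE[OF assms(1)] y by metis
  have "card (\<beta> \<union> \<gamma>) \<le> w + 1"
    using card_Un_le[of \<beta> \<gamma>] \<beta>(3) \<gamma>(3) by linarith
  moreover have "\<forall>y'. (\<forall>v\<in>\<beta> \<union> \<gamma>. y' v = y v) \<longrightarrow> \<not> (e y' \<or> f y')"
    using \<beta>(4) \<gamma>(4) y by (metis UnI1 UnI2)
  ultimately show "\<exists>\<beta>\<subseteq>V. finite \<beta> \<and> card \<beta> \<le> w + 1 \<and> (\<forall>y'. (\<forall>v\<in>\<beta>. y' v = y v) \<longrightarrow> \<not> (e y' \<or> f y'))"
    using \<beta>(1,2) \<gamma>(1,2) by (intro exI[of _ "\<beta> \<union> \<gamma>"]) auto
qed

lemma cnf_and_junta1:
  assumes "cnf V w f" "junta1 V e"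
  shows "cnf V (w + 1) (\<lambda>y. e y \<and> f y)"
  unfolding cnf_def
proof (intro allI impI)
  fix y assume y: "\<not> (e y \<and> f y)"
  show "\<exists>\<beta>\<subseteq>V. finite \<beta> \<and> card \<beta> \<le> w + 1 \<and> (\<forall>y'. (\<forall>v\<in>\<beta>. y' v = y v) \<longrightarrow> \<not> (e y' \<and> f y'))"
  proof (cases "e y")
    case False
    obtain \<beta> where "\<beta> \<subseteq> V" "finite \<beta>" "card \<beta> \<le> 1" "\<forall>y y'. (\<forall>v\<in>\<beta>. y' v = y v) \<longrightarrow> e y' = e y"
      using assms(2) unfolding junta1_def by blast
    with False show ?thesis by (intro exI[of _ \<beta>]) auto
  next
    case True
    then obtain \<gamma> where "\<gamma> \<subseteq> V" "finite \<gamma>" "card \<gamma> \<le> w" "\<And>y'. (\<And>v. v \<in> \<gamma> \<Longrightarrow> y' v = y v) \<Longrightarrow> \<not> f y'"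
      using cnfE[OF assms(1)] y by metis
    then show ?thesis by (intro exI[of _ \<gamma>]) auto
  qed
qed

text \<open>The test is distributed over the top gate and pushed down to the clauses, where it costs
  one unit of width. As a gate of its own it could cost a level.\<close>

lemma Pi_lev_junta1:
  assumes "Pi_lev V w S j f" "junta1 V e"
  shows "Pi_lev V (w + 1) S j (\<lambda>y. e y \<or> f y)" and "Pi_lev V (w + 1) S j (\<lambda>y. e y \<and> f y)"
proof -
  have "Pi_lev V (w + 1) S j (\<lambda>y. e y \<or> f y) \<and> Pi_lev V (w + 1) S j (\<lambda>y. e y \<and> f y)"
    using assms
  proof (induction j arbitrary: f e)
    case 0
    then show ?case using cnf_or_junta1 cnf_and_junta1 by auto
  next
    case (Suc j)
    then obtain G where G: "finite G" "G \<noteq> {}" "card G \<le> S" "\<forall>g\<in>G. Pi_lev V w S j (\<lambda>y. \<not> g y)"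
      "f = (\<lambda>y. \<forall>g\<in>G. g y)" by auto
    have IH: "Pi_lev V (w + 1) S j (\<lambda>y. \<not> (e y \<or> g y))" "Pi_lev V (w + 1) S j (\<lambda>y. \<not> (e y \<and> g y))"
      if "g \<in> G" for g
      using Suc.IH[OF G(4)[rule_format, OF that] junta1_not[OF Suc.prems(2)]] by auto
    let ?G1 = "(\<lambda>g y. e y \<or> g y) ` G" and ?G2 = "(\<lambda>g y. e y \<and> g y) ` G"
    have "card ?G1 \<le> S" "card ?G2 \<le> S"
      using card_image_le[OF G(1)] G(3) order_trans by blast+
    then have "Pi_lev V (w + 1) S (Suc j) (\<lambda>y. \<forall>g\<in>?G1. g y)" "Pi_lev V (w + 1) S (Suc j) (\<lambda>y. \<forall>g\<in>?G2. g y)"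
      unfolding Pi_lev.simps using G(1,2) IH by (intro exI[of _ ?G1] exI[of _ ?G2]; auto)+
    moreover have "(\<lambda>y. \<forall>g\<in>?G1. g y) = (\<lambda>y. e y \<or> f y)" "(\<lambda>y. \<forall>g\<in>?G2. g y) = (\<lambda>y. e y \<and> f y)"
      using G(2) unfolding G(5) by auto
    ultimately show ?case by metis
  qed
  then show "Pi_lev V (w + 1) S j (\<lambda>y. e y \<or> f y)" "Pi_lev V (w + 1) S j (\<lambda>y. e y \<and> f y)" by auto
qed

lemma cnf_Ball:
  assumes "\<And>i. i \<in> I \<Longrightarrow> cnf V w (f i)"
  shows "cnf V w (\<lambda>y. \<forall>i\<in>I. f i y)"
proof (rule cnfI)
  fix y assume "\<not> (\<forall>i\<in>I. f i y)"
  then obtain i where i: "i \<in> I" "\<not> f i y" by blast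
  from cnfE[OF assms[OF i(1)] i(2)] obtain \<beta> where
    "\<beta> \<subseteq> V" "finite \<beta>" "card \<beta> \<le> w" "\<And>y'. (\<And>v. v \<in> \<beta> \<Longrightarrow> y' v = y v) \<Longrightarrow> \<not> f i y'"
    by metis
  then show "\<exists>\<beta>\<subseteq>V. finite \<beta> \<and> card \<beta> \<le> w \<and> (\<forall>y'. (\<forall>v\<in>\<beta>. y' v = y v) \<longrightarrow> \<not> (\<forall>i\<in>I. f i y'))"
    using i(1) by (intro exI[of _ \<beta>]) blast
qed

text \<open>Conjunctions merge into the top gate, so consecutive steps of one player multiply the
  fan-in but add no level. At level 0 the clauses just accumulate, since \<open>cnf\<close> bounds
  only their width.\<close>

lemma Pi_lev_Ball:
  assumes "finite I" "I \<noteq> {}" "card I \<le> K" "\<And>i. i \<in> I \<Longrightarrow> Pi_lev V w S j (f i)"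
  shows "Pi_lev V w (K * S) j (\<lambda>y. \<forall>i\<in>I. f i y)"
proof (cases j)
  case 0
  then show ?thesis using assms by (auto intro: cnf_Ball)
next
  case (Suc i)
  have "\<forall>a\<in>I. \<exists>G. finite G \<and> G \<noteq> {} \<and> card G \<le> S \<and> (\<forall>g\<in>G. Pi_lev V w S i (\<lambda>y. \<not> g y)) \<and>
          f a = (\<lambda>y. \<forall>g\<in>G. g y)"
    using assms(4) Suc by simp
  from bchoice[OF this] obtain G where G: "\<forall>a\<in>I. finite (G a) \<and> G a \<noteq> {} \<and> card (G a) \<le> S \<and>
      (\<forall>g\<in>G a. Pi_lev V w S i (\<lambda>y. \<not> g y)) \<and> f a = (\<lambda>y. \<forall>g\<in>G a. g y)"
    by (elim exE)
  have K: "K \<ge> 1" using assms(1-3) by (metis One_nat_def Suc_leI card_gt_0_iff order_less_le_trans)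
  have "card (\<Union>a\<in>I. G a) \<le> (\<Sum>a\<in>I. card (G a))" by (simp add: assms(1) card_UN_le)
  also have "\<dots> \<le> card I * S" using sum_bounded_above[of I "\<lambda>a. card (G a)" S] G by simp
  also have "\<dots> \<le> K * S" using assms(3) by simp
  finally have c: "card (\<Union>a\<in>I. G a) \<le> K * S" .
  have "\<forall>g\<in>(\<Union>a\<in>I. G a). Pi_lev V w (K * S) i (\<lambda>y. \<not> g y)"
  proof
    fix g assume "g \<in> (\<Union>a\<in>I. G a)"
    then have "Pi_lev V w S i (\<lambda>y. \<not> g y)" using G by blast
    then show "Pi_lev V w (K * S) i (\<lambda>y. \<not> g y)" by (rule Pi_lev_mono) (use K in simp_all)
  qed
  then show ?thesis
    using G assms(1,2) c Suc by (auto intro!: exI[of _ "\<Union>a\<in>I. G a"] simp: fun_eq_iff)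
qed

section \<open>The switching lemma\<close>

definition falsified :: "('v \<rightharpoonup> bool) \<Rightarrow> ('v \<rightharpoonup> bool) \<Rightarrow> bool" where
  "falsified C r \<longleftrightarrow> (\<exists>v\<in>dom C \<inter> dom r. C v \<noteq> r v)"

definition first_alive :: "('v \<rightharpoonup> bool) list \<Rightarrow> ('v \<rightharpoonup> bool) \<Rightarrow> ('v \<rightharpoonup> bool) option" where
  "first_alive F r = find (\<lambda>C. \<not> falsified C r) F"

lemma falsified_mono: "falsified C r \<Longrightarrow> r \<subseteq>\<^sub>m r' \<Longrightarrow> falsified C r'"
  unfolding falsified_def map_le_def by (metis IntE IntI domIff)

lemma first_alive_Some:
  "first_alive F r = Some C \<longleftrightarrow>
     (\<exists>i<length F. F ! i = C \<and> \<not> falsified C r \<and> (\<forall>j<i. falsified (F ! j) r))"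
  unfolding first_alive_def find_Some_iff by auto

lemma first_alive_extend:
  assumes "first_alive F r = Some C" "r \<subseteq>\<^sub>m r'" "\<not> falsified C r'"
  shows "first_alive F r' = Some C"
  using assms falsified_mono unfolding first_alive_Some by blast

text \<open>
  \<open>deep F y r n\<close>: the path of the canonical decision tree of the disjunction \<open>F\<close> under \<open>r\<close> that
  follows \<open>y\<close> queries at least \<open>n\<close> variables. It is cut after exactly \<open>n\<close> of them, so the last
  block \<open>\<beta>\<close> may be an arbitrary part of the free variables of its term.
\<close>

inductive deep :: "('v \<rightharpoonup> bool) list \<Rightarrow> ('v \<Rightarrow> bool) \<Rightarrow> ('v \<rightharpoonup> bool) \<Rightarrow> nat \<Rightarrow> bool" for F y where
  deep_0: "deep F y r 0"
| deep_step: "first_alive F r = Some C \<Longrightarrow> \<beta> \<subseteq> dom C - dom r \<Longrightarrow> finite \<beta> \<Longrightarrow> \<beta> \<noteq> {} \<Longrightarrow>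
    n = 0 \<or> \<beta> = dom C - dom r \<Longrightarrow> deep F y (r ++ (Some \<circ> y) |` \<beta>) n \<Longrightarrow> deep F y r (n + card \<beta>)"

text \<open>Walk down the decision tree along \<open>y\<close>. The first alive term has free
  variables, because \<open>y\<close> falsifies it and \<open>r\<close> does not. Querying them all
  either uses up the budget \<open>n\<close> or leads on with a smaller budget; a walk that ends
  early ends with all terms falsified, and the queried variables are the certificate.\<close>

lemma deep_or_certificate:
  assumes "finite V" "\<And>C. C \<in> set F \<Longrightarrow> dom C \<subseteq> V" "\<And>C. C \<in> set F \<Longrightarrow> falsified C (Some \<circ> y)"
    and "r \<subseteq>\<^sub>m (Some \<circ> y)"
  shows "deep F y r n \<or>
    (\<exists>\<beta>\<subseteq>V - dom r. card \<beta> < n \<and> (\<forall>C\<in>set F. falsified C (r ++ (Some \<circ> y) |` \<beta>)))"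
  using assms(4)
proof (induction n arbitrary: r rule: less_induct)
  case (less n)
  show ?case
  proof (cases "n = 0")
    case True
    then show ?thesis by (simp add: deep_0)
  next
    case n0: False
    show ?thesis
    proof (cases "first_alive F r")
      case None
      then have "\<forall>C\<in>set F. falsified C r" unfolding first_alive_def by (auto simp: find_None_iff)
      then have "\<forall>C\<in>set F. falsified C (r ++ (Some \<circ> y) |` {})" by simp
      then show ?thesis using n0 by (metis card.empty empty_subsetI gr0I)
    next
      case (Some C)
      let ?\<delta> = "dom C - dom r"
      have C: "C \<in> set F" "\<not> falsified C r" using Some unfolding first_alive_Some by auto
      have fin: "finite ?\<delta>" using assms(1,2) C(1) by (meson finite_Diff finite_subset)
      have ne: "?\<delta> \<noteq> {}"
      proof
        assume e: "?\<delta> = {}"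
        obtain v where v: "v \<in> dom C" "C v \<noteq> Some (y v)"
          using assms(3)[OF C(1)] unfolding falsified_def by auto
        then have "v \<in> dom r" using e by auto
        then have "r v = Some (y v)" using less.prems by (auto simp: map_le_def)
        then show False using v C(2) \<open>v \<in> dom r\<close> unfolding falsified_def by auto
      qed
      show ?thesis
      proof (cases "card ?\<delta> \<ge> n")
        case True
        then obtain \<beta> where \<beta>: "\<beta> \<subseteq> ?\<delta>" "card \<beta> = n" by (meson obtain_subset_with_card_n)
        \<comment> \<open>The budget ends inside this term: with remaining depth 0 the rule admits a
          partial block.\<close>
        have "deep F y r (0 + card \<beta>)"
          by (rule deep_step[OF Some \<beta>(1)]) (use \<beta> n0 fin finite_subset in \<open>auto simp: deep_0\<close>)
        then show ?thesis using \<beta> by simp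
      next
        case False
        let ?r1 = "r ++ (Some \<circ> y) |` ?\<delta>"
        have cpos: "card ?\<delta> > 0" using fin ne by (simp add: card_gt_0_iff)
        have le: "?r1 \<subseteq>\<^sub>m (Some \<circ> y)"
          using less.prems by (auto simp: map_le_def map_add_def restrict_map_def split: option.splits if_splits)
        consider "deep F y ?r1 (n - card ?\<delta>)"
          | \<beta> where "\<beta> \<subseteq> V - dom ?r1" "card \<beta> < n - card ?\<delta>"
            "\<forall>C\<in>set F. falsified C (?r1 ++ (Some \<circ> y) |` \<beta>)"
          using less.IH[of "n - card ?\<delta>", OF _ le] cpos n0 by (metis diff_less gr0I)
        then show ?thesis
        proof cases
          case 1
          have "deep F y r ((n - card ?\<delta>) + card ?\<delta>)"
            by (rule deep_step[OF Some order_refl fin ne _ 1]) simp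
          then show ?thesis using False by simp
        next
          case 2
          have "card (?\<delta> \<union> \<beta>) < n" using card_Un_le[of ?\<delta> \<beta>] 2(2) by linarith
          moreover have "?r1 ++ (Some \<circ> y) |` \<beta> = r ++ (Some \<circ> y) |` (?\<delta> \<union> \<beta>)"
            by (auto simp: fun_eq_iff map_add_def restrict_map_def)
          moreover have "?\<delta> \<union> \<beta> \<subseteq> V - dom r" using 2(1) assms(2)[OF C(1)] by auto
          ultimately show ?thesis using 2(3) by metis
        qed
      qed
    qed
  qed
qed

section \<open>Encoding of restrictions with a deep path\<close>

definition term_vars :: "('v \<rightharpoonup> bool) \<Rightarrow> 'v list" where
  "term_vars C = (SOME l. set l = dom C \<and> distinct l)"

lemma term_vars: "finite (dom C) \<Longrightarrow> set (term_vars C) = dom C \<and> distinct (term_vars C)"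
  unfolding term_vars_def using finite_distinct_list[of "dom C"] by (rule someI_ex) 

text \<open>A code names a variable by its place in \<open>term_vars C\<close>, an index below
  \<open>w\<close>. This keeps the number of codes independent of the number of variables.\<close>

definition block_map :: "('v \<rightharpoonup> bool) \<Rightarrow> (nat \<times> bool) list \<Rightarrow> ('v \<rightharpoonup> bool)" where
  "block_map C b = map_of (map (\<lambda>(i, a). (term_vars C ! i, a)) b)"

text \<open>
  A restriction with a deep path is encoded by its extension satisfying all terms on the path.
  In the extension the first alive term is still the first term of the path; once the code has
  replaced the satisfying values by those of the path, the next term of the path shows up.
  The result is the set of variables to be freed again.
\<close>

fun decode :: "('v \<rightharpoonup> bool) list \<Rightarrow> (nat \<times> bool) list list \<Rightarrow> ('v \<rightharpoonup> bool) \<Rightarrow> 'v set" where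
  "decode F [] r = {}"
| "decode F (b # bs) r =
     (case first_alive F r of None \<Rightarrow> {}
      | Some C \<Rightarrow> dom (block_map C b) \<union> decode F bs (r ++ block_map C b))"

definition codes :: "nat \<Rightarrow> nat \<Rightarrow> (nat \<times> bool) list list set" where
  "codes w n = {bs. (\<forall>b\<in>set bs. b \<noteq> [] \<and> set b \<subseteq> {..<w} \<times> UNIV) \<and> sum_list (map length bs) = n}"

lemma codes_0: "codes w 0 = {[]}"
  by (auto simp: codes_def)

lemma codes_step:
  assumes "n > 0"
  shows "codes w n \<subseteq> (\<Union>j\<in>{1..n}. (\<lambda>(b, bs). b # bs) `
           ({b. set b \<subseteq> {..<w} \<times> UNIV \<and> length b = j} \<times> codes w (n - j)))"
proof
  fix bs assume bs: "bs \<in> codes w n"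
  with assms obtain b bs' where [simp]: "bs = b # bs'" by (cases bs) (auto simp: codes_def)
  have "b \<noteq> []" "set b \<subseteq> {..<w} \<times> UNIV" "length b \<le> n" "bs' \<in> codes w (n - length b)"
    using bs by (auto simp: codes_def)
  then show "bs \<in> (\<Union>j\<in>{1..n}. (\<lambda>(b, bs). b # bs) `
           ({b. set b \<subseteq> {..<w} \<times> UNIV \<and> length b = j} \<times> codes w (n - j)))"
    by (auto intro!: bexI[of _ "length b"] image_eqI[of _ _ "(b, bs')"] simp: Suc_le_eq)
qed

text \<open>The \<open>n\<close> pairs have \<open>2 * w\<close> values each, and the division into
  nonempty blocks contributes at most another factor \<open>2 ^ n\<close>.\<close>

lemma card_codes: "finite (codes w n) \<and> card (codes w n) \<le> (4 * w) ^ n"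
proof (induction n rule: less_induct)
  case (less n)
  show ?case
  proof (cases "n = 0")
    case True
    then show ?thesis by (simp add: codes_0)
  next
    case False
    let ?B = "\<lambda>j. {b :: (nat \<times> bool) list. set b \<subseteq> {..<w} \<times> UNIV \<and> length b = j}"
    let ?A = "\<lambda>j. (\<lambda>(b, bs). b # bs) ` (?B j \<times> codes w (n - j))"
    have finB: "finite (?B j)" and cardB: "card (?B j) = (2 * w) ^ j" for j
      using finite_lists_length_eq[of "{..<w} \<times> (UNIV :: bool set)" j]
        card_lists_length_eq[of "{..<w} \<times> (UNIV :: bool set)" j] by (auto simp: card_cartesian_product)
    have finA: "finite (?A j)" and cardA: "card (?A j) \<le> (2 * w) ^ j * (4 * w) ^ (n - j)" if "j \<in> {1..n}" for j
    proof -
      have IH: "finite (codes w (n - j))" "card (codes w (n - j)) \<le> (4 * w) ^ (n - j)"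
        using less.IH[of "n - j"] that by auto
      show "finite (?A j)" using IH finB by blast
      have "card (?A j) \<le> card (?B j \<times> codes w (n - j))"
        by (rule card_image_le) (use IH finB in blast)
      also have "\<dots> \<le> (2 * w) ^ j * (4 * w) ^ (n - j)"
        by (simp only: card_cartesian_product cardB) (use IH in \<open>auto intro: mult_le_mono\<close>)
      finally show "card (?A j) \<le> (2 * w) ^ j * (4 * w) ^ (n - j)" .
    qed
    have sub: "codes w n \<subseteq> (\<Union>j\<in>{1..n}. ?A j)" using codes_step False by blast
    have fin: "finite (\<Union>j\<in>{1..n}. ?A j)" using finA by blast
    have geo: "(\<Sum>j\<in>{1..n}. (2::nat) ^ (n - j)) < 2 ^ n" for n
      by (induction n) (auto simp: sum.atLeast_Suc_atMost Suc_diff_le sum_distrib_left[symmetric] sum.cl_ivl_Suc)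
    have "card (codes w n) \<le> card (\<Union>j\<in>{1..n}. ?A j)" by (rule card_mono[OF fin sub])
    also have "\<dots> \<le> (\<Sum>j\<in>{1..n}. card (?A j))" by (rule card_UN_le) simp
    also have "\<dots> \<le> (\<Sum>j\<in>{1..n}. (2 * w) ^ j * (4 * w) ^ (n - j))" by (rule sum_mono) (rule cardA)
    also have "\<dots> = (\<Sum>j\<in>{1..n}. (2 * w) ^ n * 2 ^ (n - j))"
    proof (rule sum.cong[OF refl])
      fix j assume "j \<in> {1..n}"
      then have "(2 * w) ^ n = (2 * w) ^ j * (2 * w) ^ (n - j)" by (metis atLeastAtMost_iff le_add_diff_inverse power_add)
      moreover have "(4 * w) ^ (n - j) = (2 * w) ^ (n - j) * 2 ^ (n - j)"
        using power_mult_distrib[of "2 * w" 2 "n - j"] by simp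
      ultimately show "(2 * w) ^ j * (4 * w) ^ (n - j) = (2 * w) ^ n * 2 ^ (n - j)" by simp
    qed
    also have "\<dots> \<le> (2 * w) ^ n * 2 ^ n" using geo[of n] by (simp add: sum_distrib_left[symmetric])
    also have "\<dots> = (2 * w * 2) ^ n" by (rule power_mult_distrib[symmetric])
    also have "\<dots> = (4 * w) ^ n" by simp
    finally show ?thesis using finite_subset[OF sub fin] by simp
  qed
qed

lemma block_map_exists:
  assumes "finite (dom C)" "card (dom C) \<le> w" "\<beta> \<subseteq> dom C" "\<beta> \<noteq> {}"
  obtains b where "block_map C b = (Some \<circ> y) |` \<beta>" "set b \<subseteq> {..<w} \<times> UNIV" "length b = card \<beta>" "b \<noteq> []"
proof -
  have tv: "set (term_vars C) = dom C" "distinct (term_vars C)" using term_vars[OF assms(1)] by auto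
  have len: "length (term_vars C) \<le> w" using tv assms(2) distinct_card by metis
  have "finite \<beta>" using assms(1,3) finite_subset by blast
  then obtain l where l: "set l = \<beta>" "distinct l" using finite_distinct_list by blast
  have "\<forall>v\<in>set l. \<exists>i<length (term_vars C). term_vars C ! i = v"
    using l assms(3) tv(1) by (metis in_set_conv_nth subsetD)
  then obtain ix where ix: "\<And>v. v \<in> set l \<Longrightarrow> ix v < length (term_vars C) \<and> term_vars C ! ix v = v"
    by metis
  let ?b = "map (\<lambda>v. (ix v, y v)) l"
  have "map (\<lambda>(i, a). (term_vars C ! i, a)) ?b = map (\<lambda>v. (v, y v)) l"
    using ix by auto
  then have "block_map C ?b = (Some \<circ> y) |` \<beta>"
    unfolding block_map_def using l map_of_map_restrict[of y l] by metis
  moreover have "set ?b \<subseteq> {..<w} \<times> UNIV" using ix len by (auto intro: order_less_le_trans)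
  moreover have "length ?b = card \<beta>" using l distinct_card by fastforce
  moreover have "?b \<noteq> []" using assms(4) l(1) by auto
  ultimately show ?thesis by (rule that)
qed

text \<open>\<open>\<pi>\<close> gives each block the values that satisfy its term, not those of
  \<open>y\<close>. Under \<open>r ++ \<pi>\<close> the first alive term is still \<open>C\<close>:
  the terms before it stay falsified, and later blocks avoid its variables. So \<open>decode\<close>
  finds \<open>C\<close>, puts back the values of \<open>y\<close> on the block and continues as in
  the induction hypothesis.\<close>

lemma deep_encode:
  assumes "\<And>C. C \<in> set F \<Longrightarrow> finite (dom C) \<and> dom C \<subseteq> V \<and> card (dom C) \<le> w"
    and "deep F y r n"
  shows "\<exists>\<pi>. \<exists>bs\<in>codes w n. dom \<pi> \<inter> dom r = {} \<and> dom \<pi> \<subseteq> V \<and> finite (dom \<pi>) \<and> card (dom \<pi>) = n \<and>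
           decode F bs (r ++ \<pi>) = dom \<pi>"
  using assms(2)
proof (induction r n rule: deep.induct)
  case (deep_0 r)
  show ?case by (rule exI[of _ Map.empty]) (simp add: codes_0)
next
  case (deep_step r C \<beta> n)
  let ?a = "(Some \<circ> y) |` \<beta>"
  have CF: "C \<in> set F" using deep_step(1) unfolding first_alive_Some by auto
  have C: "finite (dom C)" "dom C \<subseteq> V" "card (dom C) \<le> w" using assms(1)[OF CF] by auto
  have doma: "dom ?a = \<beta>" by auto
  obtain \<pi>1 bs where IH: "bs \<in> codes w n" "dom \<pi>1 \<inter> dom (r ++ ?a) = {}" "dom \<pi>1 \<subseteq> V" "finite (dom \<pi>1)"
    "card (dom \<pi>1) = n" "decode F bs (r ++ ?a ++ \<pi>1) = dom \<pi>1"
    using deep_step.IH by blast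
  obtain b where b: "block_map C b = ?a" "set b \<subseteq> {..<w} \<times> UNIV" "length b = card \<beta>" "b \<noteq> []"
    using block_map_exists[OF C(1,3) _ deep_step(4)] deep_step(2) by (metis Diff_subset order_trans)
  let ?\<pi> = "C |` \<beta> ++ \<pi>1"
  have domC\<beta>: "dom (C |` \<beta>) = \<beta>" using deep_step(2) by auto
  have dom\<pi>: "dom ?\<pi> = \<beta> \<union> dom \<pi>1" using domC\<beta> by auto
  have disj: "\<beta> \<inter> dom \<pi>1 = {}" "dom r \<inter> dom \<pi>1 = {}" "\<beta> \<inter> dom r = {}"
    using IH(2) doma deep_step(2) by auto
  have "\<not> falsified C (r ++ ?\<pi>)"
  proof
    assume "falsified C (r ++ ?\<pi>)"
    then obtain v where v: "v \<in> dom C" "v \<in> dom (r ++ ?\<pi>)" "C v \<noteq> (r ++ ?\<pi>) v"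
      unfolding falsified_def by auto
    consider "v \<in> \<beta>" | "v \<in> dom r" | "v \<in> dom \<pi>1" using v(2) dom\<pi> by auto
    then show False
    proof cases
      case 1
      then have "(r ++ ?\<pi>) v = C v" using disj deep_step(2)
        by (auto simp: map_add_def restrict_map_def domIff split: option.splits)
      then show False using v by simp
    next
      case 2
      then have "(r ++ ?\<pi>) v = r v" using disj
        by (metis (no_types, lifting) Int_iff Un_iff dom\<pi> empty_iff map_add_dom_app_simps(3))
      then have "falsified C r" using v 2 unfolding falsified_def by auto
      then show False using deep_step(1) unfolding first_alive_Some by auto
    next
      case 3
      \<comment> \<open>A block may miss free variables of \<open>C\<close> only if it is the last
        one, and then \<open>\<pi>1\<close> is empty.\<close>
      then have "n \<noteq> 0" using IH(4,5) card_gt_0_iff by blast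
      then have "\<beta> = dom C - dom r" using deep_step(5) by blast
      then show False using 3 v(1) disj by auto
    qed
  qed
  then have fa: "first_alive F (r ++ ?\<pi>) = Some C"
    by (rule first_alive_extend[OF deep_step(1), rotated])
      (use disj domC\<beta> in \<open>auto simp: map_le_def map_add_def restrict_map_def disjoint_iff domIff split: option.splits\<close>)
  have eq: "r ++ ?\<pi> ++ ?a = r ++ ?a ++ \<pi>1"
  proof
    fix v
    show "(r ++ ?\<pi> ++ ?a) v = (r ++ ?a ++ \<pi>1) v"
    proof (cases "v \<in> \<beta>")
      case True
      then have "\<pi>1 v = None" using disj by blast
      then show ?thesis using True by (simp add: map_add_def)
    next
      case False
      then have "?a v = None" "(C |` \<beta>) v = None" by auto
      then show ?thesis by (simp add: map_add_def split: option.splits)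
    qed
  qed
  have "decode F (b # bs) (r ++ ?\<pi>) = dom ?\<pi>"
    using fa b(1) eq IH(6) doma dom\<pi> by simp
  moreover have "b # bs \<in> codes w (n + card \<beta>)" using IH(1) b by (auto simp: codes_def)
  moreover have "card (dom ?\<pi>) = n + card \<beta>"
    unfolding dom\<pi> using disj(1) IH(4,5) deep_step(3) by (simp add: card_Un_disjoint)
  ultimately show ?case
    using dom\<pi> disj IH(3,4) deep_step(2,3) C(2)
    by (intro exI[of _ ?\<pi>] bexI[of _ "b # bs"]) auto
qed

section \<open>Counting restrictions\<close>

definition restrictions :: "'v set \<Rightarrow> nat \<Rightarrow> ('v \<rightharpoonup> bool) set" where
  "restrictions V l = {r. dom r \<subseteq> V \<and> card (V - dom r) = l}"

lemma finite_restrictions: "finite V \<Longrightarrow> finite (restrictions V l)"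
proof -
  assume V: "finite V"
  have "restrictions V l \<subseteq> (\<Union>A\<in>Pow V. {m. dom m = A \<and> ran m \<subseteq> (UNIV :: bool set)})"
    by (auto simp: restrictions_def)
  moreover have "finite (\<Union>A\<in>Pow V. {m. dom m = A \<and> ran m \<subseteq> (UNIV :: bool set)})"
    using V by (intro finite_UN_I finite_set_of_finite_maps) (auto intro: finite_subset)
  ultimately show ?thesis using finite_subset by blast
qed

lemma card_maps_bool: "finite A \<Longrightarrow> card {m :: 'v \<rightharpoonup> bool. dom m = A} = 2 ^ card A"
proof -
  assume A: "finite A"
  have "bij_betw (\<lambda>m. {v\<in>A. m v = Some True}) {m :: 'v \<rightharpoonup> bool. dom m = A} (Pow A)"
  proof (rule bij_betwI[where g = "\<lambda>B v. if v \<in> A then Some (v \<in> B) else None"])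
    show "(\<lambda>B v. if v \<in> A then Some (v \<in> B) else None) \<in> Pow A \<rightarrow> {m :: 'v \<rightharpoonup> bool. dom m = A}"
      by (auto split: if_splits)
    fix m :: "'v \<rightharpoonup> bool" assume m: "m \<in> {m. dom m = A}"
    show "(\<lambda>v. if v \<in> A then Some (v \<in> {v \<in> A. m v = Some True}) else None) = m"
    proof
      fix v
      show "(if v \<in> A then Some (v \<in> {v \<in> A. m v = Some True}) else None) = m v"
      proof (cases "m v")
        case None
        then show ?thesis using m by auto
      next
        case (Some b)
        then show ?thesis using m by (cases b) auto
      qed
    qed
  qed auto
  from bij_betw_same_card[OF this] show ?thesis using A by (simp add: card_Pow)
qed

lemma card_restrictions:
  assumes "finite V" "l \<le> card V"
  shows "card (restrictions V l) = (card V choose l) * 2 ^ (card V - l)"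
proof -
  let ?D = "{A. A \<subseteq> V \<and> card A = card V - l}"
  have star: "card (V - A) = l \<longleftrightarrow> card A = card V - l" if "A \<subseteq> V" for A
    using that assms card_Diff_subset[of A V] card_mono[of V A] finite_subset[of A V] by auto
  have eq: "restrictions V l = (\<Union>A\<in>?D. {m. dom m = A})"
    using star unfolding restrictions_def by auto
  have fD: "finite ?D" using assms by auto
  have cm: "card {m :: _ \<rightharpoonup> bool. dom m = A} = 2 ^ (card V - l)" if "A \<in> ?D" for A
    using that assms(1) finite_subset[of A V] card_maps_bool[of A] by simp
  have fm: "finite {m :: _ \<rightharpoonup> bool. dom m = A}" if "A \<in> ?D" for A
    using cm[OF that] card.infinite[of "{m :: _ \<rightharpoonup> bool. dom m = A}"] by fastforce
  have "card (restrictions V l) = (\<Sum>A\<in>?D. card {m :: _ \<rightharpoonup> bool. dom m = A})"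
    unfolding eq by (rule card_UN_disjoint[OF fD]) (use fm in auto)
  also have "\<dots> = (\<Sum>A\<in>?D. 2 ^ (card V - l))"
    by (rule sum.cong[OF refl]) (rule cm)
  also have "\<dots> = (card V choose (card V - l)) * 2 ^ (card V - l)"
    using n_subsets[OF assms(1)] by simp
  finally show ?thesis using binomial_symmetric[OF assms(2)] by simp
qed

text \<open>\<open>N choose (i - 1)\<close> is \<open>N choose i\<close> times
  \<open>i / (N - i + 1)\<close>; for \<open>i \<le> l\<close> each of the \<open>n\<close> steps
  thus costs at most \<open>l / (N - l)\<close>. The product form avoids the division.\<close>

lemma binomial_ratio:
  assumes "l \<le> N" "n \<le> l"
  shows "(N choose (l - n)) * (N - l) ^ n \<le> (N choose l) * l ^ n"
  using assms(2)
proof (induction n)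
  case 0
  then show ?case by simp
next
  case (Suc n)
  have s: "l - n = Suc (l - Suc n)" using Suc.prems by simp
  have "(l - n) * (N choose (l - n)) = (N - (l - Suc n)) * (N choose (l - Suc n))"
    unfolding s using binomial_absorb_comp[of N "l - Suc n"] by (metis Suc_times_binomial_add binomial_absorption diff_Suc_1 mult.commute)
  then have e: "(N choose (l - Suc n)) * (N - (l - Suc n)) = (N choose (l - n)) * (l - n)"
    by (simp add: mult.commute)
  have "(N choose (l - Suc n)) * (N - l) ^ Suc n
      \<le> ((N choose (l - Suc n)) * (N - (l - Suc n))) * (N - l) ^ n"
    by (simp only: mult.assoc power_Suc) (intro mult_le_mono order_refl, simp)
  also have "\<dots> = (N choose (l - n)) * (N - l) ^ n * (l - n)" unfolding e by simp
  also have "\<dots> \<le> (N choose l) * l ^ n * l" using Suc by (intro mult_le_mono[of "(N choose (l - n)) * (N - l) ^ n"]) auto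
  finally show ?case by (simp add: ac_simps)
qed

text \<open>The extended restriction and the code together determine \<open>r\<close>: decoding
  yields the added variables, and freeing them undoes the extension.\<close>

lemma card_deep_le:
  assumes "finite V" "\<And>C. C \<in> set F \<Longrightarrow> dom C \<subseteq> V \<and> card (dom C) \<le> w" "n \<le> l"
  shows "card {r \<in> restrictions V l. \<exists>y. deep F y r n} \<le> card (restrictions V (l - n)) * (4 * w) ^ n"
    (is "card ?B \<le> _")
proof -
  have F: "finite (dom C) \<and> dom C \<subseteq> V \<and> card (dom C) \<le> w" if "C \<in> set F" for C
    using assms(1) assms(2)[OF that] finite_subset by blast
  have "\<forall>r\<in>?B. \<exists>p. snd p \<in> codes w n \<and> dom (fst p) \<inter> dom r = {} \<and> dom (fst p) \<subseteq> V \<and>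
          finite (dom (fst p)) \<and> card (dom (fst p)) = n \<and> decode F (snd p) (r ++ fst p) = dom (fst p)"
  proof
    fix r assume "r \<in> ?B"
    then obtain y where "deep F y r n" by blast
    from deep_encode[OF F this] show "\<exists>p. snd p \<in> codes w n \<and> dom (fst p) \<inter> dom r = {} \<and> dom (fst p) \<subseteq> V \<and>
          finite (dom (fst p)) \<and> card (dom (fst p)) = n \<and> decode F (snd p) (r ++ fst p) = dom (fst p)"
      by (metis fst_conv snd_conv)
  qed
  from bchoice[OF this] obtain p where p: "\<forall>r\<in>?B. snd (p r) \<in> codes w n \<and> dom (fst (p r)) \<inter> dom r = {} \<and>
      dom (fst (p r)) \<subseteq> V \<and> finite (dom (fst (p r))) \<and> card (dom (fst (p r))) = n \<and>
      decode F (snd (p r)) (r ++ fst (p r)) = dom (fst (p r))"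
    by (elim exE)
  let ?e = "\<lambda>r. (r ++ fst (p r), snd (p r))"
  have undo: "r = (r ++ fst (p r)) |` (- decode F (snd (p r)) (r ++ fst (p r)))" if r: "r \<in> ?B" for r
  proof -
    have d: "decode F (snd (p r)) (r ++ fst (p r)) = dom (fst (p r))" "dom (fst (p r)) \<inter> dom r = {}"
      using p r by blast+
    show ?thesis unfolding d(1)
    proof
      fix v show "r v = ((r ++ fst (p r)) |` (- dom (fst (p r)))) v"
        using d(2) by (cases "v \<in> dom (fst (p r))") (auto simp: map_add_dom_app_simps restrict_map_def domIff)
    qed
  qed
  have inj: "inj_on ?e ?B"
  proof (rule inj_onI)
    fix r r' assume r: "r \<in> ?B" "r' \<in> ?B" "?e r = ?e r'"
    have "r = (r ++ fst (p r)) |` (- decode F (snd (p r)) (r ++ fst (p r)))" by (rule undo[OF r(1)])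
    also have "\<dots> = (r' ++ fst (p r')) |` (- decode F (snd (p r')) (r' ++ fst (p r')))"
      using r(3) by (simp only: prod.inject)
    also have "\<dots> = r'" by (rule undo[OF r(2), symmetric])
    finally show "r = r'" .
  qed
  have "?e ` ?B \<subseteq> restrictions V (l - n) \<times> codes w n"
  proof
    fix q assume "q \<in> ?e ` ?B"
    then obtain r where r: "r \<in> ?B" "q = ?e r" by blast
    have *: "dom (fst (p r)) \<inter> dom r = {}" "dom (fst (p r)) \<subseteq> V" "finite (dom (fst (p r)))"
      "card (dom (fst (p r))) = n" "snd (p r) \<in> codes w n" using p r(1) by blast+
    have rV: "dom r \<subseteq> V" "card (V - dom r) = l" using r(1) by (auto simp: restrictions_def)
    have "V - dom (r ++ fst (p r)) = (V - dom r) - dom (fst (p r))" by auto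
    moreover have "card ((V - dom r) - dom (fst (p r))) = l - n"
      using * rV by (subst card_Diff_subset) auto
    ultimately show "q \<in> restrictions V (l - n) \<times> codes w n"
      using r(2) * rV by (auto simp: restrictions_def)
  qed
  then have "card ?B \<le> card (restrictions V (l - n) \<times> codes w n)"
    using inj finite_restrictions[OF assms(1)] card_codes by (intro card_inj_on_le[of ?e]) auto
  also have "\<dots> \<le> card (restrictions V (l - n)) * (4 * w) ^ n"
    unfolding card_cartesian_product using card_codes by (intro mult_le_mono) auto
  finally show ?thesis .
qed

lemma override_agree: "r \<subseteq>\<^sub>m (Some \<circ> override r y)"
  by (auto simp: map_le_def override_def)

text \<open>Hastad's switching lemma in Razborov's counting form. If no canonical path under
  \<open>r\<close> queries more than \<open>w\<close> variables, then every zero has a certificate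
  of size \<open>w\<close>; the other restrictions are counted by their codes. Width
  \<open>w\<close> is both given and demanded, so paths of length \<open>Suc w\<close> are the bad
  ones.\<close>

lemma switching_lemma:
  assumes "finite V" "cnf V w (\<lambda>y. \<not> g y)" "Suc w \<le> l"
  shows "card {r \<in> restrictions V l. \<not> cnf (V - dom r) w (\<lambda>y. g (override r y))}
           \<le> card (restrictions V (l - Suc w)) * (4 * w) ^ Suc w"
proof -
  \<comment> \<open>\<open>cnf\<close> is semantic and supplies no list of terms. All implicants of
    \<open>g\<close> with at most \<open>w\<close> literals over \<open>V\<close> serve instead; as
    \<open>V\<close> is finite, they can be listed.\<close>
  let ?T = "{C. dom C \<subseteq> V \<and> card (dom C) \<le> w \<and> (\<forall>y. C \<subseteq>\<^sub>m (Some \<circ> y) \<longrightarrow> g y)}"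
  have "?T \<subseteq> (\<Union>A\<in>Pow V. {m. dom m = A \<and> ran m \<subseteq> (UNIV :: bool set)})" by auto
  moreover have "finite (\<Union>A\<in>Pow V. {m. dom m = A \<and> ran m \<subseteq> (UNIV :: bool set)})"
    using assms(1) by (intro finite_UN_I finite_set_of_finite_maps) (auto intro: finite_subset)
  ultimately have "finite ?T" by (rule finite_subset)
  from finite_list[OF this] obtain F where F: "set F = ?T" ..
  have sat: "g y" if "C \<in> set F" "\<not> falsified C (Some \<circ> y)" for C y
  proof -
    have "C \<subseteq>\<^sub>m (Some \<circ> y)" using that(2) by (auto simp: falsified_def map_le_def)
    then show ?thesis using that(1) F by blast
  qed
  have witness: "\<exists>C\<in>set F. C \<subseteq>\<^sub>m (Some \<circ> y)" if "g y" for y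
  proof -
    have "\<not> \<not> g y" using that by simp
    from cnfE[OF assms(2), of y] that obtain \<beta> where \<beta>: "\<beta> \<subseteq> V" "finite \<beta>" "card \<beta> \<le> w"
      "\<And>y'. (\<And>v. v \<in> \<beta> \<Longrightarrow> y' v = y v) \<Longrightarrow> \<not> \<not> g y'" by metis
    let ?C = "(Some \<circ> y) |` \<beta>"
    have d: "dom ?C = \<beta>" by auto
    have "g y'" if a: "?C \<subseteq>\<^sub>m (Some \<circ> y')" for y'
    proof -
      have "y' v = y v" if "v \<in> \<beta>" for v
        using a d that by (metis comp_apply map_le_def option.inject restrict_in)
      then show ?thesis using \<beta>(4) by blast
    qed
    then have "?C \<in> set F" unfolding F using \<beta>(1,3) d by simp
    moreover have "?C \<subseteq>\<^sub>m (Some \<circ> y)" by (auto simp: map_le_def)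
    ultimately show ?thesis by blast
  qed
  have "\<exists>y. deep F y r (Suc w)" if r: "r \<in> restrictions V l" "\<not> cnf (V - dom r) w (\<lambda>y. g (override r y))" for r
  proof (rule ccontr)
    assume nd: "\<nexists>y. deep F y r (Suc w)"
    have "cnf (V - dom r) w (\<lambda>y. g (override r y))"
    proof (rule cnfI)
      fix y assume ng: "\<not> g (override r y)"
      let ?y = "override r y"
      have "falsified C (Some \<circ> ?y)" if "C \<in> set F" for C using sat[OF that] ng by blast
      then obtain \<beta> where \<beta>: "\<beta> \<subseteq> V - dom r" "card \<beta> < Suc w"
        "\<forall>C\<in>set F. falsified C (r ++ (Some \<circ> ?y) |` \<beta>)"
        using deep_or_certificate[OF assms(1) _ _ override_agree, of F r y "Suc w"] F nd by auto
      have "\<not> g (override r y')" if y': "\<forall>v\<in>\<beta>. y' v = y v" for y'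
      proof
        assume "g (override r y')"
        from witness[OF this] obtain C where C: "C \<in> set F" "C \<subseteq>\<^sub>m (Some \<circ> override r y')" by (elim bexE)
        obtain v where v: "v \<in> dom C" "v \<in> dom (r ++ (Some \<circ> ?y) |` \<beta>)" "C v \<noteq> (r ++ (Some \<circ> ?y) |` \<beta>) v"
          using bspec[OF \<beta>(3) C(1)] unfolding falsified_def by (elim bexE IntE)
        have "C v = Some (override r y' v)" using C(2) v(1) by (auto simp: map_le_def)
        moreover have "(r ++ (Some \<circ> ?y) |` \<beta>) v = Some (override r y' v)"
        proof (cases "v \<in> \<beta>")
          case True
          then have "r v = None" using \<beta>(1) by auto
          then show ?thesis using True y' by (simp add: map_add_def override_def)
        next
          case False
          then show ?thesis using v(2) by (auto simp: map_add_def override_def restrict_map_def)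
        qed
        ultimately show False using v(3) by simp
      qed
      moreover have "finite \<beta>" using \<beta>(1) assms(1) finite_subset by blast
      ultimately show "\<exists>\<beta>\<subseteq>V - dom r. finite \<beta> \<and> card \<beta> \<le> w \<and>
          (\<forall>y'. (\<forall>v\<in>\<beta>. y' v = y v) \<longrightarrow> \<not> g (override r y'))"
        using \<beta> by (intro exI[of _ \<beta>]) auto
    qed
    then show False using r(2) by blast
  qed
  then have "{r \<in> restrictions V l. \<not> cnf (V - dom r) w (\<lambda>y. g (override r y))}
      \<subseteq> {r \<in> restrictions V l. \<exists>y. deep F y r (Suc w)}" by auto
  moreover have "finite {r \<in> restrictions V l. \<exists>y. deep F y r (Suc w)}"
    using finite_restrictions[OF assms(1)] by auto
  ultimately have "card {r \<in> restrictions V l. \<not> cnf (V - dom r) w (\<lambda>y. g (override r y))}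
      \<le> card {r \<in> restrictions V l. \<exists>y. deep F y r (Suc w)}" by (rule card_mono[rotated])
  also have "\<dots> \<le> card (restrictions V (l - Suc w)) * (4 * w) ^ Suc w"
    by (rule card_deep_le[OF assms(1) _ assms(3)]) (use F in auto)
  finally show ?thesis .
qed

text \<open>At the bottom, each disjunction \<open>g\<close> of terms turns into a conjunction of
  clauses, which merges with the conjunction over \<open>G\<close>: one level disappears. The union
  bound ranges over at most \<open>S ^ Suc j\<close> such disjunctions, up to negation.\<close>

lemma switching_level:
  assumes "finite V" "Suc w \<le> l" "Pi_lev V w S (Suc j) f"
  shows "card {r \<in> restrictions V l. \<not> Pi_lev (V - dom r) w S j (\<lambda>y. f (override r y))}
           \<le> S ^ Suc j * (card (restrictions V (l - Suc w)) * (4 * w) ^ Suc w)"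
  using assms(3)
proof (induction j arbitrary: f)
  case 0
  let ?b = "card (restrictions V (l - Suc w)) * (4 * w) ^ Suc w"
  obtain G where G: "finite G" "card G \<le> S" "\<forall>g\<in>G. cnf V w (\<lambda>y. \<not> g y)" "f = (\<lambda>y. \<forall>g\<in>G. g y)"
    using 0 by auto
  let ?B = "\<lambda>g. {r \<in> restrictions V l. \<not> cnf (V - dom r) w (\<lambda>y. g (override r y))}"
  have fin: "finite (?B g)" for g using finite_restrictions[OF assms(1)] by auto
  have "{r \<in> restrictions V l. \<not> Pi_lev (V - dom r) w S 0 (\<lambda>y. f (override r y))} \<subseteq> (\<Union>g\<in>G. ?B g)"
    unfolding G(4) by (auto intro: cnf_Ball)
  then have "card {r \<in> restrictions V l. \<not> Pi_lev (V - dom r) w S 0 (\<lambda>y. f (override r y))} \<le> card (\<Union>g\<in>G. ?B g)"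
    using fin G(1) by (intro card_mono) auto
  also have "\<dots> \<le> (\<Sum>g\<in>G. card (?B g))" by (rule card_UN_le[OF G(1)])
  also have "\<dots> \<le> (\<Sum>g\<in>G. ?b)"
    by (rule sum_mono) (use switching_lemma[OF assms(1) _ assms(2)] G(3) in blast)
  also have "\<dots> \<le> S * ?b" using G(2) by simp
  finally show ?case by simp
next
  case (Suc j)
  let ?b = "card (restrictions V (l - Suc w)) * (4 * w) ^ Suc w"
  obtain G where G: "finite G" "G \<noteq> {}" "card G \<le> S" "\<forall>g\<in>G. Pi_lev V w S (Suc j) (\<lambda>y. \<not> g y)"
    "f = (\<lambda>y. \<forall>g\<in>G. g y)"
    using Suc.prems by (subst (asm) Pi_lev.simps(2)) (elim exE conjE)
  let ?B = "\<lambda>g. {r \<in> restrictions V l. \<not> Pi_lev (V - dom r) w S j (\<lambda>y. \<not> g (override r y))}"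
  have fin: "finite (?B g)" for g using finite_restrictions[OF assms(1)] by auto
  have "{r \<in> restrictions V l. \<not> Pi_lev (V - dom r) w S (Suc j) (\<lambda>y. f (override r y))} \<subseteq> (\<Union>g\<in>G. ?B g)"
  proof
    fix r assume r: "r \<in> {r \<in> restrictions V l. \<not> Pi_lev (V - dom r) w S (Suc j) (\<lambda>y. f (override r y))}"
    show "r \<in> (\<Union>g\<in>G. ?B g)"
    proof (rule ccontr)
      assume "r \<notin> (\<Union>g\<in>G. ?B g)"
      then have *: "\<forall>g\<in>G. Pi_lev (V - dom r) w S j (\<lambda>y. \<not> g (override r y))" using r by blast
      let ?G = "(\<lambda>g y. g (override r y)) ` G"
      have "card ?G \<le> S" using card_image_le[OF G(1)] G(3) order_trans by blast
      moreover have "(\<lambda>y. f (override r y)) = (\<lambda>y. \<forall>g\<in>?G. g y)" unfolding G(5) by auto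
      ultimately have "Pi_lev (V - dom r) w S (Suc j) (\<lambda>y. f (override r y))"
        unfolding Pi_lev.simps using * G(1,2) by (intro exI[of _ ?G]) auto
      then show False using r by blast
    qed
  qed
  then have "card {r \<in> restrictions V l. \<not> Pi_lev (V - dom r) w S (Suc j) (\<lambda>y. f (override r y))} \<le> card (\<Union>g\<in>G. ?B g)"
    using fin G(1) by (intro card_mono) auto
  also have "\<dots> \<le> (\<Sum>g\<in>G. card (?B g))" by (rule card_UN_le[OF G(1)])
  also have "\<dots> \<le> (\<Sum>g\<in>G. S ^ Suc j * ?b)"
    by (rule sum_mono) (use Suc.IH G(4) in blast)
  also have "\<dots> \<le> S * (S ^ Suc j * ?b)" using G(3) by simp
  finally show ?case by (simp add: mult.assoc)
qed

section \<open>Parity under restrictions\<close>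

definition parity :: "'v set \<Rightarrow> ('v \<Rightarrow> bool) \<Rightarrow> bool" where
  "parity V y \<longleftrightarrow> odd (card {v \<in> V. y v})"

lemma parity_flip:
  assumes "finite V" "v \<in> V"
  shows "parity V (y(v := \<not> y v)) \<longleftrightarrow> \<not> parity V y"
proof (cases "y v")
  case True
  then have "{u \<in> V. y u} = insert v {u \<in> V. (y(v := \<not> y v)) u}" using assms(2) by auto
  then show ?thesis using True assms(1) unfolding parity_def by simp
next
  case False
  then have "{u \<in> V. (y(v := \<not> y v)) u} = insert v {u \<in> V. y u}" using assms(2) by auto
  then show ?thesis using False assms(1) unfolding parity_def by simp
qed

lemma parity_override:
  assumes "finite V"
  shows "parity V (override r y) \<longleftrightarrow> (parity (V - dom r) y \<noteq> odd (card {v \<in> V. r v = Some True}))"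
proof -
  have "{v \<in> V. override r y v} = {v \<in> V - dom r. y v} \<union> {v \<in> V. r v = Some True}"
    by (auto simp: override_def split: option.splits)
  moreover have "card ({v \<in> V - dom r. y v} \<union> {v \<in> V. r v = Some True})
     = card {v \<in> V - dom r. y v} + card {v \<in> V. r v = Some True}"
    using assms by (intro card_Un_disjoint) auto
  ultimately show ?thesis unfolding parity_def by simp
qed

text \<open>A certificate of size \<open>w\<close> leaves some variable free, and flipping it
  changes the parity.\<close>

lemma not_cnf_parity:
  assumes "finite V" "w < card V"
  shows "\<not> cnf V w (\<lambda>y. parity V y \<noteq> b)"
proof
  assume c: "cnf V w (\<lambda>y. parity V y \<noteq> b)"
  have "V \<noteq> {}" using assms by auto
  then obtain v where v: "v \<in> V" by blast
  obtain y where y: "\<not> (parity V y \<noteq> b)"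
    using parity_flip[OF assms(1) v, of "\<lambda>_. False"] by metis
  obtain \<beta> where \<beta>: "\<beta> \<subseteq> V" "finite \<beta>" "card \<beta> \<le> w"
    "\<And>y'. (\<And>v. v \<in> \<beta> \<Longrightarrow> y' v = y v) \<Longrightarrow> \<not> (parity V y' \<noteq> b)"
    by (rule cnfE[where f = "\<lambda>y. parity V y \<noteq> b" and y = y, OF c]) (use y in blast)+
  have "\<beta> \<noteq> V" using \<beta>(3) assms(2) by auto
  then obtain u where u: "u \<in> V" "u \<notin> \<beta>" using \<beta>(1) by blast
  have "\<not> (parity V (y(u := \<not> y u)) \<noteq> b)" by (rule \<beta>(4)) (use u in auto)
  then show False using parity_flip[OF assms(1) u(1), of y] y by simp
qed

text \<open>
  Each switching step keeps a fraction \<open>1 / (8 w Q + 1)\<close> of the variables, where the factor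
  \<open>Q ^ (w + 1)\<close> pays for the union bound over all subformulas.
\<close>

lemma exists_good_restriction:
  assumes "finite V" "Pi_lev V w S (Suc j) f" "Suc w \<le> l" "(8 * w * Q + 1) * l \<le> card V" "S ^ Suc j < Q ^ Suc w"
  shows "\<exists>r\<in>restrictions V l. Pi_lev (V - dom r) w S j (\<lambda>y. f (override r y))"
proof (rule ccontr)
  assume no: "\<not> ?thesis"
  let ?N = "card V" and ?n = "Suc w"
  have lN: "l \<le> ?N" using assms(4) by (simp add: algebra_simps)
  have "{r \<in> restrictions V l. \<not> Pi_lev (V - dom r) w S j (\<lambda>y. f (override r y))} = restrictions V l"
    using no by blast
  then have "card (restrictions V l) \<le> S ^ Suc j * (card (restrictions V (l - ?n)) * (4 * w) ^ ?n)"
    using switching_level[OF assms(1,3,2)] by simp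
  moreover have "?N - (l - ?n) = ?N - l + ?n" using lN assms(3) by simp
  moreover have "card (restrictions V (l - ?n)) = (?N choose (l - ?n)) * 2 ^ (?N - (l - ?n))"
    by (rule card_restrictions[OF assms(1)]) (use lN in simp)
  ultimately have "(?N choose l) * 2 ^ (?N - l)
      \<le> S ^ Suc j * ((?N choose (l - ?n)) * 2 ^ (?N - l + ?n) * (4 * w) ^ ?n)"
    using card_restrictions[OF assms(1) lN] by (simp only:)
  also have "\<dots> = (S ^ Suc j * (?N choose (l - ?n)) * (2 ^ ?n * (4 * w) ^ ?n)) * 2 ^ (?N - l)"
    unfolding power_add by (simp only: ac_simps)
  finally have "?N choose l \<le> S ^ Suc j * (?N choose (l - ?n)) * (2 ^ ?n * (4 * w) ^ ?n)" by simp
  \<comment> \<open>The \<open>2 ^ ?n\<close> comes from the values of the \<open>?n\<close>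
    additional fixed variables; it turns \<open>4 * w\<close> into \<open>8 * w\<close>.\<close>
  also have "2 ^ ?n * (4 * w) ^ ?n = (8 * w) ^ ?n"
  proof -
    have "2 ^ ?n * (4 * w) ^ ?n = (2 * (4 * w)) ^ ?n" by (rule power_mult_distrib[symmetric])
    also have "2 * (4 * w) = 8 * w" by simp
    finally show ?thesis .
  qed
  finally have 1: "(?N choose l) * l ^ ?n \<le> S ^ Suc j * (?N choose (l - ?n)) * (8 * w) ^ ?n * l ^ ?n" by simp
  have "8 * w * Q * l \<le> ?N - l" using assms(4) by (simp add: algebra_simps)
  then have "(8 * w * Q * l) ^ ?n \<le> (?N - l) ^ ?n" by (rule power_mono) simp
  then have "(?N choose (l - ?n)) * (8 * w * Q * l) ^ ?n \<le> (?N choose (l - ?n)) * (?N - l) ^ ?n" by simp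
  also have "\<dots> \<le> (?N choose l) * l ^ ?n" by (rule binomial_ratio[OF lN assms(3)])
  finally have 2: "(?N choose (l - ?n)) * (8 * w * Q * l) ^ ?n \<le> (?N choose l) * l ^ ?n" .
  have pos: "(?N choose (l - ?n)) > 0" using lN by (simp add: zero_less_binomial_iff)
  show False
  \<comment> \<open>For \<open>w = 0\<close> the common factor \<open>(8 * w) ^ ?n\<close> vanishes
    and cannot be cancelled, but then the bound leaves no bad restriction at all.\<close>
  proof (cases "w = 0")
    case True
    then have "(?N choose l) * l ^ ?n = 0" using 1 by simp
    then show False using assms(3) lN by simp
  next
    case False
    have "(?N choose (l - ?n)) * (8 * w * Q * l) ^ ?n = Q ^ ?n * ((?N choose (l - ?n)) * (8 * w) ^ ?n * l ^ ?n)"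
      by (simp only: power_mult_distrib ac_simps)
    moreover have "S ^ Suc j * (?N choose (l - ?n)) * (8 * w) ^ ?n * l ^ ?n
        = S ^ Suc j * ((?N choose (l - ?n)) * (8 * w) ^ ?n * l ^ ?n)"
      by (simp only: ac_simps)
    ultimately have "Q ^ ?n * ((?N choose (l - ?n)) * (8 * w) ^ ?n * l ^ ?n)
        \<le> S ^ Suc j * ((?N choose (l - ?n)) * (8 * w) ^ ?n * l ^ ?n)"
      using 1 2 by linarith
    moreover have "(?N choose (l - ?n)) * (8 * w) ^ ?n * l ^ ?n > 0"
      using pos False assms(3) by simp
    ultimately show False using assms(5) by (metis mult_le_cancel2 not_le)
  qed
qed

text \<open>After \<open>j\<close> restrictions at least \<open>Suc w\<close> variables are left,
  and their parity would have clauses of width \<open>w\<close>. A restriction turns parity into the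
  parity of the free variables or its negation, which is why \<open>b\<close> varies in the
  induction.\<close>

theorem parity_lower_bound:
  assumes "finite V" "Pi_lev V w S j (\<lambda>y. parity V y \<noteq> b)" "S ^ j < Q ^ Suc w" "S \<ge> 1"
    and "(8 * w * Q + 1) ^ j * Suc w \<le> card V"
  shows False
  using assms
proof (induction j arbitrary: V b)
  case 0
  then show ?case using not_cnf_parity[of V w b] by simp
next
  case (Suc j)
  let ?l = "(8 * w * Q + 1) ^ j * Suc w"
  have l: "Suc w \<le> ?l" by (metis mult_le_mono1 mult_1 one_le_power le_add2)
  have "(8 * w * Q + 1) * ?l \<le> card V" using Suc.prems(5) by (simp only: power_Suc mult.assoc)
  then obtain r where r: "r \<in> restrictions V ?l" "Pi_lev (V - dom r) w S j (\<lambda>y. parity V (override r y) \<noteq> b)"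
    using exists_good_restriction[OF Suc.prems(1,2) l _ Suc.prems(3)] by blast
  define b' where "b' \<longleftrightarrow> odd (card {v \<in> V. r v = Some True}) \<noteq> b"
  have eq: "(\<lambda>y. parity V (override r y) \<noteq> b) = (\<lambda>y. parity (V - dom r) y \<noteq> b')"
    using parity_override[OF Suc.prems(1)] unfolding b'_def by auto
  show ?case
  proof (rule Suc.IH)
    show "Pi_lev (V - dom r) w S j (\<lambda>y. parity (V - dom r) y \<noteq> b')" using r(2) unfolding eq .
    show "?l \<le> card (V - dom r)" using r(1) by (simp only: restrictions_def) simp
    show "S ^ j < Q ^ Suc w" using Suc.prems(3,4) by (metis power_increasing le_less_trans lessI less_imp_le_nat)
  qed (use Suc.prems(1,4) in auto)
qed

section \<open>From machines to formulas\<close>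

definition same_mode :: "ratm \<Rightarrow> config \<Rightarrow> config \<Rightarrow> bool" where
  "same_mode M c c' \<longleftrightarrow> (cur_state c \<in> universal M \<longleftrightarrow> cur_state c' \<in> universal M)"

text \<open>Acceptance within \<open>r\<close> steps and at most \<open>j\<close> further alternations.\<close>

fun acc_within :: "ratm \<Rightarrow> nat \<Rightarrow> nat \<Rightarrow> config \<Rightarrow> bool list \<Rightarrow> bool" where
  "acc_within M 0 j c x \<longleftrightarrow> cur_state c \<in> final M"
| "acc_within M (Suc r) j c x \<longleftrightarrow> cur_state c \<in> final M \<or>
     (let sub = (\<lambda>t. let c' = apply_transition t c in
                  if same_mode M c c' then acc_within M r j c' x
                  else (case j of 0 \<Rightarrow> False | Suc i \<Rightarrow> acc_within M r i c' x))
      in if cur_state c \<in> universal M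
         then (\<exists>t\<in>transitions M. enabled x t c) \<and> (\<forall>t\<in>transitions M. enabled x t c \<longrightarrow> sub t)
         else (\<exists>t\<in>transitions M. enabled x t c \<and> sub t))"

text \<open>All positions outside \<open>V\<close> are fixed to 0, so that only the positions in
  \<open>V\<close> are variables.\<close>

definition input_of :: "nat set \<Rightarrow> nat \<Rightarrow> (nat \<Rightarrow> bool) \<Rightarrow> bool list" where
  "input_of V n y = map (\<lambda>i. i \<in> V \<and> y i) [0..<n]"

lemma input_symbol_local:
  assumes "\<And>v. v \<in> V \<inter> {addr_value (addr_tape c)} \<Longrightarrow> y' v = y v"
  shows "input_symbol (input_of V n y') c = input_symbol (input_of V n y) c"
  using assms by (auto simp: input_symbol_def input_of_def Let_def)

lemma junta1_input:
  assumes "\<And>x x'. input_symbol x c = input_symbol x' c \<Longrightarrow> e x = e x'"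
  shows "junta1 V (\<lambda>y. e (input_of V n y))"
proof -
  let ?\<beta> = "V \<inter> {addr_value (addr_tape c)}"
  have "card ?\<beta> \<le> card {addr_value (addr_tape c)}" by (rule card_mono) auto
  moreover have "e (input_of V n y') = e (input_of V n y)" if "\<forall>v\<in>?\<beta>. y' v = y v" for y y'
    by (rule assms[OF input_symbol_local]) (use that in blast)
  ultimately show ?thesis unfolding junta1_def by (intro exI[of _ ?\<beta>]) auto
qed

lemma junta1_enabled: "junta1 V (\<lambda>y. enabled (input_of V n y) t c)"
  by (rule junta1_input[of c "\<lambda>x. enabled x t c"]) (simp add: enabled_def)

lemma junta1_some_enabled: "junta1 V (\<lambda>y. \<exists>t\<in>D. enabled (input_of V n y) t c)"
  by (rule junta1_input[of c "\<lambda>x. \<exists>t\<in>D. enabled x t c"]) (simp add: enabled_def)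

text \<open>Acceptance has a conjunction on top in universal configurations, rejection in the
  others; comparing with the mode covers both. A step costs up to two units of width: one for
  \<open>enabled\<close>, one for the condition that a universal configuration has a successor.
  Steps in the same mode merge into the top gate with a factor \<open>K\<close>, and an alternation
  uses one level.\<close>

lemma Pi_lev_acc_within:
  assumes "finite (transitions M)" "card (transitions M) \<le> K" "K \<ge> 1"
  shows "Pi_lev V (2 * r) (K ^ r) j
           (\<lambda>y. acc_within M r j c (input_of V n y) = (cur_state c \<in> universal M))"
proof (induction r arbitrary: j c)
  case 0
  show ?case by (simp only: acc_within.simps) (rule Pi_lev_const, simp)
next
  case (Suc r)
  let ?D = "transitions M"
  let ?u = "cur_state c \<in> universal M"
  let ?w = "2 * Suc r" and ?S = "K ^ Suc r"
  have S1: "?S \<ge> 1" "K ^ r \<ge> 1" using assms(3) by (simp_all only: one_le_power)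
  define sub where "sub x t = (let c' = apply_transition t c in
                  if same_mode M c c' then acc_within M r j c' x
                  else (case j of 0 \<Rightarrow> False | Suc i \<Rightarrow> acc_within M r i c' x))" for x t
  have sub: "Pi_lev V (2 * r) (K ^ r) j (\<lambda>y. sub (input_of V n y) t = ?u)" for t
  proof -
    let ?c = "apply_transition t c"
    show ?thesis
    proof (cases "same_mode M c ?c")
      case True
      then show ?thesis using Suc.IH[of j ?c] unfolding sub_def same_mode_def by (simp add: Let_def)
    next
      case False
      show ?thesis
      proof (cases j)
        case 0
        then show ?thesis using False S1(2) unfolding sub_def by (simp only: Let_def if_False nat.case Pi_lev_const)
      next
        case (Suc i)
        \<comment> \<open>When the mode changes, so does the side of the comparison. The formula of
          the successor therefore enters negated, as the next level requires.\<close>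
        have "Pi_lev V (2 * r) (K ^ r) i (\<lambda>y. \<not> (acc_within M r i ?c (input_of V n y) = ?u))"
          using Suc.IH[of i ?c] False unfolding same_mode_def by (cases ?u) auto
        from Pi_lev_lift[OF this S1(2)] show ?thesis
          using False Suc unfolding sub_def by (simp only: Let_def if_False nat.case)
      qed
    qed
  qed
  show ?case
  proof (cases "cur_state c \<in> final M")
    case True
    then show ?thesis by (simp only: acc_within.simps simp_thms) (rule Pi_lev_const[OF S1(1)])
  next
    case nf: False
    show ?thesis
    proof (cases "?D = {}")
      case True
      then have "(\<lambda>y. acc_within M (Suc r) j c (input_of V n y) = ?u) = (\<lambda>y. \<not> ?u)"
        using nf by (auto simp: Let_def)
      then show ?thesis using Pi_lev_const[OF S1(1)] by metis
    next
      case ne: False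
      let ?P = "\<lambda>y. \<forall>t\<in>?D. \<not> enabled (input_of V n y) t c \<or> (sub (input_of V n y) t = ?u)"
      have "Pi_lev V (2 * r + 1) (K * K ^ r) j ?P"
        by (rule Pi_lev_Ball[OF assms(1) ne assms(2)])
          (rule Pi_lev_junta1(1)[OF sub junta1_not[OF junta1_enabled]])
      then have P: "Pi_lev V (2 * r + 1) ?S j ?P" by (simp only: power_Suc)
      show ?thesis
      proof (cases ?u)
        case True
        have "(\<lambda>y. acc_within M (Suc r) j c (input_of V n y) = ?u)
            = (\<lambda>y. (\<exists>t\<in>?D. enabled (input_of V n y) t c) \<and> ?P y)"
          using nf True unfolding acc_within.simps sub_def[symmetric] by (auto simp: Let_def sub_def[unfolded Let_def])
        moreover have "Pi_lev V (2 * r + 1 + 1) ?S j (\<lambda>y. (\<exists>t\<in>?D. enabled (input_of V n y) t c) \<and> ?P y)"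
          by (rule Pi_lev_junta1(2)[OF P junta1_some_enabled])
        ultimately show ?thesis by (simp only: mult_Suc_right) (simp add: add.commute)
      next
        case False
        have "(\<lambda>y. acc_within M (Suc r) j c (input_of V n y) = ?u) = ?P"
          using nf False by (auto simp: Let_def sub_def[unfolded Let_def])
        then show ?thesis using Pi_lev_mono[OF P, of ?w ?S] by (simp only:) simp
      qed
    qed
  qed
qed

text \<open>Unlike \<open>computation\<close>, a run may start anywhere, so that induction along it
  is possible.\<close>

definition run_from :: "ratm \<Rightarrow> bool list \<Rightarrow> config \<Rightarrow> config list \<Rightarrow> bool" where
  "run_from M x c cs \<longleftrightarrow> cs \<noteq> [] \<and> hd cs = c \<and> successively (step M x) cs"

lemma run_from_Cons: "step M x c c' \<Longrightarrow> run_from M x c' cs \<Longrightarrow> run_from M x c (c # cs)"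
  by (cases cs) (auto simp: run_from_def)

lemma num_blocks_Cons:
  "cs \<noteq> [] \<Longrightarrow> num_blocks M (c # cs) = num_blocks M cs + (if same_mode M c (hd cs) then 0 else 1)"
  by (cases cs) (auto simp: num_blocks_def same_mode_def)

text \<open>A step uses up one unit of the bound on run lengths, a change of mode one unit of the
  bound on blocks. So the cut-offs of \<open>acc_within\<close> do no harm: for \<open>r = 0\<close>
  no step is possible, for \<open>j = 0\<close> no change of mode.\<close>

lemma acc_within_eq_accepting:
  assumes wf: "wf_ratm M"
    and "\<And>cs. run_from M x c cs \<Longrightarrow> length cs - 1 \<le> r \<and> num_blocks M cs \<le> Suc j"
  shows "acc_within M r j c x = accepting M x c"
  using assms(2)
proof (induction r arbitrary: j c)
  case 0
  have "\<not> step M x c c'" for c'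
  proof
    assume "step M x c c'"
    then have "run_from M x c [c, c']" by (simp add: run_from_def)
    then show False using 0 by fastforce
  qed
  then show ?case by (auto intro: accepting.final elim: accepting.cases)
next
  case (Suc r)
  define sub where "sub t = (let c' = apply_transition t c in
                  if same_mode M c c' then acc_within M r j c' x
                  else (case j of 0 \<Rightarrow> False | Suc i \<Rightarrow> acc_within M r i c' x))" for t
  have sub: "sub t = accepting M x (apply_transition t c)" if t: "t \<in> transitions M" "enabled x t c" for t
  proof -
    let ?c = "apply_transition t c"
    have st: "step M x c ?c" using t by (auto simp: step_def)
    have b: "length cs \<le> Suc r \<and> num_blocks M cs + (if same_mode M c ?c then 0 else 1) \<le> Suc j"
      if "run_from M x ?c cs" for cs
    proof -
      have "cs \<noteq> []" "hd cs = ?c" using that by (auto simp: run_from_def)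
      then show ?thesis using Suc.prems[OF run_from_Cons[OF st that]] num_blocks_Cons[of cs M c] by simp
    qed
    show ?thesis
    proof (cases "same_mode M c ?c")
      case True
      have "acc_within M r j ?c x = accepting M x ?c"
        by (rule Suc.IH) (use b True in fastforce)
      then show ?thesis using True by (simp add: sub_def Let_def)
    next
      case False
      have "run_from M x ?c [?c]" by (simp add: run_from_def)
      from b[OF this] False obtain i where i: "j = Suc i" by (cases j) (auto simp: num_blocks_def)
      have "acc_within M r i ?c x = accepting M x ?c"
        by (rule Suc.IH) (use b False i in fastforce)
      then show ?thesis using False i by (simp add: sub_def Let_def)
    qed
  qed
  have ex: "cur_state c \<in> existential M" if "t \<in> transitions M" "enabled x t c" "cur_state c \<notin> universal M" for t
    using wf that by (auto simp: wf_ratm_def wf_transition_def enabled_def states_def)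
  have disj: "universal M \<inter> existential M = {}" using wf by (simp add: wf_ratm_def)
  have a: "acc_within M (Suc r) j c x \<longleftrightarrow> cur_state c \<in> final M \<or> (if cur_state c \<in> universal M
         then (\<exists>t\<in>transitions M. enabled x t c) \<and> (\<forall>t\<in>transitions M. enabled x t c \<longrightarrow> sub t)
         else (\<exists>t\<in>transitions M. enabled x t c \<and> sub t))"
    by (simp add: sub_def)
  show ?case
  proof
    assume "acc_within M (Suc r) j c x"
    then consider "cur_state c \<in> final M"
      | "cur_state c \<in> universal M" "\<exists>t\<in>transitions M. enabled x t c"
        "\<forall>t\<in>transitions M. enabled x t c \<longrightarrow> sub t"
      | t where "cur_state c \<notin> universal M" "t \<in> transitions M" "enabled x t c" "sub t"
      unfolding a by (auto split: if_splits)
    then show "accepting M x c"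
    proof cases
      case 2
      then show ?thesis using sub by (intro accepting.universal) (auto simp: step_def)
    next
      case 3
      then show ?thesis using sub ex by (intro accepting.existential[of c]) (auto simp: step_def)
    qed (rule accepting.final)
  next
    assume "accepting M x c"
    then show "acc_within M (Suc r) j c x"
    proof cases
      case final
      then show ?thesis by simp
    next
      case (existential c')
      then have "cur_state c \<notin> universal M" using disj by blast
      then show ?thesis using existential sub unfolding a by (auto simp: step_def)
    next
      case universal
      then show ?thesis using sub unfolding a by (auto simp: step_def)
    qed
  qed
qed

text \<open>The initial configuration depends only on the length of the input, so one formula serves
  all inputs of length \<open>n\<close>; since it is universal, the comparison with the mode
  disappears.\<close>

lemma language_Pi_lev:
  assumes "wf_ratm M" "initial M \<in> universal M"
    and "\<And>x cs. computation M x cs \<Longrightarrow> length x = n \<Longrightarrow> length cs - 1 \<le> r"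
    and "\<And>x cs. computation M x cs \<Longrightarrow> num_blocks M cs \<le> Suc j"
    and "card (transitions M) \<le> K" "K \<ge> 1"
  shows "Pi_lev V (2 * r) (K ^ r) j (\<lambda>y. input_of V n y \<in> language M)"
proof -
  define c where "c = \<lparr>cur_state = initial M, addr_tape = replicate (addr_length n) False,
      addr_head = 0, work_tapes = replicate (num_tapes M) (\<lambda>_. 0, 0)\<rparr>"
  have c: "init_config M (input_of V n y) = c" for y
    by (simp add: init_config_def c_def input_of_def)
  have "acc_within M r j c (input_of V n y) = accepting M (input_of V n y) c" for y
  proof (rule acc_within_eq_accepting[OF assms(1)])
    fix cs assume "run_from M (input_of V n y) c cs"
    then have "computation M (input_of V n y) cs" by (simp add: run_from_def computation_def c)
    then show "length cs - 1 \<le> r \<and> num_blocks M cs \<le> Suc j"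
      using assms(3,4) by (simp add: input_of_def)
  qed
  then have "(\<lambda>y. acc_within M r j c (input_of V n y) = (cur_state c \<in> universal M))
      = (\<lambda>y. input_of V n y \<in> language M)"
    using assms(2) by (simp add: language_def c c_def)
  moreover have "finite (transitions M)" using assms(1) by (simp add: wf_ratm_def)
  ultimately show ?thesis using Pi_lev_acc_within[OF _ assms(5,6), of V r j c n] by simp
qed

section \<open>A counter on the address tape\<close>

text \<open>
  The cells of the address tape are split according to their position modulo \<open>D\<close>. Residue 0
  carries a mark at the left end; residue \<open>cls r d\<close> holds digit \<open>d\<close> of a level \<open>r\<close> index, its value
  being the number of ones. In a right sweep \<open>Rt d\<close> the counter clears the digit \<open>d\<close> that has just
  overflowed; for \<open>d = 0\<close> it instead sets the cells of digit 0 one after the other, with a tick at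
  each of them. The left sweep \<open>Lt d f\<close> resets digit 0 and increments digit \<open>d + 1\<close> by setting the
  first 0 that it meets; \<open>f\<close> says whether there was one. The counter stops when digit \<open>kap - 1\<close>
  overflows, and then all its cells are 0 again.
\<close>

datatype clk = Rt nat | Lt nat bool

instance clk :: countable
  by countable_datatype

text \<open>\<open>m\<close> is the number of players and of counter levels; \<open>kap\<close> is
  the number of digits of each counter, hence the exponent in the number of its ticks.\<close>

locale counter =
  fixes m kap :: nat
  assumes kap: "kap \<ge> 1"
begin

lemma nth_update: "j < length xs \<Longrightarrow> xs[i := x] ! j = (if i = j then x else xs ! j)"
  by (cases "i < length xs") (auto simp: nth_list_update)

definition D :: nat where "D = 1 + m * kap"

definition cls :: "nat \<Rightarrow> nat \<Rightarrow> nat" where "cls r d = 1 + r * kap + d"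

lemma D_pos: "D > 0"
  by (simp add: D_def)

lemma cls_less: "r < m \<Longrightarrow> d < kap \<Longrightarrow> cls r d < D"
proof -
  assume "r < m" "d < kap"
  then have "Suc r * kap \<le> m * kap" by (intro mult_le_mono1) simp
  then show "cls r d < D" using \<open>d < kap\<close> by (simp add: cls_def D_def)
qed

lemma cls_inj: "d < kap \<Longrightarrow> d' < kap \<Longrightarrow> cls r d = cls r' d' \<longleftrightarrow> r = r' \<and> d = d'"
proof
  assume d: "d < kap" "d' < kap" "cls r d = cls r' d'"
  then have e: "r * kap + d = r' * kap + d'" by (simp add: cls_def)
  have "(r * kap + d) div kap = r" "(r' * kap + d') div kap = r'" using d by auto
  then show "r = r' \<and> d = d'" using e by auto
qed simp

lemma cls_pos: "cls r d \<noteq> 0"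
  by (simp add: cls_def)

fun clock_act :: "nat \<Rightarrow> clk \<Rightarrow> nat \<Rightarrow> bool option \<Rightarrow> (clk \<times> bool \<times> head_move) option" where
  "clock_act r (Rt d) c None = Some (Lt d False, False, Move_Left)"
| "clock_act r (Rt d) c (Some b) = Some (Rt d, if c = cls r d then d = 0 else b, Move_Right)"
| "clock_act r (Lt d f) c None = None"
| "clock_act r (Lt d f) c (Some b) =
     (if c = 0 \<and> b then
        (if f then Some (Rt 0, b, Stay) else if d + 1 < kap then Some (Rt (d + 1), b, Stay) else None)
      else if c = cls r 0 then Some (Lt d f, False, Move_Left)
      else if d + 1 < kap \<and> c = cls r (d + 1) \<and> \<not> f then Some (Lt d (\<not> b), True, Move_Left)
      else Some (Lt d f, b, Move_Left))"

type_synonym clock_config = "clk \<times> nat \<times> bool list"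

definition cell_symbol :: "nat \<Rightarrow> bool list \<Rightarrow> bool option" where
  "cell_symbol p A = (if p < length A then Some (A ! p) else None)"

fun clock_step :: "nat \<Rightarrow> clock_config \<Rightarrow> clock_config option" where
  "clock_step r (q, p, A) = map_option (\<lambda>(q', b, mv). (q', min (move_head mv p) (length A), A[p := b]))
     (clock_act r q (p mod D) (cell_symbol p A))"

fun tick :: "nat \<Rightarrow> clock_config \<Rightarrow> bool" where
  "tick r (q, p, A) \<longleftrightarrow> q = Rt 0 \<and> p < length A \<and> p mod D = cls r 0"

definition marked :: "bool list \<Rightarrow> bool" where
  "marked A \<longleftrightarrow> A \<noteq> [] \<and> (\<forall>p<length A. p mod D = 0 \<longrightarrow> (A ! p \<longleftrightarrow> p = 0))"

definition digit_all :: "bool \<Rightarrow> nat set \<Rightarrow> nat \<Rightarrow> nat \<Rightarrow> bool list \<Rightarrow> bool" where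
  "digit_all b I r d A \<longleftrightarrow> (\<forall>p<length A. p \<in> I \<longrightarrow> p mod D = cls r d \<longrightarrow> A ! p = b)"

text \<open>The last condition on \<open>Lt d f\<close> says that, as long as no 0 has been found,
  the cells of digit \<open>d + 1\<close> passed so far are all 1; at the left end this means that
  the digit is full and has to overflow.\<close>

fun clock_inv :: "nat \<Rightarrow> clock_config \<Rightarrow> bool" where
  "clock_inv r (Rt d, p, A) \<longleftrightarrow> marked A \<and> p \<le> length A \<and> d < kap \<and>
     (\<forall>e. 1 \<le> e \<and> e < d \<longrightarrow> digit_all False UNIV r e A) \<and>
     (if d = 0 then digit_all False {p..} r 0 A else digit_all False {..<p} r d A \<and> digit_all False UNIV r 0 A)"
| "clock_inv r (Lt d f, p, A) \<longleftrightarrow> marked A \<and> p < length A \<and> d < kap \<and>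
     (\<forall>e. 1 \<le> e \<and> e \<le> d \<longrightarrow> digit_all False UNIV r e A) \<and>
     digit_all False {p<..} r 0 A \<and> (\<not> f \<longrightarrow> d + 1 < kap \<longrightarrow> digit_all True {p<..} r (d + 1) A)"

text \<open>The case analysis of a counter step, freed of the branches that the invariant excludes;
  the facts about single steps are derived from it. In \<open>put\<close>, a tick always meets a 0,
  because digit 0 is clear ahead of the head.\<close>

lemma clock_step_cases:
  assumes "clock_inv r (q, p, A)" and "r < m"
  obtains
    (turn) d where "q = Rt d" "p = length A" "p > 0" "clock_step r (q, p, A) = Some (Lt d False, p - 1, A)" "d < kap"
  | (put) d where "q = Rt d" "p < length A" "p mod D = cls r d" "d < kap" "d = 0 \<longrightarrow> \<not> A ! p"
      "clock_step r (q, p, A) = Some (Rt d, p + 1, A[p := (d = 0)])"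
  | (pass) d where "q = Rt d" "p < length A" "p mod D \<noteq> cls r d" "d < kap"
      "clock_step r (q, p, A) = Some (Rt d, p + 1, A)"
  | (restart) d where "q = Lt d True" "p = 0" "clock_step r (q, p, A) = Some (Rt 0, 0, A)" "d < kap"
  | (carry) d where "q = Lt d False" "p = 0" "d + 1 < kap" "clock_step r (q, p, A) = Some (Rt (d + 1), 0, A)"
  | (stop) d where "q = Lt d False" "p = 0" "d + 1 = kap" "clock_step r (q, p, A) = None"
  | (clear) d f where "q = Lt d f" "0 < p" "p < length A" "d < kap" "p mod D = cls r 0"
      "clock_step r (q, p, A) = Some (Lt d f, p - 1, A[p := False])"
  | (incr) d where "q = Lt d False" "0 < p" "p < length A" "d + 1 < kap" "p mod D = cls r (d + 1)" "\<not> A ! p"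
      "clock_step r (q, p, A) = Some (Lt d True, p - 1, A[p := True])"
  | (keep) d f where "q = Lt d f" "0 < p" "p < length A" "d < kap" "p mod D \<noteq> cls r 0"
      "\<not> f \<longrightarrow> d + 1 < kap \<longrightarrow> p mod D = cls r (d + 1) \<longrightarrow> A ! p"
      "clock_step r (q, p, A) = Some (Lt d f, p - 1, A)"
proof (cases q)
  case (Rt d)
  have inv: "marked A" "p \<le> length A" "d < kap" "d = 0 \<longrightarrow> digit_all False {p..} r 0 A" using assms(1) Rt by auto
  have A: "A \<noteq> []" using inv(1) by (simp add: marked_def)
  show ?thesis
  proof (cases "p = length A")
    case True
    then have "clock_step r (q, p, A) = Some (Lt d False, p - 1, A)" using Rt A by (simp add: cell_symbol_def min_def list_update_beyond)
    then show ?thesis using turn[OF Rt True] A inv(3) True by simp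
  next
    case False
    then have p: "p < length A" using inv(2) by simp
    show ?thesis
    proof (cases "p mod D = cls r d")
      case True
      have "d = 0 \<longrightarrow> \<not> A ! p" using inv(4) True p by (auto simp: digit_all_def)
      moreover have "clock_step r (q, p, A) = Some (Rt d, p + 1, A[p := (d = 0)])"
        using Rt p True by (simp add: cell_symbol_def)
      ultimately show ?thesis using put[OF Rt p True inv(3)] by blast
    next
      case False
      have "clock_step r (q, p, A) = Some (Rt d, p + 1, A)" using Rt p False by (simp add: cell_symbol_def)
      then show ?thesis using pass[OF Rt p False inv(3)] by blast
    qed
  qed
next
  case (Lt d f)
  have inv: "marked A" "p < length A" "d < kap" using assms(1) Lt by auto
  have sy: "cell_symbol p A = Some (A ! p)" using inv(2) by (simp add: cell_symbol_def)
  show ?thesis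
  proof (cases "p = 0")
    case True
    have A0: "A ! 0" using inv(1,2) True by (simp add: marked_def)
    show ?thesis
    proof (cases f)
      case f: True
      then have "q = Lt d True" using Lt by simp
      moreover have "clock_step r (q, p, A) = Some (Rt 0, 0, A)" using Lt True f A0 sy inv(2)
        by (simp add: list_update_same_conv)
      ultimately show ?thesis using restart True inv(3) by blast
    next
      case nf: False
      then have q: "q = Lt d False" using Lt by simp
      show ?thesis
      proof (cases "d + 1 < kap")
        case d: True
        then have "clock_step r (q, p, A) = Some (Rt (d + 1), 0, A)" using q True A0 sy inv(2)
          by (simp add: list_update_same_conv)
        then show ?thesis using carry q True d by blast
      next
        case False
        then have "clock_step r (q, p, A) = None" using q True A0 sy by simp
        moreover have "d + 1 = kap" using False inv(3) by simp
        ultimately show ?thesis using stop q True by blast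
      qed
    qed
  next
    case False
    then have p: "0 < p" by simp
    have ne: "\<not> (p mod D = 0 \<and> A ! p)" using inv(1,2) False by (auto simp: marked_def)
    have mn: "min (p - 1) (length A) = p - 1" using inv(2) by simp
    show ?thesis
    proof (cases "p mod D = cls r 0")
      case True
      then have "clock_step r (q, p, A) = Some (Lt d f, p - 1, A[p := False])"
        using Lt sy mn by (simp add: cls_pos)
      then show ?thesis using clear[OF Lt p inv(2,3) True] by blast
    next
      case nc: False
      show ?thesis
      proof (cases "d + 1 < kap \<and> p mod D = cls r (d + 1) \<and> \<not> f")
        case c: True
        then have q: "q = Lt d False" using Lt by simp
        have e: "clock_step r (q, p, A) = Some (Lt d (\<not> A ! p), p - 1, A[p := True])"
          using q sy mn nc c by (simp add: cls_pos)
        show ?thesis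
        proof (cases "A ! p")
          case True
          then have "A[p := True] = A" using inv(2) by (simp add: list_update_same_conv)
          then have e': "clock_step r (q, p, A) = Some (Lt d False, p - 1, A)" using e True by simp
          show ?thesis by (rule keep[OF q p inv(2,3) nc _ e']) (use True in blast)
        next
          case False
          have e': "clock_step r (q, p, A) = Some (Lt d True, p - 1, A[p := True])" using e False by simp
          show ?thesis by (rule incr[OF q p inv(2) _ _ False e']) (use c in auto)
        qed
      next
        case nc2: False
        have "clock_step r (q, p, A) = Some (Lt d f, p - 1, A)"
        proof -
          have "clock_act r q (p mod D) (Some (A ! p)) = Some (Lt d f, A ! p, Move_Left)"
            unfolding Lt clock_act.simps using ne nc nc2 by (simp only: if_False)
          then show ?thesis using sy mn by simp
        qed
        then show ?thesis using keep[OF Lt p inv(2,3) nc] nc2 by blast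
      qed
    qed
  qed
qed

lemma marked_update: "marked A \<Longrightarrow> p mod D = cls r d \<Longrightarrow> marked (A[p := b])"
  by (auto simp: marked_def nth_update cls_pos)

lemma digit_all_update_other: "p mod D \<noteq> cls r d \<Longrightarrow> digit_all b I r d A \<Longrightarrow> digit_all b I r d (A[p := b'])"
  by (auto simp: digit_all_def nth_update)

lemma digit_all_subset: "digit_all b I r d A \<Longrightarrow> (\<And>p. p < length A \<Longrightarrow> p \<in> J \<Longrightarrow> p mod D = cls r d \<Longrightarrow> p \<in> I) \<Longrightarrow> digit_all b J r d A"
  by (auto simp: digit_all_def)

lemma digit_all_extend:
  assumes "digit_all b {p<..} r d A" "p mod D = cls r d \<Longrightarrow> A ! p = b"
  shows "digit_all b {p - 1<..} r d A"
  unfolding digit_all_def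
proof (intro allI impI)
  fix q assume q: "q < length A" "q \<in> {p - 1<..}" "q mod D = cls r d"
  then have "q = p \<or> p < q" by auto
  then show "A ! q = b" using q assms by (auto simp: digit_all_def)
qed

lemma tick_clock_step: "tick r (q, p, A) \<Longrightarrow> clock_step r (q, p, A) = Some (Rt 0, p + 1, A[p := True])"
  by (simp add: cell_symbol_def)

declare clock_step.simps [simp del]

lemma clock_inv_clock_step:
  assumes "clock_inv r (q, p, A)" "r < m" "clock_step r (q, p, A) = Some s"
  shows "clock_inv r s"
  using assms(1,2)
proof (cases rule: clock_step_cases)
  case (turn d)
  have "1 \<le> e \<and> e \<le> d \<Longrightarrow> digit_all False UNIV r e A" for e
    using assms(1) turn(1,2) by (cases "e = d") (auto intro: digit_all_subset)
  then show ?thesis using assms(1,3) turn by (auto simp: digit_all_def)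
next
  case (put d)
  have o: "e < kap \<Longrightarrow> e \<noteq> d \<Longrightarrow> p mod D \<noteq> cls r e" for e
    using put(3,4) cls_inj[of d e r r] by auto
  have "digit_all False {p + 1..} r 0 (A[p := True])" if "d = 0"
    using assms(1) put(1) that by (auto simp: digit_all_def nth_update)
  moreover have "digit_all False {..<p + 1} r d (A[p := False])" if "d \<noteq> 0"
    using assms(1) put(1) that by (auto simp: digit_all_def nth_update less_Suc_eq)
  moreover have "digit_all False UNIV r e (A[p := b])" if "digit_all False UNIV r e A" "e < kap" "e \<noteq> d" for e b
    using digit_all_update_other[OF o[OF that(2,3)] that(1)] .
  ultimately show ?thesis using assms(1,3) put(1,2,4,6) marked_update[OF _ put(3)] kap
    by (cases "d = 0") auto
next
  case (pass d)
  have "digit_all False {p + 1..} r 0 A" if "d = 0"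
    using assms(1) pass(1) that by (auto simp: digit_all_def)
  moreover have "digit_all False {..<p + 1} r d A" if "d \<noteq> 0"
    using assms(1) pass(1,3) that by (auto simp: digit_all_def less_Suc_eq)
  ultimately show ?thesis using assms(1,3) pass by auto
next
  case (restart d)
  have "digit_all False {0..} r 0 A"
    using assms(1) restart(1,2) cls_pos[of r 0] by (auto simp: digit_all_def)
  then show ?thesis using assms(1,3) restart kap by auto
next
  case (carry d)
  have "digit_all False {p<..} r 0 A" using assms(1) carry(1) by simp
  then have "digit_all False UNIV r 0 A"
    by (rule digit_all_subset) (use carry(2) cls_pos[of r 0] in \<open>auto intro: gr0I\<close>)
  moreover have "digit_all False {..<0} r (d + 1) A" by (simp add: digit_all_def)
  ultimately show ?thesis using assms(1,3) carry by auto
next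
  case stop
  then show ?thesis using assms(3) by simp
next
  case (clear d f)
  have o: "e < kap \<Longrightarrow> e \<noteq> 0 \<Longrightarrow> p mod D \<noteq> cls r e" for e
    using clear(5) cls_inj[of 0 e r r] kap by auto
  have "digit_all False {p - 1<..} r 0 (A[p := False])"
    using assms(1) clear(1) by (auto simp: digit_all_def nth_update)
  moreover have "\<not> f \<longrightarrow> d + 1 < kap \<longrightarrow> digit_all True {p - 1<..} r (d + 1) (A[p := False])"
    using assms(1) clear(1,2) o[of "d + 1"]
    by (auto simp: digit_all_def nth_update)
  moreover have "digit_all False UNIV r e (A[p := False])" if "digit_all False UNIV r e A" "1 \<le> e" "e \<le> d" for e
    by (rule digit_all_update_other[OF o that(1)]) (use that clear(4) in auto)
  ultimately show ?thesis using assms(1,3) clear(1-4,6) marked_update[OF _ clear(5)] by auto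
next
  case (incr d)
  have o: "e < kap \<Longrightarrow> e \<noteq> d + 1 \<Longrightarrow> p mod D \<noteq> cls r e" for e
    using incr(5,4) cls_inj[of "d + 1" e r r] kap by auto
  have "digit_all False {p - 1<..} r 0 (A[p := True])"
    using assms(1) incr(1,2) o[of 0] kap
    by (auto simp: digit_all_def nth_update)
  moreover have "digit_all False UNIV r e (A[p := True])" if "digit_all False UNIV r e A" "e \<le> d" for e
    by (rule digit_all_update_other[OF o that(1)]) (use that incr(4) in auto)
  ultimately show ?thesis using assms(1,3) incr(1-4,7) marked_update[OF _ incr(5)] by auto
next
  case (keep d f)
  have "digit_all False {p - 1<..} r 0 A"
    by (rule digit_all_extend) (use assms(1) keep(1,5) in auto)
  moreover have "\<not> f \<longrightarrow> d + 1 < kap \<longrightarrow> digit_all True {p - 1<..} r (d + 1) A"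
    by (intro impI digit_all_extend) (use assms(1) keep(1,6) in auto)
  ultimately show ?thesis using assms(1,3) keep by auto
qed

section \<open>Termination of the counter\<close>

definition zeros :: "nat \<Rightarrow> nat \<Rightarrow> bool list \<Rightarrow> nat" where
  "zeros r d A = card {p. p < length A \<and> p mod D = cls r d \<and> \<not> A ! p}"

lemma zeros_le: "zeros r d A \<le> length A"
  unfolding zeros_def by (rule order_trans[OF card_mono[of "{..<length A}"]]) auto

lemma zeros_update_other: "p mod D \<noteq> cls r d \<Longrightarrow> zeros r d (A[p := b]) = zeros r d A"
  unfolding zeros_def by (intro arg_cong[of _ _ card]) (auto simp: nth_update split: if_splits)

lemma zeros_set:
  assumes "p < length A" "p mod D = cls r d" "\<not> A ! p"
  shows "zeros r d A = Suc (zeros r d (A[p := True]))"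
proof -
  have "{p. p < length A \<and> p mod D = cls r d \<and> \<not> A ! p}
      = insert p {q. q < length (A[p := True]) \<and> q mod D = cls r d \<and> \<not> A[p := True] ! q}"
    using assms by (auto simp: nth_update split: if_splits)
  then show ?thesis using assms(1) unfolding zeros_def by (simp add: nth_update)
qed

text \<open>The digits above \<open>d\<close>, measured by what they lack, as a number in base
  \<open>B\<close>. The unit is one sweep of digit 0, hence the exponent \<open>e - 1\<close>. Base
  \<open>Suc (length A)\<close> is safe for every tape, while \<open>Suc g\<close> is exact when
  every digit has \<open>g\<close> cells.\<close>

definition weight :: "nat \<Rightarrow> nat \<Rightarrow> nat \<Rightarrow> bool list \<Rightarrow> nat" where
  "weight B r d A = (\<Sum>e\<in>{d + 1..<kap}. zeros r e A * B ^ (e - 1))"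

lemma weight_cong: "(\<And>e. d < e \<Longrightarrow> e < kap \<Longrightarrow> zeros r e A = zeros r e A') \<Longrightarrow> weight B r d A = weight B r d A'"
  unfolding weight_def by (rule sum.cong) auto

lemma weight_update:
  assumes "p mod D = cls r e" "e \<le> d" "d < kap"
  shows "weight B r d (A[p := b]) = weight B r d A"
  by (rule weight_cong, rule zeros_update_other) (use assms cls_inj[of e _ r r] in auto)

lemma weight_Suc: "d + 1 < kap \<Longrightarrow> weight B r d A = zeros r (d + 1) A * B ^ d + weight B r (d + 1) A"
  unfolding weight_def by (simp add: sum.atLeast_Suc_lessThan)

lemma weight_mono: "d \<le> d' \<Longrightarrow> weight B r d' A \<le> weight B r d A"
  unfolding weight_def by (rule sum_mono2) auto

lemma geometric_sum_nat: "(\<Sum>e\<in>{1..<Suc d}. b * Suc b ^ (e - 1)) + 1 = Suc b ^ d"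
proof (induction d)
  case (Suc d)
  have "(\<Sum>e\<in>{1..<Suc (Suc d)}. b * Suc b ^ (e - 1))
      = (\<Sum>e\<in>{1..<Suc d}. b * Suc b ^ (e - 1)) + b * Suc b ^ d" by simp
  then show ?case using Suc by simp
qed simp

lemma weight_split:
  assumes "d < kap"
  shows "weight B r 0 A = (\<Sum>e\<in>{1..<Suc d}. zeros r e A * B ^ (e - 1)) + weight B r d A"
proof -
  have "{0 + 1..<kap} = {1..<Suc d} \<union> {d + 1..<kap}" using assms by auto
  then show ?thesis unfolding weight_def by (simp add: sum.union_disjoint)
qed

lemma weight_low_le:
  assumes "length A \<le> b"
  shows "(\<Sum>e\<in>{1..<Suc d}. zeros r e A * Suc b ^ (e - 1)) + 1 \<le> Suc b ^ d"
proof -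
  have "(\<Sum>e\<in>{1..<Suc d}. zeros r e A * Suc b ^ (e - 1)) \<le> (\<Sum>e\<in>{1..<Suc d}. b * Suc b ^ (e - 1))"
    by (rule sum_mono) (use zeros_le[of r _ A] assms in \<open>auto intro!: mult_le_mono1 order_trans[OF zeros_le]\<close>)
  then show ?thesis using geometric_sum_nat[where b = b and d = d] by linarith
qed

lemma weight_incr_eq:
  assumes "d + 1 < kap" "p < length A" "p mod D = cls r (d + 1)" "\<not> A ! p"
  shows "weight B r d A = B ^ d + weight B r d (A[p := True])"
proof -
  have "weight B r (d + 1) (A[p := True]) = weight B r (d + 1) A"
    by (rule weight_update[OF assms(3) order_refl assms(1)])
  then show ?thesis using zeros_set[OF assms(2-4)] by (simp add: weight_Suc[OF assms(1)])
qed

text \<open>Filling a 0 of digit \<open>d + 1\<close> removes \<open>B ^ d\<close>, and the digits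
  below, even if they are all zero, are worth less than that.\<close>

lemma weight_incr_less:
  assumes "d + 1 < kap" "p < length A" "p mod D = cls r (d + 1)" "\<not> A ! p"
  shows "weight (Suc (length A)) r 0 (A[p := True]) < weight (Suc (length A)) r d A"
proof -
  have dk: "d < kap" using assms(1) by simp
  have le: "length (A[p := True]) \<le> length A" by simp
  show ?thesis
    using weight_split[OF dk, of "Suc (length A)" r "A[p := True]"] weight_low_le[OF le, where r = r and d = d]
      weight_incr_eq[OF assms, of "Suc (length A)"] by linarith
qed

text \<open>The lexicographic order on the weight and \<open>kap - d\<close> in one number: a carry
  need not lower the weight but raises \<open>d\<close>, and \<open>kap - d\<close> stays below the
  factor \<open>kap + 1\<close>.\<close>

definition potential :: "nat \<Rightarrow> nat \<Rightarrow> bool list \<Rightarrow> nat" where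
  "potential r d A = (kap + 1) * weight (Suc (length A)) r d A + (kap - d)"

text \<open>The position within a pair of sweeps takes less than \<open>2 * length A + 4\<close>,
  one unit of the potential. After \<open>Lt d True\<close> the counter goes on with
  \<open>Rt 0\<close>, whence the \<open>potential r 0 A + 1\<close>.\<close>

fun clock_meas :: "nat \<Rightarrow> clock_config \<Rightarrow> nat" where
  "clock_meas r (Rt d, p, A) = potential r d A * (2 * length A + 4) + (length A - p) + length A + 3"
| "clock_meas r (Lt d f, p, A) = (if f then potential r 0 A + 1 else potential r d A) * (2 * length A + 4) + p + 1"

lemma clock_meas_clock_step:
  assumes "clock_inv r (q, p, A)" "r < m" "clock_step r (q, p, A) = Some s"
  shows "clock_meas r s < clock_meas r (q, p, A)"
  using assms(1,2)
proof (cases rule: clock_step_cases)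
  case (turn d)
  then show ?thesis using assms(3) by auto
next
  case (put d)
  have "potential r d (A[p := d = 0]) = potential r d A"
    unfolding potential_def using weight_update[OF put(3) order_refl put(4)] by simp
  then show ?thesis using assms(3) put(1,2,6) by auto
next
  case (pass d)
  then show ?thesis using assms(3) by auto
next
  case (restart d)
  then show ?thesis using assms(3) by auto
next
  case (carry d)
  have "potential r (d + 1) A + 1 \<le> potential r d A"
    unfolding potential_def using weight_mono[of d "d + 1" "Suc (length A)" r A] carry(3) mult_le_mono2[of "weight (Suc (length A)) r (d + 1) A" "weight (Suc (length A)) r d A" "kap + 1"]
    by linarith
  then have "(potential r (d + 1) A + 1) * (2 * length A + 4) \<le> potential r d A * (2 * length A + 4)"
    by (rule mult_le_mono1)
  then show ?thesis using assms(3) carry(1,2,4) by auto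
next
  case stop
  then show ?thesis using assms(3) by simp
next
  case (clear d f)
  have "potential r d (A[p := False]) = potential r d A" "potential r 0 (A[p := False]) = potential r 0 A"
    unfolding potential_def using weight_update[OF clear(5), of d] weight_update[OF clear(5), of 0] clear(4) kap by simp_all
  then show ?thesis using assms(3) clear(1,2,6) by auto
next
  case (incr d)
  have "(kap + 1) * (weight (Suc (length A)) r 0 (A[p := True]) + 1) \<le> (kap + 1) * weight (Suc (length A)) r d A"
    using weight_incr_less[OF incr(4,3,5,6)] by (intro mult_le_mono2) simp
  then have "potential r 0 (A[p := True]) + 1 \<le> potential r d A"
    unfolding potential_def using incr(4) by simp
  then have "(potential r 0 (A[p := True]) + 1) * (2 * length A + 4) \<le> potential r d A * (2 * length A + 4)"
    by (rule mult_le_mono1)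
  then show ?thesis using assms(3) incr(1,2,7) by auto
next
  case (keep d f)
  then show ?thesis using assms(3) by auto
qed

lemma clock_induct [consumes 2, case_names step]:
  assumes "clock_inv r s" "r < m"
    and "\<And>q p A. clock_inv r (q, p, A) \<Longrightarrow> (\<And>s'. clock_step r (q, p, A) = Some s' \<Longrightarrow> P s') \<Longrightarrow> P (q, p, A)"
  shows "P s"
  using assms(1)
proof (induction "clock_meas r s" arbitrary: s rule: less_induct)
  case less
  obtain q p A where s: "s = (q, p, A)" by (cases s)
  show ?case unfolding s
  proof (rule assms(3))
    show "clock_inv r (q, p, A)" using less.prems s by simp
    fix s' assume "clock_step r (q, p, A) = Some s'"
    then show "P s'" using less s clock_meas_clock_step[OF _ assms(2)] clock_inv_clock_step[OF _ assms(2)] by blast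
  qed
qed

section \<open>The sequence of ticks\<close>

text \<open>Recursion on fuel, because termination is known only under \<open>clock_inv\<close>;
  \<open>tick_trace_enough\<close> makes the result independent of the fuel.\<close>

fun tick_trace :: "nat \<Rightarrow> nat \<Rightarrow> clock_config \<Rightarrow> bool list list" where
  "tick_trace 0 r s = []"
| "tick_trace (Suc n) r s = (if tick r s then [snd (snd s)] else []) @
     (case clock_step r s of None \<Rightarrow> [] | Some s' \<Rightarrow> tick_trace n r s')"

text \<open>A tick records the tape before the cell under the head is set.\<close>

definition ticks :: "nat \<Rightarrow> clock_config \<Rightarrow> bool list list" where
  "ticks r s = tick_trace (Suc (clock_meas r s)) r s"

lemma tick_trace_enough:
  assumes "clock_inv r s" "r < m" "clock_meas r s < n"
  shows "tick_trace n r s = ticks r s"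
proof -
  have "\<forall>n n'. clock_meas r s < n \<longrightarrow> clock_meas r s < n' \<longrightarrow> tick_trace n r s = tick_trace n' r s"
    using assms(1,2)
  proof (induction rule: clock_induct)
    case (step q p A)
    show ?case
    proof (intro allI impI)
      fix n n' assume n: "clock_meas r (q, p, A) < n" "clock_meas r (q, p, A) < n'"
      then obtain k k' where k: "n = Suc k" "n' = Suc k'" by (metis not0_implies_Suc not_less0)
      show "tick_trace n r (q, p, A) = tick_trace n' r (q, p, A)"
      proof (cases "clock_step r (q, p, A)")
        case None
        then show ?thesis by (simp only: k tick_trace.simps option.case)
      next
        case (Some s')
        have "clock_meas r s' < k" "clock_meas r s' < k'" using clock_meas_clock_step[OF step(1) assms(2) Some] n k by auto
        then have "tick_trace k r s' = tick_trace k' r s'" using step(2)[OF Some] by blast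
        then show ?thesis using Some by (simp only: k tick_trace.simps option.case)
      qed
    qed
  qed
  then show ?thesis using assms(3) unfolding ticks_def by blast
qed

lemma ticks_step:
  assumes "clock_inv r (q, p, A)" "r < m"
  shows "ticks r (q, p, A) = (if tick r (q, p, A) then [A] else []) @
           (case clock_step r (q, p, A) of None \<Rightarrow> [] | Some s' \<Rightarrow> ticks r s')"
proof (cases "clock_step r (q, p, A)")
  case None
  then show ?thesis unfolding ticks_def by (simp only: tick_trace.simps option.case snd_conv)
next
  case (Some s')
  have "tick_trace (clock_meas r (q, p, A)) r s' = ticks r s'"
    by (rule tick_trace_enough[OF clock_inv_clock_step[OF assms Some] assms(2) clock_meas_clock_step[OF assms Some]])
  then show ?thesis unfolding ticks_def[of r "(q, p, A)"] using Some by (simp only: tick_trace.simps option.case snd_conv)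
qed

text \<open>This is the part of the tape that the level \<open>r\<close> counter never changes. It
  recovers the starting tape at any moment of a run, so the invariant of the game need not store
  that tape.\<close>

definition clear_level :: "nat \<Rightarrow> bool list \<Rightarrow> bool list" where
  "clear_level r A = map (\<lambda>p. A ! p \<and> \<not> (\<exists>d<kap. p mod D = cls r d)) [0..<length A]"

lemma length_clear_level [simp]: "length (clear_level r A) = length A"
  by (simp add: clear_level_def)

lemma clear_level_update: "p mod D = cls r d \<Longrightarrow> d < kap \<Longrightarrow> clear_level r (A[p := b]) = clear_level r A"
  by (rule nth_equalityI) (auto simp: clear_level_def nth_update)

lemma clear_level_id_iff: "clear_level r A = A \<longleftrightarrow> (\<forall>d<kap. digit_all False UNIV r d A)"
proof -
  have "clear_level r A = A \<longleftrightarrow> (\<forall>p<length A. clear_level r A ! p = A ! p)" by (subst list_eq_iff_nth_eq) simp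
  also have "\<dots> \<longleftrightarrow> (\<forall>p<length A. \<forall>d<kap. p mod D = cls r d \<longrightarrow> \<not> A ! p)" unfolding clear_level_def by simp blast
  also have "\<dots> \<longleftrightarrow> (\<forall>d<kap. digit_all False UNIV r d A)" unfolding digit_all_def by simp blast
  finally show ?thesis .
qed

lemma clear_level_clock_step:
  assumes "clock_inv r (q, p, A)" "r < m" "clock_step r (q, p, A) = Some (q', p', A')"
  shows "clear_level r A' = clear_level r A \<and> length A' = length A"
  using assms(1,2)
proof (cases rule: clock_step_cases)
  case (put d)
  then show ?thesis using assms(3) clear_level_update[OF put(3,4)] by auto
next
  case (clear d f)
  then show ?thesis using assms(3) clear_level_update[OF clear(5)] kap by auto
next
  case (incr d)
  then show ?thesis using assms(3) clear_level_update[OF incr(5,4)] by auto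
qed (use assms(3) in auto)

text \<open>The right sweeps have cleared the digits from 1 on, the last left sweep digit 0. So the
  picking player finds the tape as the guessing player found it and can repeat the same run.\<close>

lemma clear_level_stop:
  assumes "clock_inv r (q, p, A)" "r < m" "clock_step r (q, p, A) = None"
  shows "clear_level r A = A \<and> p = 0"
  using assms(1,2)
proof (cases rule: clock_step_cases)
  case (stop d)
  have "digit_all False UNIV r e A" if "e < kap" for e
  proof (cases "e = 0")
    case True
    have "digit_all False {p<..} r 0 A" using assms(1) stop(1) by simp
    then show ?thesis unfolding True by (rule digit_all_subset) (use stop(2) cls_pos[of r 0] in \<open>auto intro: gr0I\<close>)
  next
    case False
    then show ?thesis using assms(1) stop(1,3) that by auto
  qed
  then show ?thesis using stop(2) clear_level_id_iff by blast
qed (use assms(3) in auto)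

lemma clear_level_ticks:
  assumes "clock_inv r s" "r < m" "B \<in> set (ticks r s)"
  shows "clear_level r B = clear_level r (snd (snd s)) \<and> length B = length (snd (snd s))"
  using assms
proof (induction rule: clock_induct)
  case (step q p A)
  consider "B = A" | s' where "clock_step r (q, p, A) = Some s'" "B \<in> set (ticks r s')"
    using step(3) unfolding ticks_step[OF step(1) assms(2)]
    by (cases "clock_step r (q, p, A)") (auto split: if_splits)
  then show ?case
  proof cases
    case 2
    obtain q' p' A' where s': "s' = (q', p', A')" by (cases s')
    show ?thesis using step(2)[OF 2] clear_level_clock_step[OF step(1) assms(2)] 2(1) s' by simp
  qed simp
qed

text \<open>
  The weight of the digits, with \<open>zeros r 0\<close> as a tie-breaker, decreases from tick to tick, hence
  the tapes at the ticks are distinct.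
\<close>

fun below :: "nat \<Rightarrow> clock_config \<Rightarrow> bool list \<Rightarrow> bool" where
  "below r (Rt d, p, A) B \<longleftrightarrow> (let w = weight (Suc (length A)) r in
     w 0 B < w d A \<or> d = 0 \<and> w 0 B = w 0 A \<and> zeros r 0 B \<le> zeros r 0 A)"
| "below r (Lt d f, p, A) B \<longleftrightarrow> (let w = weight (Suc (length A)) r in
     if f then w 0 B \<le> w 0 A else w 0 B < w d A)"

lemma below_clock_step:
  assumes "clock_inv r (q, p, A)" "r < m" "clock_step r (q, p, A) = Some s" "below r s B"
  shows "below r (q, p, A) B \<and> (tick r (q, p, A) \<longrightarrow> B \<noteq> A)"
  using assms(1,2)
proof (cases rule: clock_step_cases)
  case (turn d)
  then show ?thesis using assms(3,4) by (auto simp: Let_def)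
next
  case (put d)
  have w: "weight b r d (A[p := c]) = weight b r d A" for b c
    by (rule weight_update[OF put(3) order_refl put(4)])
  have z: "d = 0 \<longrightarrow> zeros r 0 A = Suc (zeros r 0 (A[p := True]))"
    using zeros_set[OF put(2,3)] put(5) by auto
  show ?thesis using assms(3,4) put(1,6) w[of "Suc (length A)"] z by (auto simp: Let_def)
next
  case (pass d)
  then show ?thesis using assms(3,4) by (auto simp: Let_def)
next
  case (restart d)
  then show ?thesis using assms(3,4) by (auto simp: Let_def)
next
  case (carry d)
  then show ?thesis using assms(3,4) weight_mono[of d "d + 1" "Suc (length A)" r A] by (auto simp: Let_def)
next
  case stop
  then show ?thesis using assms(3) by simp
next
  case (clear d f)
  have "weight b r d (A[p := False]) = weight b r d A" "weight b r 0 (A[p := False]) = weight b r 0 A" for b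
    using weight_update[OF clear(5), of d] weight_update[OF clear(5), of 0] clear(4) kap by simp_all
  then show ?thesis using assms(3,4) clear(1,2,6) by (auto simp: Let_def)
next
  case (incr d)
  then show ?thesis using assms(3,4) weight_incr_less[OF incr(4,3,5,6)] by (auto simp: Let_def)
next
  case (keep d f)
  then show ?thesis using assms(3,4) by (auto simp: Let_def)
qed

end

definition xorl :: "bool list \<Rightarrow> bool" where
  "xorl bs \<longleftrightarrow> odd (length (filter id bs))"

lemma xorl_simps [simp]: "xorl [] = False" "xorl (b # bs) = (b \<noteq> xorl bs)" "xorl (bs @ cs) = (xorl bs \<noteq> xorl cs)"
  by (auto simp: xorl_def)

lemma xorl_concat: "xorl (map f (concat xss)) = xorl (map (\<lambda>xs. xorl (map f xs)) xss)"
  by (induction xss) simp_all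

lemma xorl_distinct:
  assumes "distinct xs" "inj_on h (set xs)"
  shows "xorl (map (\<lambda>a. y (h a)) xs) = parity (h ` set xs) y"
proof -
  have "{v \<in> h ` set xs. y v} = h ` set (filter (\<lambda>a. y (h a)) xs)" by auto
  moreover have "card (h ` set (filter (\<lambda>a. y (h a)) xs)) = length (filter (\<lambda>a. y (h a)) xs)"
  proof -
    have "inj_on h (set (filter (\<lambda>a. y (h a)) xs))" by (rule inj_on_subset[OF assms(2)]) auto
    then have "card (h ` set (filter (\<lambda>a. y (h a)) xs)) = card (set (filter (\<lambda>a. y (h a)) xs))"
      by (rule card_image)
    then show ?thesis using distinct_card[OF distinct_filter[OF assms(1)]] by metis
  qed
  ultimately show ?thesis by (simp add: xorl_def parity_def filter_map comp_def)
qed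

context counter
begin

lemma ticks_below:
  assumes "clock_inv r s" "r < m"
  shows "distinct (ticks r s) \<and> (\<forall>B\<in>set (ticks r s). below r s B)"
  using assms
proof (induction rule: clock_induct)
  case (step q p A)
  note eq = ticks_step[OF step(1) assms(2)]
  have self: "tick r (q, p, A) \<Longrightarrow> below r (q, p, A) A" by auto
  show ?case
  proof (cases "clock_step r (q, p, A)")
    case None
    then show ?thesis using self unfolding eq by auto
  next
    case (Some s')
    have IH: "distinct (ticks r s')" "\<forall>B\<in>set (ticks r s'). below r s' B" using step(2)[OF Some] by auto
    have b: "\<forall>B\<in>set (ticks r s'). below r (q, p, A) B \<and> (tick r (q, p, A) \<longrightarrow> B \<noteq> A)"
      using IH(2) below_clock_step[OF step(1) assms(2) Some] by blast
    show ?thesis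
    proof (cases "tick r (q, p, A)")
      case True
      then have e: "ticks r (q, p, A) = A # ticks r s'" using Some unfolding eq by simp
      show ?thesis unfolding e using IH(1) b self[OF True] True by (simp only: distinct.simps set_simps) blast
    next
      case False
      then have e: "ticks r (q, p, A) = ticks r s'" using Some unfolding eq by simp
      show ?thesis unfolding e using IH(1) b by blast
    qed
  qed
qed

section \<open>The number of ticks\<close>

definition digit_cells :: "nat \<Rightarrow> nat \<Rightarrow> nat \<Rightarrow> nat \<Rightarrow> nat" where
  "digit_cells r d p n = card {i. p \<le> i \<and> i < n \<and> i mod D = cls r d}"

text \<open>The ticks still to come: those of the current sweep \<open>Rt 0\<close>, and
  \<open>g\<close> for each later one, of which there is one per unit of weight in base
  \<open>Suc g\<close>.\<close>

fun tick_count :: "nat \<Rightarrow> nat \<Rightarrow> clock_config \<Rightarrow> nat" where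
  "tick_count g r (Rt d, p, A) =
     (if d = 0 then digit_cells r 0 p (length A) + g * weight (Suc g) r 0 A else g * weight (Suc g) r d A)"
| "tick_count g r (Lt d f, p, A) = (if f then g * (1 + weight (Suc g) r 0 A) else g * weight (Suc g) r d A)"

lemma zeros_full: "digit_all False UNIV r d A \<Longrightarrow> zeros r d A = digit_cells r d 0 (length A)"
  unfolding zeros_def digit_cells_def digit_all_def by (intro arg_cong[of _ _ card]) auto

lemma digit_cells_Suc: "p < n \<Longrightarrow> digit_cells r d p n = (if p mod D = cls r d then 1 else 0) + digit_cells r d (p + 1) n"
proof -
  assume p: "p < n"
  have "{i. p \<le> i \<and> i < n \<and> i mod D = cls r d}
      = (if p mod D = cls r d then {p} else {}) \<union> {i. p + 1 \<le> i \<and> i < n \<and> i mod D = cls r d}"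
    using p by (auto simp: Suc_le_eq order_le_less)
  moreover have "finite {i. p + 1 \<le> i \<and> i < n \<and> i mod D = cls r d}" by simp
  ultimately show ?thesis unfolding digit_cells_def by (auto simp: card_insert_if)
qed

lemma weight_low_full:
  assumes "\<forall>e. 1 \<le> e \<and> e \<le> d \<longrightarrow> zeros r e A = g"
  shows "(\<Sum>e\<in>{1..<Suc d}. zeros r e A * Suc g ^ (e - 1)) + 1 = Suc g ^ d"
proof -
  have "(\<Sum>e\<in>{1..<Suc d}. zeros r e A * Suc g ^ (e - 1)) = (\<Sum>e\<in>{1..<Suc d}. g * Suc g ^ (e - 1))"
    by (rule sum.cong) (use assms in auto)
  then show ?thesis using geometric_sum_nat[where b = g and d = d] by simp
qed

lemma tick_count_clock_step:
  assumes "clock_inv r (q, p, A)" "r < m" "\<And>d. d < kap \<Longrightarrow> digit_cells r d 0 (length A) = g"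
  shows "tick_count g r (q, p, A) = (if tick r (q, p, A) then 1 else 0) +
           (case clock_step r (q, p, A) of None \<Rightarrow> 0 | Some s \<Rightarrow> tick_count g r s)"
  using assms(1,2)
proof (cases rule: clock_step_cases)
  case (turn d)
  then show ?thesis by (simp add: digit_cells_def)
next
  case (put d)
  have "weight (Suc g) r d (A[p := c]) = weight (Suc g) r d A" for c
    by (rule weight_update[OF put(3) order_refl put(4)])
  then show ?thesis using put digit_cells_Suc[OF put(2), of r 0] by (auto simp: put(3))
next
  case (pass d)
  then show ?thesis using digit_cells_Suc[OF pass(2), of r 0] by auto
next
  case (restart d)
  then show ?thesis using assms(3)[of 0] kap by simp
next
  case (carry d)
  have "zeros r (d + 1) A = 0"
  proof -
    have "digit_all True {p<..} r (d + 1) A" using assms(1) carry(1,3) by simp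
    then have "{p. p < length A \<and> p mod D = cls r (d + 1) \<and> \<not> A ! p} = {}"
      using carry(2) cls_pos[of r "d + 1"] by (auto simp: digit_all_def)
    then show ?thesis by (simp only: zeros_def card.empty)
  qed
  then show ?thesis using carry weight_Suc[OF carry(3), of "Suc g" r A] by simp
next
  case (stop d)
  then show ?thesis by (simp add: weight_def)
next
  case (clear d f)
  have "weight (Suc g) r d (A[p := False]) = weight (Suc g) r d A" "weight (Suc g) r 0 (A[p := False]) = weight (Suc g) r 0 A"
    using weight_update[OF clear(5), of d] weight_update[OF clear(5), of 0] clear(4) kap by simp_all
  then show ?thesis using clear by simp
next
  case (incr d)
  have dk: "d < kap" using incr(4) by simp
  let ?A = "A[p := True]"
  \<comment> \<open>The digits from 1 to \<open>d\<close> hold only zeros, hence are worth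
    \<open>Suc g ^ d - 1\<close>; so the overflow together with the increment lowers the weight by
    exactly 1.\<close>
  have "zeros r e ?A = g" if e: "1 \<le> e \<and> e \<le> d" for e
  proof -
    have "p mod D \<noteq> cls r e" using incr(4,5) cls_inj[of e "d + 1" r r] e by auto
    then have "zeros r e ?A = zeros r e A" by (rule zeros_update_other)
    also have "\<dots> = g" using zeros_full[of r e A] assms(1) assms(3)[of e] incr(1) e dk by simp
    finally show ?thesis .
  qed
  then have "weight (Suc g) r d A = 1 + weight (Suc g) r 0 ?A"
    using weight_split[OF dk, of "Suc g" r ?A] weight_low_full[of d r ?A g] weight_incr_eq[OF incr(4,3,5,6), of "Suc g"]
    by simp
  then show ?thesis using incr by simp
next
  case (keep d f)
  then show ?thesis by simp
qed

lemma length_ticks: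
  assumes "clock_inv r s" "r < m" "\<And>d. d < kap \<Longrightarrow> digit_cells r d 0 (length (snd (snd s))) = g"
  shows "length (ticks r s) = tick_count g r s"
  using assms
proof (induction rule: clock_induct)
  case (step q p A)
  have g: "\<And>d. d < kap \<Longrightarrow> digit_cells r d 0 (length A) = g" using step(3) by simp
  have tc: "tick_count g r (q, p, A) = (if tick r (q, p, A) then 1 else 0) +
           (case clock_step r (q, p, A) of None \<Rightarrow> 0 | Some s \<Rightarrow> tick_count g r s)"
    by (rule tick_count_clock_step[OF step(1) assms(2)]) (rule g)
  note eq = ticks_step[OF step(1) assms(2)] tc
  show ?case
  proof (cases "clock_step r (q, p, A)")
    case None
    show ?thesis unfolding eq None by (simp del: tick.simps)
  next
    case (Some s')
    obtain q' p' A' where s': "s' = (q', p', A')" by (cases s')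
    have "length A' = length A" using clear_level_clock_step[OF step(1) assms(2)] Some s' by blast
    then have "length (ticks r s') = tick_count g r s'" using step(2)[OF Some] g s' by simp
    then show ?thesis unfolding eq Some by (simp del: tick.simps)
  qed
qed

lemma digit_cells_complete: "c < D \<Longrightarrow> card {i. i < D * g \<and> i mod D = c} = g"
proof -
  assume c: "c < D"
  have "{i. i < D * g \<and> i mod D = c} = (\<lambda>j. D * j + c) ` {..<g}"
  proof
    show "{i. i < D * g \<and> i mod D = c} \<subseteq> (\<lambda>j. D * j + c) ` {..<g}"
    proof
      fix i assume i: "i \<in> {i. i < D * g \<and> i mod D = c}"
      then have "i = D * (i div D) + c" by auto
      moreover have "i div D < g" using i by (auto intro: less_mult_imp_div_less simp: mult.commute)
      ultimately show "i \<in> (\<lambda>j. D * j + c) ` {..<g}" by blast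
    qed
    show "(\<lambda>j. D * j + c) ` {..<g} \<subseteq> {i. i < D * g \<and> i mod D = c}"
    proof
      fix i assume "i \<in> (\<lambda>j. D * j + c) ` {..<g}"
      then obtain j where j: "j < g" "i = D * j + c" by auto
      have "D * j + c < D * Suc j" using c by simp
      also have "\<dots> \<le> D * g" using j(1) by (intro mult_le_mono2) simp
      finally show "i \<in> {i. i < D * g \<and> i mod D = c}" using j c by simp
    qed
  qed
  moreover have "inj_on (\<lambda>j. D * j + c) {..<g}" using D_pos by (auto simp: inj_on_def)
  ultimately show ?thesis by (simp add: card_image)
qed

section \<open>The tree of addresses\<close>

definition ready :: "nat \<Rightarrow> bool list \<Rightarrow> bool" where
  "ready r A \<longleftrightarrow> marked A \<and> (\<forall>r'. r \<le> r' \<and> r' < m \<longrightarrow> clear_level r' A = A)"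

definition outside :: "nat \<Rightarrow> nat \<Rightarrow> bool" where
  "outside r p \<longleftrightarrow> (\<forall>d<kap. p mod D \<noteq> cls r d)"

lemma clock_inv_start: "ready r A \<Longrightarrow> r < m \<Longrightarrow> clock_inv r (Rt 0, 0, A)"
  using kap by (auto simp: ready_def clear_level_id_iff digit_all_def)

definition level_ticks :: "nat \<Rightarrow> bool list \<Rightarrow> bool list list" where
  "level_ticks r A = ticks r (Rt 0, 0, A)"

lemma clear_level_eq_outside:
  "clear_level r A = clear_level r B \<Longrightarrow> length A = length B \<Longrightarrow> p < length A \<Longrightarrow> outside r p \<Longrightarrow> A ! p = B ! p"
proof -
  assume a: "clear_level r A = clear_level r B" "length A = length B" "p < length A" "outside r p"
  have "clear_level r A ! p = A ! p" "clear_level r B ! p = B ! p" using a(2-4) by (auto simp: clear_level_def outside_def)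
  then show ?thesis using a(1) by simp
qed

lemma ready_agree:
  assumes "ready r A" "length B = length A" "\<And>p. p < length A \<Longrightarrow> outside r p \<Longrightarrow> B ! p = A ! p"
  shows "ready (Suc r) B"
proof -
  have A: "marked A" using assms(1) by (simp add: ready_def)
  have "B ! p = A ! p" if "p < length A" "p mod D = 0" for p
    by (rule assms(3)[OF that(1)]) (use that(2) in \<open>simp add: outside_def cls_pos[symmetric]\<close>)
  then have "marked B" using A assms(2) unfolding marked_def by (metis length_0_conv)
  moreover have "clear_level r' B = B" if r': "Suc r \<le> r'" "r' < m" for r'
  proof -
    have "clear_level r' A = A" using assms(1) r' by (simp add: ready_def)
    then have a: "\<And>d p. d < kap \<Longrightarrow> p < length A \<Longrightarrow> p mod D = cls r' d \<Longrightarrow> \<not> A ! p"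
      unfolding clear_level_id_iff by (simp add: digit_all_def)
    have "\<not> B ! p" if p: "d < kap" "p < length B" "p mod D = cls r' d" for d p
    proof -
      have "outside r p" using p r'(1) cls_inj[of d _ r' r] by (auto simp: outside_def)
      then show ?thesis using assms(2,3) p a by metis
    qed
    then show ?thesis unfolding clear_level_id_iff by (simp add: digit_all_def)
  qed
  ultimately show ?thesis by (simp add: ready_def)
qed

lemma level_ticks:
  assumes "ready r A" "r < m" "B \<in> set (level_ticks r A)"
  shows "length B = length A" "ready (Suc r) B" "clear_level r B = A"
    "\<And>p. p < length A \<Longrightarrow> outside r p \<Longrightarrow> B ! p = A ! p"
proof -
  have cl: "clear_level r B = clear_level r A" "length B = length A"
    using clear_level_ticks[OF clock_inv_start[OF assms(1,2)] assms(2)] assms(3) by (auto simp: level_ticks_def)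
  then show "length B = length A" by simp
  show o: "B ! p = A ! p" if "p < length A" "outside r p" for p
    by (rule clear_level_eq_outside[OF cl]) (use cl that in auto)
  show "ready (Suc r) B" by (rule ready_agree[OF assms(1) cl(2) o])
  show "clear_level r B = A" using cl(1) assms(1,2) by (simp add: ready_def)
qed

lemma level_ticks_distinct: "ready r A \<Longrightarrow> r < m \<Longrightarrow> distinct (level_ticks r A)"
  unfolding level_ticks_def using ticks_below[OF clock_inv_start] by blast

lemma length_level_ticks:
  assumes "ready r A" "r < m" "length A = D * g"
  shows "length (level_ticks r A) = g * Suc g ^ (kap - 1)"
proof -
  have h: "digit_cells r d 0 (length A) = g" if "d < kap" for d
    using digit_cells_complete[OF cls_less[OF assms(2) that], of g] by (simp add: digit_cells_def assms(3))
  have "digit_all False UNIV r d A" if "d < kap" for d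
    using assms(1,2) that clear_level_id_iff[of r A] by (simp add: ready_def)
  then have "\<forall>e. 1 \<le> e \<and> e \<le> kap - 1 \<longrightarrow> zeros r e A = g" using h zeros_full kap by auto
  then have "weight (Suc g) r 0 A + 1 = Suc g ^ (kap - 1)"
    using weight_low_full[of "kap - 1" r A g] kap unfolding weight_def by simp
  then have "digit_cells r 0 0 (length A) + g * weight (Suc g) r 0 A = g * Suc g ^ (kap - 1)"
    using h[of 0] kap by (metis add.commute distrib_left le_neq_implies_less mult.right_neutral not_one_le_zero gr0I)
  then show ?thesis
    unfolding level_ticks_def using length_ticks[OF clock_inv_start[OF assms(1,2)] assms(2), of g] h by simp
qed

text \<open>The addresses whose bits enter the parity. Each level writes only to its own residues,
  so the choices made at earlier levels stay on the tape as part of the address.\<close>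

fun leaves :: "nat \<Rightarrow> nat \<Rightarrow> bool list \<Rightarrow> bool list list" where
  "leaves 0 r A = [A]"
| "leaves (Suc n) r A = concat (map (leaves n (Suc r)) (level_ticks r A))"

lemma leaves_agree:
  assumes "ready r A" "r + n = m" "B \<in> set (leaves n r A)"
  shows "length B = length A \<and> (\<forall>p<length A. (\<forall>r'. r \<le> r' \<and> r' < m \<longrightarrow> outside r' p) \<longrightarrow> B ! p = A ! p)"
  using assms
proof (induction n arbitrary: r A)
  case (Suc n)
  then obtain C where C: "C \<in> set (level_ticks r A)" "B \<in> set (leaves n (Suc r) C)" by auto
  have r: "r < m" using Suc.prems(2) by simp
  note lt = level_ticks[OF Suc.prems(1) r C(1)]
  have IH: "length B = length C \<and> (\<forall>p<length C. (\<forall>r'. Suc r \<le> r' \<and> r' < m \<longrightarrow> outside r' p) \<longrightarrow> B ! p = C ! p)"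
    by (rule Suc.IH[OF lt(2) _ C(2)]) (use Suc.prems(2) in simp)
  have "B ! p = A ! p" if "p < length A" "\<forall>r'. r \<le> r' \<and> r' < m \<longrightarrow> outside r' p" for p
  proof -
    have "B ! p = C ! p" using IH that lt(1) by (simp add: Suc_le_eq)
    also have "\<dots> = A ! p" using lt(4) that r by blast
    finally show ?thesis .
  qed
  then show ?case using IH lt(1) by simp
qed simp

text \<open>The tapes at two ticks of level \<open>r\<close> differ in a cell of level
  \<open>r\<close>, which the later levels do not touch.\<close>

lemma leaves_distinct:
  assumes "ready r A" "r + n = m"
  shows "distinct (leaves n r A)"
  using assms
proof (induction n arbitrary: r A)
  case (Suc n)
  have r: "r < m" using Suc.prems(2) by simp
  note lt = level_ticks[OF Suc.prems(1) r]
  have disj: "set (leaves n (Suc r) C) \<inter> set (leaves n (Suc r) C') = {}"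
    if C: "C \<in> set (level_ticks r A)" "C' \<in> set (level_ticks r A)" "C \<noteq> C'" for C C'
  proof (rule ccontr)
    assume "set (leaves n (Suc r) C) \<inter> set (leaves n (Suc r) C') \<noteq> {}"
    then obtain B where B: "B \<in> set (leaves n (Suc r) C)" "B \<in> set (leaves n (Suc r) C')" by blast
    have n: "Suc r + n = m" using Suc.prems(2) by simp
    note a = leaves_agree[OF lt(2)[OF C(1)] n B(1)] leaves_agree[OF lt(2)[OF C(2)] n B(2)]
    have "C ! p = C' ! p" if p: "p < length C" for p
    proof (cases "outside r p")
      case True
      then show ?thesis using lt(1,4) C(1,2) p by metis
    next
      case False
      then obtain d where d: "d < kap" "p mod D = cls r d" by (auto simp: outside_def)
      have "outside r' p" if "Suc r \<le> r'" for r'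
        using d that cls_inj[of d _ r r'] by (auto simp: outside_def)
      then show ?thesis using a p lt(1) C(1,2) by simp
    qed
    then have "C = C'" using lt(1) C(1,2) by (intro nth_equalityI) auto
    then show False using C(3) by simp
  qed
  have IH: "distinct (leaves n (Suc r) C)" if "C \<in> set (level_ticks r A)" for C
    by (rule Suc.IH[OF lt(2)[OF that]]) (use Suc.prems(2) in simp)
  have "distinct (concat (map (leaves n (Suc r)) cs))"
    if "distinct cs" "set cs \<subseteq> set (level_ticks r A)" for cs
    using that
  proof (induction cs)
    case (Cons C cs)
    have C: "C \<in> set (level_ticks r A)" "set cs \<subseteq> set (level_ticks r A)" "C \<notin> set cs" "distinct cs"
      using Cons.prems by auto
    have "set (leaves n (Suc r) C) \<inter> (\<Union>C'\<in>set cs. set (leaves n (Suc r) C')) = {}"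
    proof (rule ccontr)
      assume "set (leaves n (Suc r) C) \<inter> (\<Union>C'\<in>set cs. set (leaves n (Suc r) C')) \<noteq> {}"
      then obtain C' B where B: "C' \<in> set cs" "B \<in> set (leaves n (Suc r) C) \<inter> set (leaves n (Suc r) C')" by auto
      have "C \<noteq> C'" "C' \<in> set (level_ticks r A)" using B(1) C by auto
      from disj[OF C(1) this(2,1)] B(2) show False by simp
    qed
    then show ?case using IH[OF C(1)] Cons.IH[OF C(4,2)] by simp
  qed simp
  then show ?case using level_ticks_distinct[OF Suc.prems(1) r] by simp
qed simp

lemma length_leaves:
  assumes "ready r A" "r + n = m" "length A = D * g"
  shows "length (leaves n r A) = (g * Suc g ^ (kap - 1)) ^ n"
  using assms
proof (induction n arbitrary: r A)
  case (Suc n)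
  have r: "r < m" using Suc.prems(2) by simp
  note lt = level_ticks[OF Suc.prems(1) r]
  have "length (leaves n (Suc r) C) = (g * Suc g ^ (kap - 1)) ^ n" if "C \<in> set (level_ticks r A)" for C
    by (rule Suc.IH[OF lt(2)[OF that]]) (use Suc.prems(2,3) lt(1)[OF that] in simp_all)
  then have "map (\<lambda>C. length (leaves n (Suc r) C)) (level_ticks r A)
      = map (\<lambda>_. (g * Suc g ^ (kap - 1)) ^ n) (level_ticks r A)" by simp
  then have "length (leaves (Suc n) r A) = length (level_ticks r A) * (g * Suc g ^ (kap - 1)) ^ n"
    by (simp only: leaves.simps length_concat map_map comp_def sum_list_triv of_nat_id)
  then show ?case using length_level_ticks[OF Suc.prems(1) r Suc.prems(3)] by simp
qed simp

lemma length_leaf: "ready r A \<Longrightarrow> r + n = m \<Longrightarrow> B \<in> set (leaves n r A) \<Longrightarrow> length B = length A"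
  using leaves_agree by blast

definition pval :: "(bool list \<Rightarrow> bool) \<Rightarrow> nat \<Rightarrow> bool list \<Rightarrow> bool" where
  "pval lb r A = xorl (map lb (leaves (m - r) r A))"

lemma pval_leaf: "pval lb m A = lb A"
  by (simp add: pval_def)

lemma pval_level: "r < m \<Longrightarrow> pval lb r A = xorl (map (pval lb (Suc r)) (level_ticks r A))"
proof -
  assume "r < m"
  then have "m - r = Suc (m - Suc r)" by simp
  then show ?thesis by (simp add: pval_def[abs_def] xorl_concat comp_def)
qed

text \<open>At most one sweep of digit 0 for each value of the other digits, with
  \<open>kap + 3\<close> to cover the carries. For fixed \<open>m\<close> and \<open>kap\<close> and
  \<open>length A = D * g\<close> this has the order of the number of ticks, so a tick takes
  constant time on average.\<close>

lemma clock_meas_start_le: "clock_meas r (Rt 0, 0, A) \<le> (kap + 3) * (2 * length A + 4) * Suc (length A) ^ (kap - 1)"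
proof -
  let ?L = "length A"
  have "weight (Suc ?L) r 0 A + 1 \<le> Suc ?L ^ (kap - 1)"
    using weight_low_le[where A = A and b = ?L and d = "kap - 1" and r = r] kap unfolding weight_def by simp
  then have "(kap + 1) * (weight (Suc ?L) r 0 A + 1) \<le> (kap + 1) * Suc ?L ^ (kap - 1)" by (rule mult_le_mono2)
  then have "potential r 0 A + 1 \<le> (kap + 1) * Suc ?L ^ (kap - 1)" unfolding potential_def by simp
  then have "(potential r 0 A + 1) * (2 * ?L + 4) \<le> (kap + 1) * Suc ?L ^ (kap - 1) * (2 * ?L + 4)" by (rule mult_le_mono1)
  also have "\<dots> \<le> (kap + 3) * (2 * ?L + 4) * Suc ?L ^ (kap - 1)" by (simp add: algebra_simps)
  finally show ?thesis by simp
qed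

end

section \<open>The parity game\<close>

text \<open>
  In \<open>Run r Guess b\<close>, player \<open>r\<close> pushes one bit per tick of level \<open>r\<close> onto the work tape, claiming
  that it is the parity below that tick; \<open>b\<close> is the parity that the remaining bits must have.
  In \<open>Run r Pick\<close>, player \<open>r + 1\<close> runs the same counter again, pops the bits, and picks a tick whose
  bit is wrong: \<open>Ret r b\<close> walks back to the left end with the opposite bit \<open>b\<close> as the new claim.
  In \<open>Run r Eval b\<close>, the input is read at every tick of the last level. \<open>Stop w j\<close> has verdict \<open>w\<close>.
  Player \<open>j\<close> is universal iff \<open>j\<close> is even, and such a player wants the machine to reject.
\<close>

datatype rmode = Guess | Pick | Eval

datatype mstate = Init | Run nat rmode bool clk nat | Ret nat bool nat | Stop bool nat

instance rmode :: countable
  by countable_datatype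

instance mstate :: countable
  by countable_datatype

fun player :: "mstate \<Rightarrow> nat" where
  "player Init = 0"
| "player (Run r md b k c) = (if md = Pick then r + 1 else r)"
| "player (Ret r b c) = r + 1"
| "player (Stop w j) = j"

context counter
begin

definition start_state :: "nat \<Rightarrow> bool \<Rightarrow> mstate" where
  "start_state r b = Run r (if r + 1 < m then Guess else Eval) b (Rt 0) 0"

text \<open>The control carries the head position modulo \<open>D\<close>, which tells it the digit
  of the cell being read.\<close>

fun adv :: "head_move \<Rightarrow> nat \<Rightarrow> nat" where
  "adv Move_Left c = (c + D - 1) mod D"
| "adv Stay c = c"
| "adv Move_Right c = (c + 1) mod D"

type_synonym effect = "mstate \<times> bool \<times> head_move \<times> nat \<times> head_move"

text \<open>A guesser whose bits miss the claimed parity has lost; otherwise the work head steps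
  back onto the last bit and the opponent takes over. A picker who has challenged nothing has lost.
  An evaluator wins iff no parity is left over.\<close>

fun finish :: "nat \<Rightarrow> rmode \<Rightarrow> bool \<Rightarrow> mstate \<times> head_move" where
  "finish r Guess b = (if b then (Stop (even r) r, Stay) else (Run r Pick False (Rt 0) 0, Move_Left))"
| "finish r Pick b = (Stop (odd r) (r + 1), Stay)"
| "finish r Eval b = (Stop (b = even r) r, Stay)"

text \<open>A challenge in \<open>Pick\<close> does not carry out the counter step, so it keeps the
  address from before the cell is set, the one recorded in \<open>ticks\<close>. \<open>Eval\<close>
  reads at that address as well.\<close>

fun on_tick :: "nat \<Rightarrow> rmode \<Rightarrow> bool \<Rightarrow> clk \<Rightarrow> nat \<Rightarrow> bool option \<Rightarrow> bool \<Rightarrow> nat \<Rightarrow> clk \<Rightarrow> bool \<Rightarrow> head_move \<Rightarrow> effect set" where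
  "on_tick r Guess b k c i a s k' v mv =
     (\<lambda>g. (Run r Guess (b \<noteq> g) k' (adv mv c), v, mv, of_bool g, Move_Right)) ` UNIV"
| "on_tick r Pick b k c i a s k' v mv =
     {(Run r Pick b k' (adv mv c), v, mv, s, Move_Left), (Ret r (s \<noteq> 1) c, a, Stay, s, Stay)}"
| "on_tick r Eval b k c i a s k' v mv =
     {(Run r Eval (b \<noteq> (i = Some True)) k' (adv mv c), v, mv, s, Stay)}"

text \<open>An empty address tape, which occurs only for inputs of length at most 1, has no room for
  the mark; the game then stops at once.\<close>

fun delta :: "mstate \<Rightarrow> bool option \<Rightarrow> bool option \<Rightarrow> nat \<Rightarrow> effect set" where
  "delta Init i a s =
     (if a = None then {(Stop False 0, False, Stay, s, Stay)} else {(start_state 0 True, True, Stay, s, Stay)})"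
| "delta (Run r md b k c) i a s =
     (case clock_act r k c a of
        None \<Rightarrow> {(fst (finish r md b), a = Some True, Stay, s, snd (finish r md b))}
      | Some (k', v, mv) \<Rightarrow>
          if k = Rt 0 \<and> c = cls r 0 \<and> a \<noteq> None then on_tick r md b k c i (a = Some True) s k' v mv
          else {(Run r md b k' (adv mv c), v, mv, s, Stay)})"
| "delta (Ret r b c) i a s =
     (if c = 0 \<and> a = Some True then {(start_state (r + 1) b, True, Stay, s, Stay)}
      else {(Ret r b (adv Move_Left c), a = Some True, Move_Left, s, Stay)})"
| "delta (Stop w j) i a s = {}"

definition clock_states :: "clk set" where
  "clock_states = Rt ` {..<kap} \<union> (\<lambda>(d, f). Lt d f) ` ({..<kap} \<times> UNIV)"

fun valid :: "mstate \<Rightarrow> bool" where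
  "valid Init \<longleftrightarrow> True"
| "valid (Run r md b k c) \<longleftrightarrow> r < m \<and> (md = Eval \<longleftrightarrow> r + 1 = m) \<and> k \<in> clock_states \<and> c < D"
| "valid (Ret r b c) \<longleftrightarrow> r + 1 < m \<and> c < D"
| "valid (Stop w j) \<longleftrightarrow> j < m"

definition Q :: "mstate set" where
  "Q = Collect valid"

lemma Q_iff [simp]: "q \<in> Q \<longleftrightarrow> valid q"
  by (simp add: Q_def)

lemma clock_states_simps [simp]: "Rt d \<in> clock_states \<longleftrightarrow> d < kap" "Lt d f \<in> clock_states \<longleftrightarrow> d < kap"
  by (auto simp: clock_states_def)

lemma finite_rmode: "finite (UNIV :: rmode set)"
proof -
  have "(UNIV :: rmode set) = {Guess, Pick, Eval}" using rmode.exhaust by auto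
  then show ?thesis by (metis finite.simps)
qed

lemma finite_Q: "finite Q"
proof -
  have c: "finite clock_states" by (simp add: clock_states_def)
  have "Q \<subseteq> {Init} \<union> (\<lambda>(r, md, b, k, c). Run r md b k c) ` ({..<m} \<times> UNIV \<times> UNIV \<times> clock_states \<times> {..<D})
       \<union> (\<lambda>(r, b, c). Ret r b c) ` ({..<m} \<times> UNIV \<times> {..<D}) \<union> (\<lambda>(w, j). Stop w j) ` (UNIV \<times> {..<m})"
    (is "Q \<subseteq> ?A")
  proof
    fix q assume q: "q \<in> Q"
    show "q \<in> ?A"
    proof (cases q)
      case (Run r md b k c)
      then have "q = (\<lambda>(r, md, b, k, c). Run r md b k c) (r, md, b, k, c)"
        "(r, md, b, k, c) \<in> {..<m} \<times> UNIV \<times> UNIV \<times> clock_states \<times> {..<D}" using q by auto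
      then show ?thesis by blast
    next
      case (Ret r b c)
      then have "q = (\<lambda>(r, b, c). Ret r b c) (r, b, c)" "(r, b, c) \<in> {..<m} \<times> UNIV \<times> {..<D}" using q by auto
      then show ?thesis by blast
    next
      case (Stop w j)
      then have "q = (\<lambda>(w, j). Stop w j) (w, j)" "(w, j) \<in> UNIV \<times> {..<m}" using q by auto
      then show ?thesis by blast
    qed simp
  qed
  moreover have "finite ?A" using c finite_rmode by (intro finite_UnI finite_imageI finite_cartesian_product) auto
  ultimately show ?thesis by (rule finite_subset)
qed

lemma finite_delta: "finite (delta q i a s)"
proof (cases q)
  case (Run r md b k c)
  have "finite (on_tick r md b k c i (a = Some True) s k' v mv)" for k' v mv
    by (cases md) auto
  then show ?thesis unfolding Run by (auto split: option.split)
qed auto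

lemma adv_less: "c < D \<Longrightarrow> adv mv c < D"
  by (cases mv) (auto simp: D_pos)

lemma clock_act_clock_states: "clock_act r k c a = Some (k', v, mv) \<Longrightarrow> k \<in> clock_states \<Longrightarrow> k' \<in> clock_states"
  using kap by (cases "(r, k, c, a)" rule: clock_act.cases) (auto split: if_splits)

lemma delta_closed:
  assumes "q \<in> Q" "(q', v, mv, w, d) \<in> delta q i a s" "s \<le> 1" "m \<ge> 1"
  shows "q' \<in> Q" "w \<le> 1" "player q' = player q \<or> player q' = Suc (player q)"
proof -
  have "q' \<in> Q \<and> w \<le> 1 \<and> (player q' = player q \<or> player q' = Suc (player q))"
  proof (cases q)
    case Init
    then show ?thesis using assms kap D_pos by (auto simp: start_state_def split: if_splits)
  next
    case (Run r md b k c)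
    show ?thesis
    proof (cases "clock_act r k c a")
      case None
      then show ?thesis using assms kap D_pos unfolding Run by (cases md) (auto split: if_splits)
    next
      case (Some z)
      obtain k' v' mv' where z: "z = (k', v', mv')" by (cases z)
      have "k' \<in> clock_states" using clock_act_clock_states[OF Some[unfolded z]] assms(1) Run by simp
      then show ?thesis using assms Some adv_less unfolding Run z
        by (cases md) (auto split: if_splits)
    qed
  next
    case (Ret r b c)
    then show ?thesis using assms kap D_pos adv_less by (auto simp: start_state_def split: if_splits)
  qed (use assms in auto)
  then show "q' \<in> Q" "w \<le> 1" "player q' = player q \<or> player q' = Suc (player q)" by auto
qed

lemma player_less: "q \<in> Q \<Longrightarrow> m \<ge> 1 \<Longrightarrow> player q < m"
  by (cases q) auto

definition trans_of :: "mstate \<Rightarrow> bool option \<Rightarrow> bool option \<Rightarrow> nat \<Rightarrow> effect \<Rightarrow> transition" where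
  "trans_of q i a s e = (case e of (q', v, mv, w, d) \<Rightarrow>
     \<lparr>from_state = to_nat q, read_input = i, read_addr = a, read_work = [s],
      to_state = to_nat q', write_addr = v, move_addr = mv, act_work = [(w, d)]\<rparr>)"

definition M :: ratm where
  "M = \<lparr>num_tapes = 1,
        universal = to_nat ` {q \<in> Q. even (player q)},
        existential = to_nat ` {q \<in> Q. odd (player q)},
        initial = to_nat Init,
        final = to_nat ` {Stop True j | j. j < m},
        work_alphabet = {0, 1},
        transitions = (\<Union>q\<in>Q. \<Union>i. \<Union>a. \<Union>s\<in>{0, 1}. trans_of q i a s ` delta q i a s)\<rparr>"

lemma transitions_M: "t \<in> transitions M \<longleftrightarrow>
    (\<exists>q i a s e. q \<in> Q \<and> s \<in> {0, 1} \<and> e \<in> delta q i a s \<and> t = trans_of q i a s e)"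
  unfolding M_def by (simp only: ratm.simps UN_iff image_iff) blast

lemma states_M: "states M = to_nat ` Q"
  by (auto simp: states_def M_def)

lemma wf_M: "m \<ge> 1 \<Longrightarrow> wf_ratm M"
proof -
  assume m: "m \<ge> 1"
  have "wf_transition M t" if t: "t \<in> transitions M" for t
  proof -
    obtain q i a s q' v mv w d where q: "q \<in> Q" "s \<in> {0, 1}" "(q', v, mv, w, d) \<in> delta q i a s"
      "t = trans_of q i a s (q', v, mv, w, d)"
      using t unfolding transitions_M by (metis prod_cases5)
    have ns: "q \<noteq> Stop True j" for j using q(3) by auto
    have "s \<le> 1" using q(2) by auto
    note dc = delta_closed[OF q(1,3) this m]
    have "to_nat q \<notin> final M" using ns by (auto simp: M_def)
    moreover have "w = 0 \<or> w = 1" using dc(2) by auto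
    ultimately show ?thesis using q(1,2) dc(1) unfolding q(4) wf_transition_def states_M
      by (auto simp: trans_of_def) (auto simp: M_def)
  qed
  moreover have "finite (transitions M)"
    using finite_Q finite_delta by (auto simp: M_def)
  moreover have "universal M \<inter> existential M = {}" by (auto simp: M_def)
  moreover have "final M \<subseteq> states M" unfolding states_M by (auto simp: M_def)
  moreover have "initial M \<in> states M" unfolding states_M by (auto simp: M_def)
  moreover have "finite (states M)" unfolding states_M using finite_Q by simp
  ultimately show ?thesis unfolding wf_ratm_def by (simp add: M_def)
qed

type_synonym mconfig = "mstate \<times> bool list \<times> nat \<times> (nat \<Rightarrow> nat) \<times> nat"

fun cfg :: "mconfig \<Rightarrow> config" where
  "cfg (q, A, p, f, h) = \<lparr>cur_state = to_nat q, addr_tape = A, addr_head = p, work_tapes = [(f, h)]\<rparr>"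

definition input_at :: "bool list \<Rightarrow> bool list \<Rightarrow> bool option" where
  "input_at x A = (let i = addr_value A in if i < length x then Some (x ! i) else None)"

fun mstep :: "bool list \<Rightarrow> mconfig \<Rightarrow> mconfig \<Rightarrow> bool" where
  "mstep x (q, A, p, f, h) X' \<longleftrightarrow> (\<exists>q' v mv w d. (q', v, mv, w, d) \<in> delta q (input_at x A) (cell_symbol p A) (f h) \<and>
     X' = (q', A[p := v], min (move_head mv p) (length A), f(h := w), move_head d h))"

lemma step_cfg:
  assumes "q \<in> Q" "f h \<le> 1"
  shows "step M x (cfg (q, A, p, f, h)) c' \<longleftrightarrow> (\<exists>X'. mstep x (q, A, p, f, h) X' \<and> c' = cfg X')"
proof
  assume "step M x (cfg (q, A, p, f, h)) c'"
  then obtain t where t: "t \<in> transitions M" "enabled x t (cfg (q, A, p, f, h))"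
    "c' = apply_transition t (cfg (q, A, p, f, h))" by (auto simp: step_def)
  then obtain q1 i a s q' v mv w d where q: "(q', v, mv, w, d) \<in> delta q1 i a s"
    "t = trans_of q1 i a s (q', v, mv, w, d)"
    unfolding transitions_M by (metis prod_cases5)
  have e: "q1 = q" "i = input_at x A" "a = cell_symbol p A" "s = f h"
    using t(2) by (auto simp: q(2) trans_of_def enabled_def input_symbol_def input_at_def addr_symbol_def cell_symbol_def)
  have "mstep x (q, A, p, f, h) (q', A[p := v], min (move_head mv p) (length A), f(h := w), move_head d h)"
    using q(1) e by auto
  moreover have "c' = cfg (q', A[p := v], min (move_head mv p) (length A), f(h := w), move_head d h)"
    using t(3) by (simp add: q(2) trans_of_def apply_transition_def)
  ultimately show "\<exists>X'. mstep x (q, A, p, f, h) X' \<and> c' = cfg X'" by blast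
next
  assume "\<exists>X'. mstep x (q, A, p, f, h) X' \<and> c' = cfg X'"
  then obtain q' v mv w d where q: "(q', v, mv, w, d) \<in> delta q (input_at x A) (cell_symbol p A) (f h)"
    "c' = cfg (q', A[p := v], min (move_head mv p) (length A), f(h := w), move_head d h)" by auto
  let ?t = "trans_of q (input_at x A) (cell_symbol p A) (f h) (q', v, mv, w, d)"
  have "f h \<in> {0, 1}" using assms(2) by auto
  then have "?t \<in> transitions M" using q(1) assms(1) unfolding transitions_M by blast
  moreover have "enabled x ?t (cfg (q, A, p, f, h))"
    by (simp add: trans_of_def enabled_def input_symbol_def input_at_def addr_symbol_def cell_symbol_def)
  moreover have "c' = apply_transition ?t (cfg (q, A, p, f, h))"
    by (simp add: q(2) trans_of_def apply_transition_def)
  ultimately show "step M x (cfg (q, A, p, f, h)) c'" by (auto simp: step_def)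
qed

section \<open>Invariant, time bound and winner of the game\<close>

text \<open>In \<open>Guess\<close>, the stack holds at least the \<open>s - t\<close> bits of the
  past ticks, possibly above leftovers of earlier levels. In \<open>Pick\<close>, the work head
  stands on the next bit to pop, so \<open>Suc h\<close> bits are available for the \<open>t\<close>
  ticks to come.\<close>

fun game_inv :: "mconfig \<Rightarrow> bool" where
  "game_inv (q, A, p, f, h) \<longleftrightarrow> q \<in> Q \<and> (\<forall>i. f i \<le> 1) \<and>
     (case q of
        Init \<Rightarrow> A = replicate (length A) False \<and> p = 0
      | Run r md b k c \<Rightarrow> clock_inv r (k, p, A) \<and> c = p mod D \<and> ready r (clear_level r A) \<and>
          (let t = length (ticks r (k, p, A)); s = length (level_ticks r (clear_level r A)) in
           case md of Guess \<Rightarrow> t \<le> s \<and> s \<le> h + t | Pick \<Rightarrow> t \<le> Suc h | Eval \<Rightarrow> True)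
      | Ret r b c \<Rightarrow> p < length A \<and> c = p mod D \<and> ready (Suc r) A
      | Stop w j \<Rightarrow> True)"

definition run_bound :: "nat \<Rightarrow> nat" where
  "run_bound l = (kap + 3) * (2 * l + 4) * Suc l ^ (kap - 1)"

definition level_bound :: "nat \<Rightarrow> nat" where
  "level_bound l = 2 * run_bound l + l + 5"

text \<open>A level takes two runs of the counter and one walk back. The summand for the mode
  reserves time for the phases of the level that are still ahead.\<close>

fun game_meas :: "mconfig \<Rightarrow> nat" where
  "game_meas (q, A, p, f, h) = (let l = length A in
     case q of
       Init \<Rightarrow> m * level_bound l + 1
     | Run r md b k c \<Rightarrow> (m - 1 - r) * level_bound l + clock_meas r (k, p, A) + 1 +
         (case md of Guess \<Rightarrow> run_bound l + l + 3 | Pick \<Rightarrow> l + 3 | Eval \<Rightarrow> 0)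
     | Ret r b c \<Rightarrow> (m - 1 - r) * level_bound l + p + 2
     | Stop w j \<Rightarrow> 0)"

definition stack :: "(nat \<Rightarrow> nat) \<Rightarrow> nat \<Rightarrow> bool list" where
  "stack f h = map (\<lambda>i. f i = 1) (rev [0..<h])"

lemma stack_Suc: "stack f (Suc h) = (f h = 1) # stack f h"
  by (simp add: stack_def)

lemma stack_push: "stack (f(h := w)) h = stack f h"
  by (auto simp: stack_def)

lemma length_stack [simp]: "length (stack f h) = h"
  by (simp add: stack_def)

definition leaf_bit :: "bool list \<Rightarrow> bool list \<Rightarrow> bool" where
  "leaf_bit x A \<longleftrightarrow> input_at x A = Some True"

text \<open>
  The value of a configuration for the player to move. Pushing and popping reverse the order, so
  the bits pushed so far belong to the last ticks; a \<open>Guess\<close> position is won iff they are all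
  correct and the target parity is still the true one.
\<close>

fun wins :: "bool list \<Rightarrow> mconfig \<Rightarrow> bool" where
  "wins x (q, A, p, f, h) =
     (case q of
        Init \<Rightarrow> pval (leaf_bit x) 0 (A[0 := True])
      | Run r md b k c \<Rightarrow>
          (let P = pval (leaf_bit x) (Suc r); ts = ticks r (k, p, A); t = length ts;
               all = level_ticks r (clear_level r A) in
           case md of
             Guess \<Rightarrow> take (length all - t) (stack f h) = map P (drop t all) \<and> b = xorl (map P (take t all))
           | Pick \<Rightarrow> \<exists>l<t. stack f (Suc h) ! l \<noteq> P (ts ! l)
           | Eval \<Rightarrow> b = xorl (map P ts))
      | Ret r b c \<Rightarrow> b = pval (leaf_bit x) (Suc r) A
      | Stop w j \<Rightarrow> w = odd j)"

declare Let_def [simp]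

lemma adv_correct:
  assumes "clock_inv r (k, p, A)" "clock_act r k (p mod D) (cell_symbol p A) = Some (k', v, mv)"
  shows "adv mv (p mod D) = min (move_head mv p) (length A) mod D"
proof -
  have A: "marked A" "p \<le> length A" using assms(1) by (cases k; simp)+
  have left: "p > 0" if "mv = Move_Left"
  proof (cases k)
    case (Rt d)
    have "A \<noteq> []" using A(1) by (simp add: marked_def)
    then show ?thesis using assms(2) that Rt A(2) by (auto simp: cell_symbol_def split: if_splits)
  next
    case (Lt d f)
    have p: "p < length A" using assms(1) Lt by simp
    show ?thesis
    proof (rule ccontr)
      assume "\<not> p > 0"
      then have "p = 0" "A ! 0" using A(1) p by (auto simp: marked_def)
      then show False using assms(2) that Lt p by (auto simp: cell_symbol_def split: if_splits)
    qed
  qed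
  have right: "p < length A" if "mv = Move_Right"
    using assms that by (cases k) (auto simp: cell_symbol_def split: if_splits)
  show ?thesis
  proof (cases mv)
    case Move_Left
    then obtain p' where p': "p = Suc p'" using left by (cases p) auto
    have "p mod D + D - 1 = p mod D + (D - 1)" using D_pos by simp
    then have "(p mod D + D - 1) mod D = (p + (D - 1)) mod D" by (simp add: mod_simps)
    also have "p + (D - 1) = p' + D" using p' D_pos by simp
    finally show ?thesis using Move_Left p' A(2) by (simp add: min_def)
  next
    case Stay
    then show ?thesis using A(2) by (simp add: min_def)
  next
    case Move_Right
    then show ?thesis using right by (simp add: min_def mod_simps)
  qed
qed

lemma clock_run:
  assumes "clock_inv r (k, p, A)" "r < m" "clock_act r k (p mod D) (cell_symbol p A) = Some (k', v, mv)"
    and "p' = min (move_head mv p) (length A)"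
  shows "clock_inv r (k', p', A[p := v])" "clear_level r (A[p := v]) = clear_level r A"
    "clock_meas r (k', p', A[p := v]) < clock_meas r (k, p, A)"
    "ticks r (k, p, A) = (if tick r (k, p, A) then [A] else []) @ ticks r (k', p', A[p := v])"
proof -
  have c: "clock_step r (k, p, A) = Some (k', p', A[p := v])" using assms(3,4) by (simp add: clock_step.simps)
  show "clock_inv r (k', p', A[p := v])" by (rule clock_inv_clock_step[OF assms(1,2) c])
  show "clear_level r (A[p := v]) = clear_level r A" using clear_level_clock_step[OF assms(1,2) c] by simp
  show "clock_meas r (k', p', A[p := v]) < clock_meas r (k, p, A)" by (rule clock_meas_clock_step[OF assms(1,2) c])
  show "ticks r (k, p, A) = (if tick r (k, p, A) then [A] else []) @ ticks r (k', p', A[p := v])"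
    unfolding ticks_step[OF assms(1,2)] c by (simp del: tick.simps)
qed

lemma clock_end:
  assumes "clock_inv r (k, p, A)" "r < m" "clock_act r k (p mod D) (cell_symbol p A) = None"
  shows "clear_level r A = A" "p = 0" "ticks r (k, p, A) = []" "p < length A"
proof -
  have c: "clock_step r (k, p, A) = None" using assms(3) by (simp add: clock_step.simps)
  show "clear_level r A = A" "p = 0" using clear_level_stop[OF assms(1,2) c] by auto
  have "\<not> tick r (k, p, A)" using tick_clock_step c by (metis option.distinct(1))
  then show "ticks r (k, p, A) = []" unfolding ticks_step[OF assms(1,2)] c by (simp del: tick.simps)
  have "marked A" using assms(1) by (cases k) auto
  then show "p < length A" using \<open>p = 0\<close> by (simp add: marked_def)
qed

lemma clock_meas_pos: "clock_meas r s > 0"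
  by (cases "(r, s)" rule: clock_meas.cases) simp_all

lemma rewrite_cell_symbol: "p < length A \<Longrightarrow> A[p := (cell_symbol p A = Some True)] = A"
  by (simp add: cell_symbol_def list_update_same_conv)

definition apply_effect :: "bool list \<Rightarrow> nat \<Rightarrow> (nat \<Rightarrow> nat) \<Rightarrow> nat \<Rightarrow> effect \<Rightarrow> mconfig" where
  "apply_effect A p f h e = (case e of (q', v, mv, w, d) \<Rightarrow>
     (q', A[p := v], min (move_head mv p) (length A), f(h := w), move_head d h))"

definition succs :: "bool list \<Rightarrow> mconfig \<Rightarrow> mconfig set" where
  "succs x X = (case X of (q, A, p, f, h) \<Rightarrow> apply_effect A p f h ` delta q (input_at x A) (cell_symbol p A) (f h))"

lemma mstep_succs: "mstep x X X' \<longleftrightarrow> X' \<in> succs x X"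
proof -
  obtain q A p f h where X: "X = (q, A, p, f, h)" by (metis prod_cases5)
  show ?thesis unfolding X by (auto simp: succs_def apply_effect_def image_iff Bex_def)
qed

definition tape :: "mconfig \<Rightarrow> bool list" where
  "tape X = fst (snd X)"

lemma tape_simps [simp]: "tape (q, A, s) = A"
  by (simp add: tape_def)

definition good :: "bool list \<Rightarrow> mconfig \<Rightarrow> mconfig \<Rightarrow> bool" where
  "good x X X' \<longleftrightarrow> game_inv X' \<and> length (tape X') = length (tape X) \<and> game_meas X' < game_meas X"

text \<open>\<open>wins\<close> always refers to the player to move: a good move leads to a won
  position of the same player or to a lost one of the next.\<close>

definition win_move :: "bool list \<Rightarrow> mconfig \<Rightarrow> mconfig \<Rightarrow> bool" where
  "win_move x X X' \<longleftrightarrow> (wins x X' \<longleftrightarrow> player (fst X') = player (fst X))"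

lemma start_state:
  assumes "ready r A" "r < m" "\<And>i. f i \<le> 1"
  shows "game_inv (start_state r b, A, 0, f, h)"
    "game_meas (start_state r b, A, 0, f, h) \<le> (m - 1 - r) * level_bound (length A) + 2 * run_bound (length A) + length A + 4"
    "wins x (start_state r b, A, 0, f, h) \<longleftrightarrow> b = pval (leaf_bit x) r A"
    "player (start_state r b) = r"
proof -
  have clear_level: "clear_level r A = A" using assms(1,2) by (simp add: ready_def)
  have cv: "clock_inv r (Rt 0, 0, A)" by (rule clock_inv_start[OF assms(1,2)])
  note eq = level_ticks_def[of r A, symmetric]
  show "game_inv (start_state r b, A, 0, f, h)"
    using assms cv clear_level kap D_pos by (auto simp: start_state_def eq)
  have "clock_meas r (Rt 0, 0, A) \<le> run_bound (length A)"
    using clock_meas_start_le[of r A] by (simp add: run_bound_def)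
  then show "game_meas (start_state r b, A, 0, f, h) \<le> (m - 1 - r) * level_bound (length A) + 2 * run_bound (length A) + length A + 4"
    by (auto simp: start_state_def Let_def simp del: clock_meas.simps)
  show "wins x (start_state r b, A, 0, f, h) \<longleftrightarrow> b = pval (leaf_bit x) r A"
    unfolding pval_level[OF assms(2)] by (simp add: start_state_def eq clear_level Let_def)
  show "player (start_state r b) = r" by (simp add: start_state_def)
qed

lemma succs_Init:
  assumes "game_inv (Init, A, p, f, h)" "m \<ge> 1"
  shows "succs x (Init, A, p, f, h) \<noteq> {}" "\<forall>X'\<in>succs x (Init, A, p, f, h). good x (Init, A, p, f, h) X'"
    "A \<noteq> [] \<Longrightarrow> wins x (Init, A, p, f, h) \<longleftrightarrow> (\<exists>X'\<in>succs x (Init, A, p, f, h). win_move x (Init, A, p, f, h) X')"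
proof -
  have inv: "A = replicate (length A) False" "p = 0" "\<And>i. f i \<le> 1" using assms(1) by auto
  let ?A = "A[0 := True]"
  have ev: "succs x (Init, A, p, f, h) = {(start_state 0 True, ?A, 0, f, h)}" if "A \<noteq> []"
    using that inv(2) by (simp add: succs_def apply_effect_def cell_symbol_def)
  have ev0: "succs x (Init, A, p, f, h) = {(Stop False 0, [], 0, f, h)}" if "A = []"
    using that inv(2) by (simp add: succs_def apply_effect_def cell_symbol_def)
  have rd: "ready 0 ?A" if "A \<noteq> []"
  proof -
    have nth: "?A ! i \<longleftrightarrow> i = 0" if "i < length A" for i
    proof -
      have "\<not> A ! i" by (subst inv(1)) (use that in simp)
      then show ?thesis using that by (simp add: nth_update)
    qed
    have "marked ?A" using that nth by (auto simp: marked_def)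
    moreover have "clear_level r ?A = ?A" for r
      unfolding clear_level_id_iff digit_all_def
    proof (intro allI impI)
      fix d i assume i: "i < length ?A" "i mod D = cls r d"
      then have "i \<noteq> 0" using cls_pos[of r d] by (intro notI) simp
      then show "?A ! i = False" using nth[of i] i(1) by simp
    qed
    ultimately show ?thesis by (simp add: ready_def)
  qed
  show "succs x (Init, A, p, f, h) \<noteq> {}" using ev ev0 by (cases "A = []") auto
  show "\<forall>X'\<in>succs x (Init, A, p, f, h). good x (Init, A, p, f, h) X'"
  proof (cases "A = []")
    case True
    then show ?thesis using ev0 inv(3) assms(2) by (simp add: good_def)
  next
    case False
    have m: "(m - 1) * level_bound (length A) + level_bound (length A) = m * level_bound (length A)"
      using assms(2) by (metis add.commute mult_Suc Suc_diff_1 less_le_trans less_one)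
    have "game_meas (start_state 0 True, ?A, 0, f, h) < game_meas (Init, A, p, f, h)"
      using start_state(2)[OF rd[OF False], where b = True and f = f and h = h] inv(3) assms(2) m by (simp add: level_bound_def)
    then show ?thesis using ev[OF False] start_state(1)[OF rd[OF False], where b = True and f = f and h = h] inv(3) assms(2)
      by (simp add: good_def del: game_inv.simps game_meas.simps)
  qed
  assume ne: "A \<noteq> []"
  show "wins x (Init, A, p, f, h) \<longleftrightarrow> (\<exists>X'\<in>succs x (Init, A, p, f, h). win_move x (Init, A, p, f, h) X')"
    unfolding ev[OF ne] using start_state(3)[OF rd[OF ne], where b = True and f = f and h = h] start_state(4)[OF rd[OF ne] _ inv(3)] inv(3) assms(2)
    by (simp add: win_move_def del: wins.simps) simp
qed

lemma succs_Ret: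
  assumes "game_inv (Ret r b c, A, p, f, h)"
  shows "succs x (Ret r b c, A, p, f, h) \<noteq> {}" "\<forall>X'\<in>succs x (Ret r b c, A, p, f, h). good x (Ret r b c, A, p, f, h) X'"
    "wins x (Ret r b c, A, p, f, h) \<longleftrightarrow> (\<exists>X'\<in>succs x (Ret r b c, A, p, f, h). win_move x (Ret r b c, A, p, f, h) X')"
proof -
  let ?X = "(Ret r b c, A, p, f, h)"
  have inv: "p < length A" "c = p mod D" "ready (Suc r) A" "r + 1 < m" "\<And>i. f i \<le> 1" using assms by auto
  have mk: "marked A" using inv(3) by (simp add: ready_def)
  have sy: "cell_symbol p A = Some (A ! p)" using inv(1) by (simp add: cell_symbol_def)
  have left_end: "c = 0 \<and> A ! p \<longleftrightarrow> p = 0" using mk inv(1,2) by (auto simp: marked_def)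
  have "succs x ?X \<noteq> {} \<and> (\<forall>X'\<in>succs x ?X. good x ?X X') \<and> (wins x ?X \<longleftrightarrow> (\<exists>X'\<in>succs x ?X. win_move x ?X X'))"
  proof (cases "p = 0")
    case True
    have "A[p := True] = A" using left_end True list_update_same_conv[OF inv(1)] by auto
    then have ev: "succs x ?X = {(start_state (r + 1) b, A, 0, f, h)}"
      using left_end True sy by (simp add: succs_def apply_effect_def)
    have r: "Suc r < m" using inv(4) by simp
    have "m - 1 - r = Suc (m - 1 - Suc r)" using r by simp
    then have "(m - 1 - r) * level_bound (length A) = (m - 1 - Suc r) * level_bound (length A) + level_bound (length A)"
      by (simp only: mult_Suc add.commute)
    then have "game_meas (start_state (r + 1) b, A, 0, f, h) < game_meas ?X"
      using start_state(2)[OF inv(3) r, where b = b and f = f and h = h] inv(5) True by (simp add: level_bound_def)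
    then show ?thesis using start_state(1-3)[OF inv(3) r, where b = b and f = f and h = h]
        start_state(4)[OF inv(3) r inv(5)] inv(5) unfolding ev
      by (simp add: good_def win_move_def del: game_inv.simps game_meas.simps wins.simps) simp
  next
    case False
    have "A[p := A ! p] = A" by simp
    moreover have "\<not> (c = 0 \<and> A ! p)" using False left_end by blast
    ultimately have ev: "succs x ?X = {(Ret r b (adv Move_Left c), A, p - 1, f, h)}"
      using sy inv(1) by (auto simp: succs_def apply_effect_def min_def)
    obtain p' where p': "p = Suc p'" using False by (cases p) auto
    have "c + D - 1 = c + (D - 1)" using D_pos by simp
    then have "adv Move_Left c = (p + (D - 1)) mod D" by (simp add: inv(2) mod_simps)
    also have "p + (D - 1) = p' + D" using p' D_pos by simp
    finally have c: "adv Move_Left c = (p - 1) mod D" using p' by simp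
    show ?thesis unfolding ev using inv c D_pos p' by (simp add: good_def win_move_def)
  qed
  then show "succs x ?X \<noteq> {}" "\<forall>X'\<in>succs x ?X. good x ?X X'" "wins x ?X \<longleftrightarrow> (\<exists>X'\<in>succs x ?X. win_move x ?X X')"
    by auto
qed

lemma take_map_iff:
  assumes "length ys = t" "t \<le> length us"
  shows "take t us = map P ys \<longleftrightarrow> \<not> (\<exists>l<t. us ! l \<noteq> P (ys ! l))"
  using assms by (auto simp: list_eq_iff_nth_eq)

lemma succs_end:
  assumes "game_inv (Run r md b k c, A, p, f, h)" "clock_act r k c (cell_symbol p A) = None"
  defines "X \<equiv> (Run r md b k c, A, p, f, h)"
  shows "succs x X \<noteq> {} \<and> (\<forall>X'\<in>succs x X. good x X X') \<and> (wins x X \<longleftrightarrow> (\<exists>X'\<in>succs x X. win_move x X X'))"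
proof -
  have inv: "clock_inv r (k, p, A)" "c = p mod D" "ready r (clear_level r A)" "r < m" "\<And>i. f i \<le> 1" "md = Eval \<longleftrightarrow> r + 1 = m"
    using assms(1) by auto
  note ce = clock_end[OF inv(1,4) assms(2)[unfolded inv(2)]]
  have rd: "ready r A" using inv(3) ce(1) by simp
  have ev: "succs x X = {(fst (finish r md b), A, 0, f, move_head (snd (finish r md b)) h)}"
    using assms(2) ce(2,4) rewrite_cell_symbol[OF ce(4)] by (simp add: X_def succs_def apply_effect_def)
  show ?thesis
  proof (cases md)
    case Guess
    have rm: "r + 1 < m" using inv(4,6) Guess by auto
    let ?all = "level_ticks r A"
    have s: "length ?all \<le> h" using assms(1) Guess ce(1,3) by simp
    have w: "wins x X \<longleftrightarrow> take (length ?all) (stack f h) = map (pval (leaf_bit x) (Suc r)) ?all \<and> \<not> b"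
      using Guess ce(1,3) by (simp add: X_def)
    show ?thesis
    proof (cases b)
      case True
      have "good x X (Stop (even r) r, A, 0, f, h)"
        using inv(4,5) Guess by (simp add: good_def X_def)
      then show ?thesis unfolding ev w using Guess True by (simp add: win_move_def X_def)
    next
      case False
      let ?X = "(Run r Pick False (Rt 0) 0, A, 0, f, h - 1)"
      have ev': "succs x X = {?X}" using ev Guess False by simp
      have cv: "clock_inv r (Rt 0, 0, A)" by (rule clock_inv_start[OF rd inv(4)])
      have mi: "game_inv ?X" using inv(4,5) rm cv kap D_pos rd ce(1) s
        by (simp del: clock_inv.simps add: level_ticks_def[symmetric])
      have "clock_meas r (Rt 0, 0, A) \<le> run_bound (length A)"
        using clock_meas_start_le[of r A] by (simp add: run_bound_def)
      then have me: "game_meas ?X < game_meas X" using Guess clock_meas_pos[of r "(k, p, A)"] by (simp add: X_def del: clock_meas.simps)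
      \<comment> \<open>Here the turn passes: the guesser wins iff the picker has no wrong bit to
        challenge.\<close>
      have "take (length ?all) (stack f h) = map (pval (leaf_bit x) (Suc r)) ?all
          \<longleftrightarrow> \<not> (\<exists>l<length ?all. stack f h ! l \<noteq> pval (leaf_bit x) (Suc r) (?all ! l))"
        by (rule take_map_iff) (use s in auto)
      also have "\<dots> \<longleftrightarrow> \<not> wins x ?X"
      proof (cases "length ?all = 0")
        case True
        then show ?thesis by (simp add: level_ticks_def[symmetric])
      next
        case False
        then have "Suc (h - 1) = h" using s by linarith
        then show ?thesis by (simp add: level_ticks_def[symmetric])
      qed
      finally have "wins x X \<longleftrightarrow> \<not> wins x ?X" using w False by simp
      then show ?thesis unfolding ev' using mi me Guess
        by (simp add: good_def win_move_def X_def del: wins.simps game_inv.simps game_meas.simps)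
    qed
  next
    case Pick
    have rm: "r + 1 < m" using inv(4,6) Pick by auto
    have "good x X (Stop (odd r) (r + 1), A, 0, f, h)"
      using rm inv(5) Pick by (simp add: good_def X_def)
    moreover have "\<not> wins x X" using Pick ce(3) by (simp add: X_def)
    ultimately show ?thesis unfolding ev using Pick by (simp add: win_move_def X_def)
  next
    case Eval
    have "good x X (Stop (b = even r) r, A, 0, f, h)"
      using inv(4,5) Eval by (simp add: good_def X_def)
    moreover have "wins x X \<longleftrightarrow> \<not> b" using Eval ce(3) by (simp add: X_def)
    ultimately show ?thesis unfolding ev using Eval by (simp add: win_move_def X_def) blast
  qed
qed

lemma tick_cell_symbol: "tick r (k, p, A) \<longleftrightarrow> k = Rt 0 \<and> p mod D = cls r 0 \<and> cell_symbol p A \<noteq> None"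
  by (auto simp: cell_symbol_def)

lemma succs_move:
  assumes "game_inv (Run r md b k c, A, p, f, h)" "clock_act r k c (cell_symbol p A) = Some (k', v, mv)"
    "\<not> tick r (k, p, A)"
  defines "X \<equiv> (Run r md b k c, A, p, f, h)"
  shows "succs x X \<noteq> {} \<and> (\<forall>X'\<in>succs x X. good x X X') \<and> (wins x X \<longleftrightarrow> (\<exists>X'\<in>succs x X. win_move x X X'))"
proof -
  have inv: "clock_inv r (k, p, A)" "c = p mod D" "ready r (clear_level r A)" "r < m" "\<And>i. f i \<le> 1" "md = Eval \<longleftrightarrow> r + 1 = m"
    "k \<in> clock_states" "c < D"
    using assms(1) by auto
  define p' where "p' = min (move_head mv p) (length A)"
  note cr = clock_run[OF inv(1,4) assms(2)[unfolded inv(2)] p'_def]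
  have ad: "adv mv c = p' mod D" using adv_correct[OF inv(1) assms(2)[unfolded inv(2)]] inv(2) p'_def by simp
  let ?X = "(Run r md b k' (adv mv c), A[p := v], p', f, h)"
  have ev: "succs x X = {?X}"
    using assms(2,3) inv(2) unfolding tick_cell_symbol by (auto simp: X_def succs_def apply_effect_def p'_def)
  have t: "ticks r (k', p', A[p := v]) = ticks r (k, p, A)" using cr(4) assms(3) by simp
  have "game_inv ?X"
    using assms(1) inv cr(1,2) ad t clock_act_clock_states[OF assms(2) inv(7)] adv_less[OF inv(8)]
    by (cases md) (simp_all del: clock_inv.simps)
  moreover have "game_meas ?X < game_meas X" using cr(3) by (cases md) (simp_all add: X_def del: clock_meas.simps)
  moreover have "wins x ?X \<longleftrightarrow> wins x X" using t cr(2) by (cases md) (simp_all add: X_def)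
  ultimately show ?thesis unfolding ev
    by (simp add: good_def win_move_def X_def del: wins.simps game_inv.simps game_meas.simps)
qed

text \<open>In \<open>Guess\<close> the only good bit is the true parity below the tick at which it
  will be popped. In \<open>Pick\<close> a wrong bit is challenged now or later. In
  \<open>Eval\<close> the bit read is removed from the target.\<close>

lemma succs_tick:
  assumes "game_inv (Run r md b k c, A, p, f, h)" "clock_act r k c (cell_symbol p A) = Some (k', v, mv)"
    "tick r (k, p, A)"
  defines "X \<equiv> (Run r md b k c, A, p, f, h)"
  shows "succs x X \<noteq> {} \<and> (\<forall>X'\<in>succs x X. good x X X') \<and> (wins x X \<longleftrightarrow> (\<exists>X'\<in>succs x X. win_move x X X'))"
proof -
  have inv: "clock_inv r (k, p, A)" "c = p mod D" "ready r (clear_level r A)" "r < m" "\<And>i. f i \<le> 1" "md = Eval \<longleftrightarrow> r + 1 = m"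
    "k \<in> clock_states" "c < D"
    using assms(1) by auto
  define p' where "p' = min (move_head mv p) (length A)"
  note cr = clock_run[OF inv(1,4) assms(2)[unfolded inv(2)] p'_def]
  have ad: "adv mv c = p' mod D" using adv_correct[OF inv(1) assms(2)[unfolded inv(2)]] inv(2) p'_def by simp
  have pl: "p < length A" using assms(3) by simp
  let ?P = "pval (leaf_bit x) (Suc r)"
  let ?all = "level_ticks r (clear_level r A)"
  let ?Y = "\<lambda>b f h. (Run r md b k' (adv mv c), A[p := v], p', f, h)"
  define ts where "ts = ticks r (k', p', A[p := v])"
  have t: "ticks r (k, p, A) = A # ts" using cr(4) assms(3) by (simp add: ts_def)
  have k': "k' \<in> clock_states" by (rule clock_act_clock_states[OF assms(2) inv(7)])
  have me: "game_meas (?Y b' f' h') < game_meas X" for b' f' h'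
    using cr(3) by (cases md) (simp_all add: X_def del: clock_meas.simps)
  have ev: "succs x X = apply_effect A p f h ` on_tick r md b k c (input_at x A) (cell_symbol p A = Some True) (f h) k' v mv"
    using assms(2,3) inv(2) unfolding tick_cell_symbol by (simp add: X_def succs_def)
  show ?thesis
  proof (cases md)
    case Guess
    let ?Z = "\<lambda>g. ?Y (b \<noteq> g) (f(h := of_bool g)) (Suc h)"
    have ev': "succs x X = range ?Z"
      unfolding ev using Guess by (auto simp: apply_effect_def p'_def image_image)
    have len: "length ts < length ?all" "length ?all \<le> h + Suc (length ts)"
      using assms(1) Guess t by auto
    have g: "good x X (?Z g)" for g
      using assms(1) inv cr(1,2) ad k' adv_less[OF inv(8)] Guess len me[of "b \<noteq> g"]
      by (simp add: good_def X_def ts_def[symmetric] del: clock_inv.simps game_meas.simps)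
    have dr: "drop (length ts) ?all = ?all ! length ts # drop (Suc (length ts)) ?all"
      using len(1) by (simp add: Cons_nth_drop_Suc)
    have ta: "take (Suc (length ts)) ?all = take (length ts) ?all @ [?all ! length ts]"
      using len(1) by (simp add: take_Suc_conv_app_nth)
    have df: "length ?all - length ts = Suc (length ?all - Suc (length ts))" using len(1) by simp
    have wX: "wins x X \<longleftrightarrow> take (length ?all - Suc (length ts)) (stack f h) = map ?P (drop (Suc (length ts)) ?all)
        \<and> b = (xorl (map ?P (take (length ts) ?all)) \<noteq> ?P (?all ! length ts))"
      using Guess t ta by (simp add: X_def)
    \<comment> \<open>Popping reverses the order, so the bit pushed now belongs to the mirrored
      tick, whose index is \<open>length ts\<close>.\<close>
    have wZ: "wins x (?Z g) \<longleftrightarrow> g = ?P (?all ! length ts)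
        \<and> take (length ?all - Suc (length ts)) (stack f h) = map ?P (drop (Suc (length ts)) ?all)
        \<and> (b \<noteq> g) = xorl (map ?P (take (length ts) ?all))" for g
      using Guess cr(2) dr by (simp add: ts_def[symmetric] df stack_Suc stack_push)
    have "wins x X \<longleftrightarrow> (\<exists>g. wins x (?Z g))" unfolding wX wZ by auto
    moreover have "player (fst (?Z g)) = player (fst X)" for g using Guess by (simp add: X_def)
    ultimately show ?thesis unfolding ev' using g by (auto simp: win_move_def simp del: wins.simps)
  next
    case Pick
    have rm: "r + 1 < m" using inv(4,6) Pick by auto
    let ?X1 = "?Y b f (h - 1)" and ?X2 = "(Ret r (f h \<noteq> 1) c, A, p, f, h)"
    have ev': "succs x X = {?X1, ?X2}"
      unfolding ev using Pick pl rewrite_cell_symbol[OF pl] by (simp add: apply_effect_def p'_def)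
    have len: "length ts \<le> h" using assms(1) Pick t by simp
    have g1: "good x X ?X1"
      using assms(1) inv cr(1,2) ad k' adv_less[OF inv(8)] Pick len me[of b]
      by (simp add: good_def X_def ts_def[symmetric] del: clock_inv.simps game_meas.simps)
    have "ready (Suc r) A"
      by (rule ready_agree[OF inv(3)]) (auto simp: clear_level_def outside_def)
    moreover have "game_meas ?X2 < game_meas X" using Pick pl by (simp add: X_def)
    ultimately have g2: "good x X ?X2"
      using inv(2,5,8) rm pl by (simp add: good_def X_def del: game_meas.simps)
    have "wins x X \<longleftrightarrow> (f h = 1) \<noteq> ?P A \<or> (\<exists>l<length ts. stack f h ! l \<noteq> ?P (ts ! l))"
      using Pick t by (auto simp: X_def stack_Suc less_Suc_eq_0_disj)
    moreover have "wins x ?X2 \<longleftrightarrow> (f h = 1) \<noteq> ?P A" by auto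
    moreover have "wins x ?X1 \<longleftrightarrow> (\<exists>l<length ts. stack f h ! l \<noteq> ?P (ts ! l))"
    proof (cases "h = 0")
      case True
      then show ?thesis using len Pick by (simp add: ts_def[symmetric])
    next
      case False
      then have "Suc (h - 1) = h" by simp
      then show ?thesis using Pick by (simp add: ts_def[symmetric])
    qed
    ultimately have "wins x X \<longleftrightarrow> wins x ?X1 \<or> wins x ?X2" by blast
    then show ?thesis unfolding ev' using g1 g2 Pick by (simp add: win_move_def X_def del: wins.simps)
  next
    case Eval
    have rm: "Suc r = m" using inv(6) Eval by simp
    let ?X1 = "?Y (b \<noteq> leaf_bit x A) f h"
    have ev': "succs x X = {?X1}"
      unfolding ev using Eval by (simp add: apply_effect_def p'_def leaf_bit_def)
    have g1: "good x X ?X1"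
      using assms(1) inv cr(1,2) ad k' adv_less[OF inv(8)] Eval me[of "b \<noteq> leaf_bit x A"]
      by (simp add: good_def X_def del: clock_inv.simps game_meas.simps)
    have "?P A = leaf_bit x A" unfolding rm by (rule pval_leaf)
    then have "wins x X \<longleftrightarrow> wins x ?X1" using Eval t by (auto simp: X_def ts_def[symmetric])
    then show ?thesis unfolding ev' using g1 Eval by (simp add: win_move_def X_def del: wins.simps)
  qed
qed

lemma succs_main:
  assumes "game_inv (q, A, p, f, h)" "m \<ge> 1" "\<And>w j. q \<noteq> Stop w j"
  shows "succs x (q, A, p, f, h) \<noteq> {}" "\<forall>X'\<in>succs x (q, A, p, f, h). good x (q, A, p, f, h) X'"
    "A \<noteq> [] \<Longrightarrow> wins x (q, A, p, f, h) \<longleftrightarrow> (\<exists>X'\<in>succs x (q, A, p, f, h). win_move x (q, A, p, f, h) X')"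
proof -
  let ?X = "(q, A, p, f, h)"
  have "succs x ?X \<noteq> {} \<and> (\<forall>X'\<in>succs x ?X. good x ?X X')
      \<and> (A \<noteq> [] \<longrightarrow> (wins x ?X \<longleftrightarrow> (\<exists>X'\<in>succs x ?X. win_move x ?X X')))"
  proof (cases q)
    case Init
    then show ?thesis using succs_Init[of A p f h x] assms(1,2) by blast
  next
    case (Run r md b k c)
    show ?thesis
    proof (cases "clock_act r k c (cell_symbol p A)")
      case None
      show ?thesis using succs_end[OF assms(1)[unfolded Run] None, of x] unfolding Run by blast
    next
      case (Some z)
      obtain k' v mv where z: "z = (k', v, mv)" by (cases z)
      show ?thesis
        using succs_tick[OF assms(1)[unfolded Run] Some[unfolded z], of x]
          succs_move[OF assms(1)[unfolded Run] Some[unfolded z], of x] unfolding Run by blast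
    qed
  next
    case (Ret r b c)
    then show ?thesis using succs_Ret[of r b c A p f h x] assms(1) by blast
  next
    case (Stop w j)
    then show ?thesis using assms(3) by blast
  qed
  then show "succs x ?X \<noteq> {}" "\<forall>X'\<in>succs x ?X. good x ?X X'"
    "A \<noteq> [] \<Longrightarrow> wins x ?X \<longleftrightarrow> (\<exists>X'\<in>succs x ?X. win_move x ?X X')" by auto
qed

section \<open>The hierarchy\<close>

lemma mode_cfg: "q \<in> Q \<Longrightarrow> cur_state (cfg (q, A, p, f, h)) \<in> universal M \<longleftrightarrow> even (player q)"
  "q \<in> Q \<Longrightarrow> cur_state (cfg (q, A, p, f, h)) \<in> existential M \<longleftrightarrow> odd (player q)"
  "q \<in> Q \<Longrightarrow> cur_state (cfg (q, A, p, f, h)) \<in> final M \<longleftrightarrow> (\<exists>j. q = Stop True j)"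
  by (auto simp: M_def)

lemma succs_Stop: "succs x (Stop w j, A, p, f, h) = {}"
  by (simp add: succs_def)

lemma step_succs:
  assumes "game_inv X"
  shows "step M x (cfg X) c' \<longleftrightarrow> (\<exists>X'\<in>succs x X. c' = cfg X')"
proof -
  obtain q A p f h where X: "X = (q, A, p, f, h)" by (metis prod_cases5)
  have qf: "q \<in> Q" "f h \<le> 1" using assms unfolding X by auto
  show ?thesis unfolding X step_cfg[of q f h, OF qf] mstep_succs by blast
qed

lemma player_succs:
  assumes "game_inv X" "m \<ge> 1" "X' \<in> succs x X"
  shows "player (fst X') = player (fst X) \<or> player (fst X') = Suc (player (fst X))"
proof -
  obtain q A p f h where X: "X = (q, A, p, f, h)" by (metis prod_cases5)
  obtain e where e: "e \<in> delta q (input_at x A) (cell_symbol p A) (f h)" "X' = apply_effect A p f h e"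
    using assms(3) unfolding X by (auto simp: succs_def)
  obtain q' v mv w d where e': "e = (q', v, mv, w, d)" by (metis prod_cases5)
  show ?thesis using delta_closed(3)[OF _ e(1)[unfolded e'] _ assms(2)] assms(1) e(2) unfolding X e'
    by (simp add: apply_effect_def)
qed

text \<open>Backward induction: odd players are existential and want acceptance, even ones want
  rejection. A move raises the player by at most one, so the parity of the player shows whether the
  turn has passed.\<close>

lemma accepting_iff_wins:
  assumes "game_inv X" "tape X \<noteq> []" "m \<ge> 1"
  shows "accepting M x (cfg X) \<longleftrightarrow> (wins x X \<longleftrightarrow> odd (player (fst X)))"
  using assms(1,2)
proof (induction "game_meas X" arbitrary: X rule: less_induct)
  case less
  obtain q A p f h where X: "X = (q, A, p, f, h)" by (metis prod_cases5)
  have q: "q \<in> Q" and A: "A \<noteq> []" using less.prems unfolding X by auto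
  note mode = mode_cfg[OF q, of A p f h]
  have disj: "universal M \<inter> existential M = {}" by (auto simp: M_def)
  show ?case
  proof (cases "\<exists>w j. q = Stop w j")
    case True
    then obtain w j where wj: "q = Stop w j" by blast
    have ns: "\<not> step M x (cfg X) c'" for c'
      using step_succs[OF less.prems(1)] succs_Stop unfolding X wj by simp
    have "accepting M x (cfg X) \<longleftrightarrow> w"
    proof
      assume "accepting M x (cfg X)"
      then have "cur_state (cfg X) \<in> final M" by cases (use ns in auto)
      then show w using mode(3) unfolding X wj by auto
    next
      assume w
      then have "cur_state (cfg X) \<in> final M" using mode(3) unfolding X wj by auto
      then show "accepting M x (cfg X)" by (rule accepting.final)
    qed
    then show ?thesis unfolding X wj by auto
  next
    case False
    note sm = succs_main[OF less.prems(1)[unfolded X] assms(3), of x]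
    have sm: "succs x X \<noteq> {}" "\<forall>X'\<in>succs x X. good x X X'" "wins x X \<longleftrightarrow> (\<exists>X'\<in>succs x X. win_move x X X')"
      using sm False A unfolding X by blast+
    have IH: "accepting M x (cfg X') \<longleftrightarrow> (win_move x X X' \<longleftrightarrow> odd (player (fst X)))" if X': "X' \<in> succs x X" for X'
    proof -
      have g: "game_inv X'" "length (tape X') = length (tape X)" "game_meas X' < game_meas X"
        using sm(2) X' by (auto simp: good_def)
      have "tape X' \<noteq> []" using g(2) less.prems(2) by auto
      from less.hyps[OF g(3,1) this] show ?thesis
        using player_succs[OF less.prems(1) assms(3) X'] unfolding win_move_def by auto
    qed
    have nf: "cur_state (cfg X) \<notin> final M" using mode(3) False unfolding X by auto
    show ?thesis
    proof (cases "odd (player q)")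
      case True
      have e: "cur_state (cfg X) \<in> existential M" using mode(2) True unfolding X by blast
      then have nu: "cur_state (cfg X) \<notin> universal M" using disj by blast
      have "accepting M x (cfg X) \<longleftrightarrow> (\<exists>X'\<in>succs x X. accepting M x (cfg X'))"
      proof
        assume "accepting M x (cfg X)"
        then show "\<exists>X'\<in>succs x X. accepting M x (cfg X')"
          by cases (use nf nu step_succs[OF less.prems(1)] in auto)
      next
        assume "\<exists>X'\<in>succs x X. accepting M x (cfg X')"
        then show "accepting M x (cfg X)"
          using step_succs[OF less.prems(1)] accepting.existential[OF e] by blast
      qed
      also have "\<dots> \<longleftrightarrow> wins x X" using IH sm(3) True unfolding X by auto
      finally show ?thesis using True unfolding X by simp
    next
      case False
      have u: "cur_state (cfg X) \<in> universal M" using mode(1) False unfolding X by blast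
      then have ne: "cur_state (cfg X) \<notin> existential M" using disj by blast
      have "accepting M x (cfg X) \<longleftrightarrow> (\<forall>X'\<in>succs x X. accepting M x (cfg X'))"
      proof
        assume "accepting M x (cfg X)"
        then show "\<forall>X'\<in>succs x X. accepting M x (cfg X')"
          by cases (use nf ne step_succs[OF less.prems(1)] in auto)
      next
        assume a: "\<forall>X'\<in>succs x X. accepting M x (cfg X')"
        show "accepting M x (cfg X)"
          by (rule accepting.universal[OF u]) (use a sm(1) step_succs[OF less.prems(1)] in auto)
      qed
      also have "\<dots> \<longleftrightarrow> \<not> wins x X" using IH sm(3) False unfolding X by auto
      finally show ?thesis using False unfolding X by simp
    qed
  qed
qed

text \<open>The mode is the parity of the player, which never decreases and stays below
  \<open>m\<close>; so every new block uses up one player.\<close>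

lemma run_bounds:
  assumes "run_from M x (cfg X) cs" "game_inv X" "m \<ge> 1"
  shows "length cs - 1 \<le> game_meas X \<and> num_blocks M cs + player (fst X) \<le> m"
  using assms(1,2)
proof (induction cs arbitrary: X)
  case Nil
  then show ?case by (simp add: run_from_def)
next
  case (Cons c cs)
  obtain q A p f h where X: "X = (q, A, p, f, h)" by (metis prod_cases5)
  have q: "q \<in> Q" using Cons.prems(2) unfolding X by auto
  have c: "c = cfg X" using Cons.prems(1) by (simp add: run_from_def)
  have pl: "player q < m" by (rule player_less[OF q assms(3)])
  show ?case
  proof (cases cs)
    case Nil
    then show ?thesis using pl unfolding X by (simp add: num_blocks_def)
  next
    case (Cons c' cs')
    then have st: "step M x (cfg X) c'" "successively (step M x) cs"
      using Cons.prems(1) c by (auto simp: run_from_def)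
    then obtain X' where X': "X' \<in> succs x X" "c' = cfg X'" using step_succs[OF Cons.prems(2)] by blast
    have ns: "\<And>w j. q \<noteq> Stop w j" using X'(1) unfolding X by (auto simp: succs_def)
    have g: "game_inv X'" "game_meas X' < game_meas X"
      using succs_main(2)[OF Cons.prems(2)[unfolded X] assms(3) ns, of x] X'(1) unfolding X by (auto simp: good_def)
    have "run_from M x (cfg X') cs" using st(2) Cons X'(2) by (simp add: run_from_def)
    from Cons.IH[OF this g(1)]
    have IH: "length cs - 1 \<le> game_meas X'" "num_blocks M cs + player (fst X') \<le> m" by auto
    obtain q' A' p' f' h' where X'': "X' = (q', A', p', f', h')" by (metis prod_cases5)
    have q': "q' \<in> Q" using g(1) unfolding X'' by auto
    have "same_mode M c c' \<longleftrightarrow> (even (player q) \<longleftrightarrow> even (player q'))"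
      unfolding same_mode_def c X'(2) X X'' using mode_cfg(1)[OF q] mode_cfg(1)[OF q'] by blast
    moreover have "player q' = player q \<or> player q' = Suc (player q)"
      using player_succs[OF Cons.prems(2) assms(3) X'(1)] unfolding X X'' by simp
    moreover have "num_blocks M (c # cs) = num_blocks M cs + (if same_mode M c c' then 0 else 1)"
      using num_blocks_Cons[of cs M c] Cons by simp
    ultimately have "num_blocks M (c # cs) + player q \<le> m" using IH(2) unfolding X'' by auto
    moreover have "length (c # cs) - 1 \<le> game_meas X" using IH(1) g(2) Cons by simp
    ultimately show ?thesis unfolding X by simp
  qed
qed

definition init :: "nat \<Rightarrow> mconfig" where
  "init l = (Init, replicate l False, 0, \<lambda>_. 0, 0)"

lemma game_inv_init: "game_inv (init l)"
  by (simp add: init_def)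

lemma init_config_M: "init_config M x = cfg (init (addr_length (length x)))"
  by (simp add: init_config_def init_def) (simp add: M_def)

lemma init_M: "m \<ge> 1 \<Longrightarrow> initial M \<in> universal M"
  by (auto simp: M_def)

lemma game_meas_init: "game_meas (init l) = m * level_bound l + 1"
  by (simp add: init_def)

lemma addr_length_log: "n \<ge> 2 \<Longrightarrow> real (addr_length n) \<le> 2 * log 2 (real n) \<and> 1 \<le> log 2 (real n)"
proof -
  assume n: "n \<ge> 2"
  have l: "1 \<le> log 2 (real n)" using n by (simp add: le_log_iff)
  have "real (addr_length n) = of_int \<lceil>log 2 (real n)\<rceil>" using l by (simp add: addr_length_def)
  also have "\<dots> \<le> log 2 (real n) + 1" by linarith
  finally show ?thesis using l by simp
qed

lemma level_bound_log:
  assumes "1 \<le> l" "real L \<le> 2 * l"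
  shows "real (level_bound L) \<le> (16 * real (kap + 3) * 3 ^ (kap - 1) + 7) * l ^ kap"
proof -
  have lk: "l \<le> l ^ kap" using self_le_power[of l kap] assms(1) kap by simp
  have "real (Suc L) ^ (kap - 1) \<le> (3 * l) ^ (kap - 1)" by (rule power_mono) (use assms in auto)
  then have "real (kap + 3) * (2 * real L + 4) * real (Suc L) ^ (kap - 1)
      \<le> real (kap + 3) * (8 * l) * (3 * l) ^ (kap - 1)"
    using assms by (intro mult_mono) auto
  also have "\<dots> = 8 * real (kap + 3) * 3 ^ (kap - 1) * (l * l ^ (kap - 1))"
    by (simp add: power_mult_distrib)
  also have "l * l ^ (kap - 1) = l ^ kap" using kap by (simp flip: power_Suc)
  finally have "real (run_bound L) \<le> 8 * real (kap + 3) * 3 ^ (kap - 1) * l ^ kap"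
    by (simp add: run_bound_def)
  moreover have "real L + 5 \<le> 7 * l ^ kap" using assms lk by linarith
  ultimately show ?thesis by (simp add: level_bound_def algebra_simps)
qed

lemma language_M_ATIME:
  assumes "m \<ge> 1"
  shows "language M \<in> ATIME_op (\<lambda>n. log 2 (real n) ^ kap) m"
proof -
  let ?T = "\<lambda>n. game_meas (init (addr_length n))"
  let ?C = "real m * (16 * real (kap + 3) * 3 ^ (kap - 1) + 7) + 1"
  have "(\<lambda>n. real (?T n)) \<in> O(\<lambda>n. log 2 (real n) ^ kap)"
  proof (rule bigoI)
    show "\<forall>\<^sub>F n in at_top. norm (real (?T n)) \<le> ?C * norm (log 2 (real n) ^ kap)"
      using eventually_ge_at_top[of "2::nat"]
    proof eventually_elim
      case (elim n)
      note al = addr_length_log[OF elim]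
      have "1 \<le> log 2 (real n) ^ kap" using al by (simp add: one_le_power)
      moreover have "real m * real (level_bound (addr_length n))
          \<le> real m * ((16 * real (kap + 3) * 3 ^ (kap - 1) + 7) * log 2 (real n) ^ kap)"
        using level_bound_log[of "log 2 (real n)" "addr_length n"] al by (intro mult_left_mono) auto
      ultimately have "real (?T n) \<le> ?C * log 2 (real n) ^ kap"
        by (simp add: game_meas_init algebra_simps)
      then show ?case using al by simp
    qed
  qed
  moreover have run: "run_from M x (cfg (init (addr_length (length x)))) cs" if "computation M x cs" for x cs
    using that by (simp add: computation_def run_from_def init_config_M)
  have "length cs - 1 \<le> ?T (length x) \<and> num_blocks M cs \<le> m" if "computation M x cs" for x cs
    using run_bounds[OF run[OF that] game_inv_init assms] by linarith
  ultimately have "wf_ratm M \<and> initial M \<in> universal M \<and>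
      (\<exists>T :: nat \<Rightarrow> nat. (\<lambda>n. real (T n)) \<in> O(\<lambda>n. log 2 (real n) ^ kap) \<and>
         (\<forall>x cs. computation M x cs \<longrightarrow> length cs - 1 \<le> T (length x))) \<and>
      (\<forall>x cs. computation M x cs \<longrightarrow> num_blocks M cs \<le> m)"
    using wf_M[OF assms] init_M[OF assms] by (intro conjI exI[of _ ?T]) simp_all
  then show ?thesis unfolding ATIME_op_def by (intro CollectI exI[of _ M]) (rule conjI[OF refl])
qed

lemma addr_value_less: "addr_value A < 2 ^ length A"
  using horner_sum_of_bool_2_less[of "rev A"] by (simp add: addr_value_def)

lemma addr_value_inj: "length A = length B \<Longrightarrow> addr_value A = addr_value B \<Longrightarrow> A = B"
proof -
  assume a: "length A = length B" "addr_value A = addr_value B"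
  have "rev A ! i = rev B ! i" if "i < length A" for i
  proof -
    have "bit (horner_sum of_bool 2 (rev A) :: nat) i = bit (horner_sum of_bool 2 (rev B) :: nat) i"
      using a(2) by (simp add: addr_value_def)
    then show ?thesis using that a(1) by (simp add: bit_horner_sum_bit_iff)
  qed
  then have "rev A = rev B" using a(1) by (intro nth_equalityI) auto
  then show "A = B" by simp
qed

lemma addr_length_power: "addr_length (2 ^ l) = l"
  by (simp add: addr_length_def log_nat_power)

definition base :: "nat \<Rightarrow> bool list" where
  "base l = (replicate l False)[0 := True]"

text \<open>Used for inputs of length \<open>2 ^ l\<close>: their address tape has \<open>l\<close>
  cells and no address points past the input bits.\<close>

definition hard_addresses :: "nat \<Rightarrow> nat set" where
  "hard_addresses l = addr_value ` set (leaves m 0 (base l))"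

lemma ready_base:
  assumes "l \<ge> 1"
  shows "ready 0 (base l)"
proof -
  have nth: "base l ! i \<longleftrightarrow> i = 0" if "i < l" for i
    using that by (simp add: base_def nth_update)
  have len: "length (base l) = l" by (simp add: base_def)
  have "marked (base l)" using assms nth len by (auto simp: marked_def)
  moreover have "clear_level r (base l) = base l" for r
    unfolding clear_level_id_iff digit_all_def
  proof (intro allI impI)
    fix d i assume i: "i < length (base l)" "i mod D = cls r d"
    then have "i \<noteq> 0" using cls_pos[of r d] by (intro notI) simp
    then show "base l ! i = False" using nth[of i] i(1) len by simp
  qed
  ultimately show ?thesis by (simp add: ready_def)
qed

lemma inj_addr_leaves: "l \<ge> 1 \<Longrightarrow> inj_on addr_value (set (leaves m 0 (base l)))"
  using length_leaf[OF ready_base, of l m] by (intro inj_onI addr_value_inj) auto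

lemma card_hard_addresses:
  assumes "g \<ge> 1"
  shows "card (hard_addresses (D * g)) = (g * Suc g ^ (kap - 1)) ^ m"
proof -
  have l: "D * g \<ge> 1" using assms D_pos by (simp add: Suc_le_eq)
  have "card (hard_addresses (D * g)) = card (set (leaves m 0 (base (D * g))))"
    unfolding hard_addresses_def by (rule card_image[OF inj_addr_leaves[OF l]])
  also have "\<dots> = length (leaves m 0 (base (D * g)))"
    by (rule distinct_card[OF leaves_distinct[OF ready_base[OF l]]]) simp
  also have "\<dots> = (g * Suc g ^ (kap - 1)) ^ m"
    by (rule length_leaves[OF ready_base[OF l]]) (simp_all add: base_def)
  finally show ?thesis .
qed

text \<open>The universal first player claims that the parity is odd and, when this is true, forces
  rejection; hence the negation.\<close>

lemma language_M_parity:
  assumes "m \<ge> 1" "l \<ge> 1"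
  shows "input_of (hard_addresses l) (2 ^ l) y \<in> language M \<longleftrightarrow> parity (hard_addresses l) y \<noteq> True"
proof -
  let ?V = "hard_addresses l" and ?x = "input_of (hard_addresses l) (2 ^ l) y"
  have len: "length ?x = 2 ^ l" by (simp add: input_of_def)
  have "init_config M ?x = cfg (init l)" by (simp add: init_config_M len addr_length_power)
  then have "?x \<in> language M \<longleftrightarrow> \<not> wins ?x (init l)"
    using accepting_iff_wins[OF game_inv_init _ assms(1), of l ?x] assms(2)
    by (simp add: language_def init_def)
  also have "wins ?x (init l) \<longleftrightarrow> xorl (map (leaf_bit ?x) (leaves m 0 (base l)))"
    by (simp add: init_def base_def pval_def)
  also have "map (leaf_bit ?x) (leaves m 0 (base l)) = map (\<lambda>A. y (addr_value A)) (leaves m 0 (base l))"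
  proof (rule map_cong[OF refl])
    fix A assume A: "A \<in> set (leaves m 0 (base l))"
    then have "length A = l" using length_leaf[OF ready_base[OF assms(2)], of m A] by (simp add: base_def)
    then have "addr_value A < 2 ^ l" using addr_value_less[of A] by simp
    moreover have "addr_value A \<in> ?V" using A by (simp add: hard_addresses_def)
    ultimately show "leaf_bit ?x A = y (addr_value A)"
      by (simp add: leaf_bit_def input_at_def len) (simp add: input_of_def)
  qed
  also have "xorl (map (\<lambda>A. y (addr_value A)) (leaves m 0 (base l))) = parity ?V y"
    unfolding hard_addresses_def
    by (rule xorl_distinct[OF leaves_distinct[OF ready_base[OF assms(2)]] inj_addr_leaves[OF assms(2)]]) simp
  finally show ?thesis by simp
qed

text \<open>At one large length \<open>2 ^ l\<close> the assumed machine yields a formula of width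
  \<open>w = O(l ^ k)\<close>. Each of the \<open>m - 1\<close> restrictions divides the number of
  variables by \<open>O(w)\<close>, and \<open>w + 1\<close> of them must remain; so
  \<open>O(w) ^ m\<close> variables are too many for it, and the game uses of the order of
  \<open>(l ^ (k + 1)) ^ m\<close>.\<close>

lemma language_M_not_ATIME:
  assumes "m \<ge> 1" "kap = Suc k"
  shows "language M \<notin> ATIME_op (\<lambda>n. log 2 (real n) ^ k) m"
proof
  assume "language M \<in> ATIME_op (\<lambda>n. log 2 (real n) ^ k) m"
  then obtain M' T where M': "language M = language M'" "wf_ratm M'" "initial M' \<in> universal M'"
    "(\<lambda>n. real (T n)) \<in> O(\<lambda>n. log 2 (real n) ^ k)"
    "\<And>x cs. computation M' x cs \<Longrightarrow> length cs - 1 \<le> T (length x)"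
    "\<And>x cs. computation M' x cs \<Longrightarrow> num_blocks M' cs \<le> m"
    unfolding ATIME_op_def by blast
  from M'(4) obtain C where C: "C > 0" "\<forall>\<^sub>F n in at_top. norm (real (T n)) \<le> C * norm (log 2 (real n) ^ k)"
    by (elim landau_o.bigE)
  then obtain N where N: "\<And>n. n \<ge> N \<Longrightarrow> norm (real (T n)) \<le> C * norm (log 2 (real n) ^ k)"
    unfolding eventually_sequentially by blast
  define a where "a = card (transitions M')"
  \<comment> \<open>Chosen so that \<open>w = E * g ^ k\<close> with \<open>E\<close> independent of
    \<open>g\<close>.\<close>
  define E where "E = (a + 2) * (nat \<lceil>C\<rceil> * D ^ k)"
  \<comment> \<open>A constant with \<open>(2 ^ w) ^ (m - 1) < q ^ Suc w\<close>, which pays for the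
    union bound.\<close>
  define q where "q = (2::nat) ^ m"
  \<comment> \<open>The second bound gives \<open>8 * w * q + w + 1 \<le> g ^ Suc k\<close>;
    \<open>N\<close> puts \<open>2 ^ l\<close> in the range of the asymptotic time bound.\<close>
  define g where "g = max N (8 * E * q + E + 2)"
  define l where "l = D * g"
  define r where "r = nat \<lceil>C\<rceil> * l ^ k"
  \<comment> \<open>One number for two bounds: the width \<open>2 * r\<close>, and the fan-in
    \<open>(2 ^ a) ^ r \<le> 2 ^ w\<close>.\<close>
  define w where "w = (a + 2) * r"
  have g1: "g \<ge> 1" by (simp add: g_def)
  have lg: "l \<ge> g" using D_pos by (simp add: l_def)
  then have l1: "l \<ge> 1" using g1 by simp
  have "N \<le> 2 ^ l"
  proof -
    have "N \<le> l" using lg by (simp add: g_def)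
    also have "l < 2 ^ l" by (rule less_exp)
    finally show ?thesis by simp
  qed
  from N[OF this] have "real (T (2 ^ l)) \<le> C * real l ^ k" by (simp add: log_nat_power)
  also have "\<dots> \<le> real (nat \<lceil>C\<rceil>) * real l ^ k" using C(1) by (intro mult_right_mono) auto
  also have "\<dots> = real r" by (simp add: r_def)
  finally have T: "T (2 ^ l) \<le> r" by simp
  let ?V = "hard_addresses l"
  have "Pi_lev ?V (2 * r) ((2 ^ a) ^ r) (m - 1) (\<lambda>y. input_of ?V (2 ^ l) y \<in> language M')"
  proof (rule language_Pi_lev[OF M'(2,3)])
    show "length cs - 1 \<le> r" if "computation M' x cs" "length x = 2 ^ l" for x cs
      using M'(5)[OF that(1)] that(2) T by simp
    show "num_blocks M' cs \<le> Suc (m - 1)" if "computation M' x cs" for x cs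
      using M'(6)[OF that] assms(1) by simp
    show "card (transitions M') \<le> 2 ^ a" unfolding a_def by (simp add: less_exp less_imp_le)
  qed simp
  then have "Pi_lev ?V (2 * r) ((2 ^ a) ^ r) (m - 1) (\<lambda>y. parity ?V y \<noteq> True)"
    unfolding M'(1)[symmetric] language_M_parity[OF assms(1) l1] .
  moreover have "2 * r \<le> w" "(2 ^ a) ^ r \<le> (2::nat) ^ w"
    by (auto simp: w_def power_mult[symmetric])
  ultimately have Pi: "Pi_lev ?V w (2 ^ w) (m - 1) (\<lambda>y. parity ?V y \<noteq> True)" by (rule Pi_lev_mono)
  have w: "w = E * g ^ k" by (simp add: w_def r_def l_def E_def power_mult_distrib algebra_simps)
  have big: "8 * w * q + w + 1 \<le> g ^ Suc k"
  proof -
    have "8 * w * q + w + 1 \<le> (8 * E * q + E) * g ^ k + g ^ k"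
      using g1 by (simp add: w algebra_simps)
    also have "\<dots> = (8 * E * q + E + 1) * g ^ k" by simp
    also have "\<dots> \<le> g * g ^ k" by (rule mult_le_mono1) (simp add: g_def)
    finally show ?thesis by simp
  qed
  have "g * g ^ k \<le> g * Suc g ^ k" by (intro mult_le_mono power_mono) auto
  then have big': "8 * w * q + w + 1 \<le> g * Suc g ^ k"
    using big unfolding power_Suc by (rule order_trans[rotated])
  show False
  proof (rule parity_lower_bound[OF _ Pi])
    show "finite ?V" by (simp add: hard_addresses_def)
    have "(2 ^ w) ^ (m - 1) = (2::nat) ^ (w * (m - 1))" by (simp add: power_mult)
    also have "\<dots> < 2 ^ (m * Suc w)"
    proof (rule power_strict_increasing)
      have "w * (m - 1) \<le> w * m" by simp
      also have "\<dots> < m * Suc w" using assms(1) by (simp add: mult.commute)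
      finally show "w * (m - 1) < m * Suc w" .
    qed simp
    also have "\<dots> = q ^ Suc w" unfolding q_def by (rule power_mult)
    finally show "(2 ^ w) ^ (m - 1) < q ^ Suc w" .
    \<comment> \<open>Both the loss factor of a restriction and the final \<open>Suc w\<close> are
      at most \<open>g * Suc g ^ k\<close>, the number of ticks of a level.\<close>
    have "(8 * w * q + 1) ^ (m - 1) * Suc w \<le> (g * Suc g ^ k) ^ (m - 1) * (g * Suc g ^ k)"
      using big' by (intro mult_le_mono power_mono) auto
    also have "\<dots> = (g * Suc g ^ k) ^ m" using assms(1) by (metis Suc_diff_1 less_le_trans less_one mult.commute power_Suc)
    also have "\<dots> = card ?V" using card_hard_addresses[OF g1] assms(2) by (simp add: l_def)
    finally show "(8 * w * q + 1) ^ (m - 1) * Suc w \<le> card ?V" .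
  qed simp
qed

end

lemma ATIME_op_mono:
  assumes "f \<in> O(g)"
  shows "ATIME_op f m \<subseteq> ATIME_op g m"
proof -
  have "h \<in> O(g)" if "h \<in> O(f)" for h :: "nat \<Rightarrow> real"
    using landau_o.big_trans[OF that assms] .
  then show ?thesis unfolding ATIME_op_def by fast
qed

lemma log_power_mono: "k \<le> k' \<Longrightarrow> (\<lambda>n. log 2 (real n) ^ k) \<in> O(\<lambda>n :: nat. log 2 (real n) ^ k')"
proof (rule bigoI[where c = 1])
  assume k: "k \<le> k'"
  show "\<forall>\<^sub>F n in at_top. norm (log 2 (real n) ^ k) \<le> 1 * norm (log 2 (real n) ^ k')"
    using eventually_ge_at_top[of "2::nat"]
  proof eventually_elim
    case (elim n)
    have "1 \<le> log 2 (real n)" using elim by (simp add: le_log_iff)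
    then show ?case using k by (simp add: power_increasing)
  qed
qed

text \<open>One more digit than the exponent \<open>k\<close> puts the game just beyond time
  \<open>log ^ k\<close>, for every number of blocks. The statement with \<open>k + 2\<close>
  follows by monotonicity.\<close>

theorem ATIME_op_hierarchy:
  assumes "m \<ge> 1"
  shows "ATIME_op (\<lambda>n. log 2 (real n) ^ k) m \<subset> ATIME_op (\<lambda>n. log 2 (real n) ^ (k + 1)) m"
proof -
  interpret counter m "k + 1" by unfold_locales simp
  have "language M \<in> ATIME_op (\<lambda>n. log 2 (real n) ^ (k + 1)) m" by (rule language_M_ATIME[OF assms])
  moreover have "language M \<notin> ATIME_op (\<lambda>n. log 2 (real n) ^ k) m" by (rule language_M_not_ATIME[OF assms]) simp
  moreover have "ATIME_op (\<lambda>n. log 2 (real n) ^ k) m \<subseteq> ATIME_op (\<lambda>n. log 2 (real n) ^ (k + 1)) m"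
    by (rule ATIME_op_mono[OF log_power_mono]) simp
  ultimately show ?thesis by blast
qed

theorem theorem6:
  shows "(\<forall>k::nat. k > 1 \<longrightarrow>
            ATIME_op (\<lambda>n. log 2 (real n) ^ k) 2 \<subset> ATIME_op (\<lambda>n. log 2 (real n) ^ (k + 1)) 2) \<and>
         (\<forall>m k::nat. m > 2 \<longrightarrow> k > 1 \<longrightarrow>
            ATIME_op (\<lambda>n. log 2 (real n) ^ k) m \<subset> ATIME_op (\<lambda>n. log 2 (real n) ^ (k + 2)) m)"
proof (intro conjI allI impI)
  fix k :: nat
  show "ATIME_op (\<lambda>n. log 2 (real n) ^ k) 2 \<subset> ATIME_op (\<lambda>n. log 2 (real n) ^ (k + 1)) 2"
    by (rule ATIME_op_hierarchy) simp
next
  fix m k :: nat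
  assume "m > 2"
  then have "ATIME_op (\<lambda>n. log 2 (real n) ^ k) m \<subset> ATIME_op (\<lambda>n. log 2 (real n) ^ (k + 1)) m"
    by (intro ATIME_op_hierarchy) simp
  also have "\<dots> \<subseteq> ATIME_op (\<lambda>n. log 2 (real n) ^ (k + 2)) m"
    by (rule ATIME_op_mono[OF log_power_mono]) simp
  finally show "ATIME_op (\<lambda>n. log 2 (real n) ^ k) m \<subset> ATIME_op (\<lambda>n. log 2 (real n) ^ (k + 2)) m" .
qed

end
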